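(* Let $\mathbb{T}^2=\mathbb{C}^2/\Lambda$ be a two-dimensional complex torus and let $(X,\mathcal{L})$ be a lamination by Riemann surfaces holomorphically embedded in $\mathbb{T}^2$ without invariant complex line segments. Then there exist $\epsilon_0>0$, $A>0$ and a covering $\{B_i\}$ of the lamination by flow boxes such that for every $\epsilon\in\mathbb{C}$ with $0<|\epsilon|<\epsilon_0$, for each of the translations $\tau=\tau_{(\epsilon,0)}$ and $\tau=\tau_{(0,\epsilon)}$, and for any two plaques $L_1,L_2$ of the same flow box $B_i$, the number of intersection points of $L_1$ and $L_2^\epsilon=\tau(L_2)$ is at most $A\log(1/|\epsilon|)$.
   Context: $\pi:\mathbb{C}^2\to\mathbb{T}^2$ is the projection; $\tau_{(\epsilon_1,\epsilon_2)}$ denotes the automorphism of $\mathbb{T}^2$ induced by the translation $(x_1,x_2)\mapsto(x_1+\epsilon_1,x_2+\epsilon_2)$ of $\mathbb{C}^2$. A lamination by Riemann surfaces embedded in a complex surface is a compact set $X$ covered by flow boxes in which $X$ is a union of disjoint holomorphic discs (plaques) varying continuously in a transversal parameter. The lamination has an invariant complex line segment if there are an affine complex line $Y\subset\mathbb{C}^2$ and an open set $U\subset\mathbb{C}^2$ with $\emptyset\neq Y\cap U\subset\pi^{-1}(X)\cap U$. *)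

theory Defs
  imports "HOL-Analysis.Analysis"
begin

text \<open>We model C^2 as complex \<times> complex. The torus T^2 = C^2 / Lambda is modelled
  upstairs: a point of the torus is the coset z + Lambda, and a subset X of the
  torus is represented by its full preimage Xt = pi^-1(X), a Lambda-invariant set.\<close>

type_synonym c2 = "complex \<times> complex"

definition lattice :: "c2 set \<Rightarrow> bool" where
  "lattice \<Lambda> \<longleftrightarrow> (\<exists>v1 v2 v3 v4 :: c2.
      independent {v1, v2, v3, v4} \<and> card {v1, v2, v3, v4} = 4 \<and>
      \<Lambda> = {real_of_int a *\<^sub>R v1 + real_of_int b *\<^sub>R v2 + real_of_int c *\<^sub>R v3
              + real_of_int d *\<^sub>R v4 | a b c d. True})"

definition tproj :: "c2 set \<Rightarrow> c2 \<Rightarrow> c2 set" where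
  "tproj \<Lambda> z = (\<lambda>l. z + l) ` \<Lambda>"

text \<open>A (lifted) flow box of the lamination with lift Xt: an open set U of C^2
  projecting injectively into the torus, a transversal T and a homeomorphism
  phi from (unit disc) \<times> T onto Xt \<inter> U, whose plaques z \<mapsto> phi(z,t) are
  holomorphic immersions (holomorphically embedded discs).\<close>
definition flow_box :: "c2 set \<Rightarrow> c2 set \<Rightarrow> c2 set \<Rightarrow> c2 set \<Rightarrow> (complex \<times> c2 \<Rightarrow> c2) \<Rightarrow> bool" where
  "flow_box \<Lambda> Xt U T \<phi> \<longleftrightarrow>
     open U \<and> (\<forall>x\<in>U. \<forall>y\<in>U. x - y \<in> \<Lambda> \<longrightarrow> x = y) \<and>
     (\<exists>\<psi>. homeomorphism (ball 0 1 \<times> T) (Xt \<inter> U) \<phi> \<psi>) \<and>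
     (\<forall>t\<in>T. (\<lambda>z. fst (\<phi> (z, t))) holomorphic_on ball 0 1 \<and>
             (\<lambda>z. snd (\<phi> (z, t))) holomorphic_on ball 0 1 \<and>
             (\<forall>z\<in>ball 0 1. deriv (\<lambda>w. fst (\<phi> (w, t))) z \<noteq> 0 \<or>
                             deriv (\<lambda>w. snd (\<phi> (w, t))) z \<noteq> 0))"

definition plaque :: "(complex \<times> c2 \<Rightarrow> c2) \<Rightarrow> c2 \<Rightarrow> c2 set" where
  "plaque \<phi> t = (\<lambda>z. \<phi> (z, t)) ` ball 0 1"

text \<open>A lamination by Riemann surfaces holomorphically embedded in T^2, given by
  its lift Xt = pi^-1(X): closed (so X is compact), Lambda-invariant, and covered by flow boxes.\<close>
definition lamination :: "c2 set \<Rightarrow> c2 set \<Rightarrow> bool" where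
  "lamination \<Lambda> Xt \<longleftrightarrow> closed Xt \<and> (\<forall>l\<in>\<Lambda>. (\<lambda>x. x + l) ` Xt = Xt) \<and>
     (\<forall>x\<in>Xt. \<exists>U T \<phi>. flow_box \<Lambda> Xt U T \<phi> \<and> x \<in> U)"

definition cline :: "c2 \<Rightarrow> c2 \<Rightarrow> c2 set" where
  "cline p v = {(fst p + c * fst v, snd p + c * snd v) | c. True}"

definition has_invariant_line_segment :: "c2 set \<Rightarrow> bool" where
  "has_invariant_line_segment Xt \<longleftrightarrow>
     (\<exists>p v U. v \<noteq> 0 \<and> open U \<and> cline p v \<inter> U \<noteq> {} \<and> cline p v \<inter> U \<subseteq> Xt \<inter> U)"

end

theory Submission
  imports Defs "HOL-Complex_Analysis.Complex_Analysis"
begin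

text \<open>
  Suppose that a plaque and a translated plaque, both close to a point \<open>p\<close>, meet in many more than
  \<open>ln (1 / |\<epsilon>|)\<close> points. By the maximum principle they then agree up to \<open>O(|\<epsilon>| ^ N)\<close> for every
  \<open>N\<close>, and by a three circles argument this propagates along the leaf through \<open>p\<close>. It cannot reach
  a point where the leaf is tangent to the direction of translation: there the difference of the two
  untranslated leaves, divided by \<open>\<epsilon>\<close>, would converge to minus the derivative of the function
  defining the leaf, which has an isolated zero, whereas distinct leaves are disjoint (Hurwitz). As
  the torus is compact, it follows that the leaf is the graph of a function continued with a uniform
  step and with bounded derivative, so it is a line, which is excluded.

  A translation in the first coordinate is reduced to one in the second by swapping the coordinates.
  The absence of lines also guarantees that overlapping flow boxes define the same leaves.
\<close>

section \<open>Quantitative lemmas on holomorphic functions of one variable\<close>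

text \<open>Smallness beyond every power of the shift is forced by the continuation: each use of the
  three circles argument divides the exponent by a constant, so a fixed power would be used up after
  finitely many discs. It is available because the negated claim supplies counts n ln (1 / |e n|)
  with n unbounded, while each zero gains a constant factor.

  The obstacle is the step length: a leaf is a graph over the first coordinate only on a disc that
  shrinks near a vertical tangency. There it is written over the second coordinate, where a vertical
  shift moves the argument of the function instead of its value. This is why every notion appears
  both for \<open>X\<close> and for its image under \<open>prod.swap\<close>.

  Transversals are arbitrary sets and plaques depend only continuously on the parameter. Derivatives
  are therefore controlled by Cauchy's estimates, and convergence of leaves by Harnack's inequality
  applied to the difference of two leaves, which vanishes either nowhere or identically.\<close>

lemma ball_subset_ballI: "dist a w + d \<le> r \<Longrightarrow> ball w d \<subseteq> ball a r"
proof
  fix x assume "dist a w + d \<le> r" "x \<in> ball w d"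
  then show "x \<in> ball a r" using dist_triangle[of a x w] by simp
qed

text \<open>Cauchy's inequality is applied on the circle of radius \<open>r/2\<close>, where the
  bound on the open ball is available; hence the factor 2.\<close>

lemma norm_deriv_le_ball:
  assumes "f holomorphic_on ball z r" "0 < r" "\<And>w. w \<in> ball z r \<Longrightarrow> cmod (f w) \<le> B"
  shows "cmod (deriv f z) \<le> 2 * B / r"
proof -
  have sub: "cball z (r/2) \<subseteq> ball z r" using assms(2) by auto
  have "cmod ((deriv ^^ 1) f z) \<le> fact 1 * B / (r/2) ^ 1"
  proof (rule Cauchy_inequality)
    show "f holomorphic_on ball z (r/2)"
      using assms by (auto intro: holomorphic_on_subset)
    show "continuous_on (cball z (r/2)) f"
      using assms(1) sub by (meson holomorphic_on_imp_continuous_on holomorphic_on_subset)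
    show "cmod (f x) \<le> B" if "cmod (z - x) = r/2" for x
      using that assms by (auto simp: dist_norm)
  qed (use assms in auto)
  then show ?thesis by (simp add: mult.commute)
qed

lemma norm_deriv_le_ball':
  assumes "f holomorphic_on ball c R" "\<And>w. w \<in> ball c R \<Longrightarrow> cmod (f w) \<le> B"
    and "z \<in> ball c s" "s < R"
  shows "cmod (deriv f z) \<le> 2 * B / (R - s)"
proof (rule norm_deriv_le_ball)
  have sub: "ball z (R - s) \<subseteq> ball c R"
    using assms(3) by (intro ball_subset_ballI) auto
  show "f holomorphic_on ball z (R - s)" using assms(1) sub holomorphic_on_subset by blast
  show "cmod (f w) \<le> B" if "w \<in> ball z (R - s)" for w using that sub assms(2) by blast
qed (use assms in auto)

lemma bounded_holomorphic_Lipschitz: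
  assumes "f holomorphic_on ball c R" "\<And>w. w \<in> ball c R \<Longrightarrow> cmod (f w) \<le> B"
    and "s < R" "x \<in> ball c s" "y \<in> ball c s"
  shows "cmod (f x - f y) \<le> 2 * B / (R - s) * cmod (x - y)"
proof (rule field_differentiable_bound)
  show "convex (ball c s)" by simp
  show "(f has_field_derivative deriv f z) (at z within ball c s)" if "z \<in> ball c s" for z
  proof -
    have "z \<in> ball c R" using that assms by auto
    then show ?thesis using assms(1)
      by (meson has_field_derivative_at_within holomorphic_derivI open_ball)
  qed
  show "cmod (deriv f z) \<le> 2 * B / (R - s)" if "z \<in> ball c s" for z
    using norm_deriv_le_ball'[OF assms(1,2) that assms(3)] by blast
qed (use assms in auto)

lemma holomorphic_eqI:
  assumes "f holomorphic_on S" "g holomorphic_on S" "open S" "connected S" "w \<in> S"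
    and "\<forall>\<^sub>F x in nhds w. f x = g x" "x \<in> S"
  shows "f x = g x"
proof -
  obtain V where V: "open V" "w \<in> V" "\<And>x. x \<in> V \<Longrightarrow> f x = g x"
    using assms(6) unfolding eventually_nhds by blast
  define U where "U = V \<inter> S"
  have "open U" "w \<in> U" using assms V by (auto simp: U_def)
  then have li: "w islimpt U"
    by (simp add: interior_limit_point interior_open)
  have "f x - g x = 0"
    by (rule analytic_continuation[of "\<lambda>x. f x - g x" S U w])
      (use assms li V in \<open>auto simp: U_def intro!: holomorphic_intros\<close>)
  then show ?thesis by simp
qed

lemma holomorphic_eqI_ball:
  assumes "f holomorphic_on ball a r" "g holomorphic_on ball a r" "w \<in> ball a r"
    and "0 < d" "\<And>x. x \<in> ball w d \<Longrightarrow> f x = g x" "x \<in> ball a r"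
  shows "f x = g x"
proof (rule holomorphic_eqI[OF assms(1,2) _ _ assms(3) _ assms(6)])
  show "\<forall>\<^sub>F x in nhds w. f x = g x"
    unfolding eventually_nhds using assms(4,5) by (intro exI[of _ "ball w d"]) auto
qed auto

text \<open>Harnack's inequality for the positive harmonic function \<open>ln (B / |d|)\<close>, obtained from the
  Schwarz lemma applied to a Cayley transform of a logarithm of \<open>B / d\<close>.\<close>

lemma Harnack_nonvanishing:
  assumes hol: "d holomorphic_on ball c R" and R: "0 < R"
    and bd: "\<And>w. w \<in> ball c R \<Longrightarrow> cmod (d w) < B"
    and nz: "(\<forall>w\<in>ball c R. d w \<noteq> 0) \<or> (\<forall>w\<in>ball c R. d w = 0)"
    and z: "z \<in> cball c (R/2)"
  shows "cmod (d z) ^ 3 \<le> B\<^sup>2 * cmod (d c)"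
proof (cases "\<forall>w\<in>ball c R. d w = 0")
  case True
  then show ?thesis using z R by auto
next
  case False
  with nz have nz: "\<And>w. w \<in> ball c R \<Longrightarrow> d w \<noteq> 0" by blast
  have B: "B > 0" using bd[of c] R norm_ge_zero[of "d c"] by (simp del: norm_ge_zero)
  define D where "D = (\<lambda>w. d (c + of_real R * w))"
  have img: "c + of_real R * w \<in> ball c R" if "w \<in> ball 0 1" for w :: complex
  proof -
    have "R * cmod w < R * 1" using that R by (intro mult_strict_left_mono) auto
    then show ?thesis using R by (simp add: mem_ball dist_norm norm_mult)
  qed
  have holD: "D holomorphic_on ball 0 1"
  proof -
    have "(d \<circ> (\<lambda>w. c + of_real R * w)) holomorphic_on ball 0 1"
      by (rule holomorphic_on_compose_gen[OF _ hol]) (use img in \<open>auto intro!: holomorphic_intros\<close>)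
    then show ?thesis by (simp add: D_def o_def)
  qed
  have holBD: "(\<lambda>w. of_real B / D w) holomorphic_on ball 0 1"
    using nz img by (intro holomorphic_intros holD) (auto simp: D_def)
  obtain h where h: "h holomorphic_on ball 0 1" "\<And>w. w \<in> ball 0 1 \<Longrightarrow> of_real B / D w = exp (h w)"
  proof (rule contractible_imp_holomorphic_log[OF holBD])
    show "contractible (ball (0::complex) 1)" by (simp add: convex_imp_contractible)
    show "of_real B / D w \<noteq> 0" if "w \<in> ball 0 1" for w
      using B nz[OF img[OF that]] by (simp add: D_def)
  qed blast
  have normexp: "cmod (D w) = B * exp (- Re (h w))" if "w \<in> ball 0 1" for w
  proof -
    have "B / cmod (D w) = exp (Re (h w))"
      using arg_cong[OF h(2)[OF that], of cmod] B by (simp add: norm_divide)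
    moreover have "cmod (D w) \<noteq> 0" using nz img[OF that] by (simp add: D_def)
    ultimately show ?thesis using B by (simp add: exp_minus field_simps)
  qed
  have Repos: "Re (h w) > 0" if "w \<in> ball 0 1" for w
  proof -
    have "B * exp (- Re (h w)) < B * 1"
      using normexp[OF that] bd[OF img[OF that]] by (simp add: D_def)
    then show ?thesis using B by (simp add: mult_less_cancel_left)
  qed
  define k where "k = Re (h 0)"
  have k: "k > 0" using Repos[of 0] by (simp add: k_def)
  \<comment> \<open>Removing the imaginary part makes \<open>u 0 = k\<close> real and positive, so
    the Cayley transform \<open>S\<close> of the right half-plane sends it to 0 and the Schwarz
    lemma applies.\<close>
  define u where "u = (\<lambda>w. h w - \<i> * Im (h 0))"
  have u0: "u 0 = of_real k" by (simp add: u_def k_def complex_eq_iff)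
  have Reu: "Re (u w) = Re (h w)" for w by (simp add: u_def)
  define S where "S = (\<lambda>w. (u w - of_real k) / (u w + of_real k))"
  have den: "u w + of_real k \<noteq> 0" if "w \<in> ball 0 1" for w
    using Repos[OF that] k Reu[of w]
    by (metis add_pos_pos order_less_irrefl plus_complex.sel(1) Re_complex_of_real zero_complex.sel(1))
  have holS: "S holomorphic_on ball 0 1"
    unfolding S_def using den by (auto intro!: holomorphic_intros h simp: u_def)
  have S1: "cmod (S w) < 1" if "cmod w < 1" for w
  proof -
    have "(cmod (u w - of_real k))\<^sup>2 < (cmod (u w + of_real k))\<^sup>2"
      using Repos[of w] that k Reu[of w] unfolding cmod_power2 by (simp add: power2_eq_square algebra_simps)
    then have "cmod (u w - of_real k) < cmod (u w + of_real k)"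
      using power_less_imp_less_base by (metis norm_ge_zero)
    then show ?thesis using den[of w] that by (simp add: S_def norm_divide divide_less_eq)
  qed
  define w where "w = (z - c) / of_real R"
  have w: "cmod w \<le> 1/2" using z R by (auto simp: w_def norm_divide dist_norm norm_minus_commute field_simps)
  have "cmod (S w) \<le> cmod w"
    by (rule Schwarz_Lemma(1)[OF holS]) (use S1 w u0 in \<open>auto simp: S_def\<close>)
  then have "cmod (u w - of_real k) \<le> 1/2 * cmod (u w + of_real k)"
  proof -
    assume "cmod (S w) \<le> cmod w"
    then have "cmod (u w - of_real k) / cmod (u w + of_real k) \<le> 1/2"
      using w unfolding S_def norm_divide by linarith
    moreover have "cmod (u w + of_real k) > 0" using den[of w] w by simp
    ultimately show ?thesis by (simp only: divide_le_eq split: if_splits)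
  qed
  then have "(2 * cmod (u w - of_real k))\<^sup>2 \<le> (cmod (u w + of_real k))\<^sup>2"
    by (intro power_mono) auto
  then have "4 * ((Re (u w) - k)\<^sup>2 + (Im (u w))\<^sup>2) \<le> (Re (u w) + k)\<^sup>2 + (Im (u w))\<^sup>2"
    by (simp add: power_mult_distrib cmod_power2)
  then have "(2 * (k - Re (u w)))\<^sup>2 \<le> (Re (u w) + k)\<^sup>2"
    using zero_le_square[of "Im (u w)"] unfolding power2_eq_square by (simp add: algebra_simps del: zero_le_square)
  then have "2 * (k - Re (u w)) \<le> Re (u w) + k"
    by (rule power2_le_imp_le) (use Repos[of w] w k Reu[of w] in auto)
  \<comment> \<open>Since \<open>Re (h w)\<close> is ln (B / |D w|), this is Harnack's inequality
    with the constant (1 - 1/2) / (1 + 1/2) = 1/3 belonging to half the radius. It is the source of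
    the exponent 3.\<close>
  then have "3 * Re (h w) \<ge> k" using Reu by simp
  then have "exp (- Re (h w)) ^ 3 \<le> exp (- k)"
    by (simp flip: exp_of_nat_mult)
  then have "B ^ 3 * exp (- Re (h w)) ^ 3 \<le> B ^ 3 * exp (- k)"
    using B by (intro mult_left_mono) auto
  then have "cmod (D w) ^ 3 \<le> B\<^sup>2 * cmod (D 0)"
    using normexp[of w] normexp[of 0] w
    by (simp add: power_mult_distrib k_def power2_eq_square power3_eq_cube mult_ac)
  moreover have "D w = d z" "D 0 = d c" using R by (auto simp: D_def w_def)
  ultimately show ?thesis by simp
qed

text \<open>A three circles estimate with an integer parameter. Dividing \<open>u\<close> by (w -
  c)^k and applying the maximum principle to the annulus between the radii \<open>s/2\<close> and
  \<open>3*R/4\<close> weighs the small bound against the global one; the two bases are R/s = (R/2)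
  / (s/2) and 2/3 = (R/2) / (3R/4). Leaving \<open>k\<close> free avoids real exponents; it is
  chosen in \<open>rapid_propagate\<close>.\<close>

lemma two_radii_bound:
  assumes hol: "u holomorphic_on ball c R" and R: "0 < R"
    and bd: "\<And>w. w \<in> ball c R \<Longrightarrow> cmod (u w) \<le> B"
    and s: "0 < s" "s < R/2" and bds: "\<And>w. w \<in> ball c s \<Longrightarrow> cmod (u w) \<le> \<delta>"
    and z: "z \<in> ball c (R/2)"
  shows "cmod (u z) \<le> max (\<delta> * (R/s)^k) (B * (2/3)^k)"
proof (cases "dist c z < s")
  case True
  then have "cmod (u z) \<le> \<delta>" using bds by auto
  moreover have "\<delta> \<le> \<delta> * (R/s)^k"
  proof -
    have "0 \<le> \<delta>" using bds[of c] s order_trans[OF norm_ge_zero] by simp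
    moreover have "1 \<le> (R/s)^k" using s R by (intro one_le_power) (simp add: le_divide_eq_1)
    ultimately show ?thesis by (metis mult_left_mono mult.right_neutral)
  qed
  ultimately show ?thesis by simp
next
  case False
  define S where "S = cball c (3*R/4) - ball c (s/2)"
  define f where "f = (\<lambda>w. u w / (w - c)^k)"
  define M where "M = max (\<delta> / (s/2)^k) (B / (3*R/4)^k)"
  have clS: "closed S" by (auto simp: S_def)
  have subS: "S \<subseteq> ball c R - {c}" using R s by (auto simp: S_def dist_norm)
  have holf: "f holomorphic_on ball c R - {c}"
    unfolding f_def by (intro holomorphic_intros holomorphic_on_subset[OF hol]) auto
  have frS: "frontier S \<subseteq> sphere c (3*R/4) \<union> sphere c (s/2)"
  proof -
    have "frontier S \<subseteq> frontier (cball c (3*R/4)) \<union> frontier (- ball c (s/2))"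
      unfolding S_def Diff_eq by (rule frontier_Int_subset)
    then show ?thesis using s R by (simp add: frontier_complement)
  qed
  have "cmod (f z) \<le> M"
  proof (rule maximum_modulus_frontier[of f S])
    show "f holomorphic_on interior S"
      by (rule holomorphic_on_subset[OF holf]) (use subS interior_subset in blast)
    show "continuous_on (closure S) f"
      using holf subS clS by (metis closure_closed holomorphic_on_imp_continuous_on holomorphic_on_subset)
    show "bounded S" by (auto simp: S_def intro: bounded_subset[OF bounded_cball])
    show "z \<in> S" using False z R s by (auto simp: S_def)
    show "cmod (f w) \<le> M" if "w \<in> frontier S" for w
    proof -
      from that frS consider "dist c w = 3*R/4" | "dist c w = s/2" by auto
      then show ?thesis
      proof cases
        case 1
        then have "cmod (u w) \<le> B" using bd[of w] R by auto
        then have "cmod (f w) \<le> B / (3*R/4)^k" using 1 R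
          unfolding f_def norm_divide norm_power dist_norm norm_minus_commute[of c]
          by (simp only:) (intro divide_right_mono, auto)
        then show ?thesis unfolding M_def by (rule max.coboundedI2)
      next
        case 2
        then have "cmod (u w) \<le> \<delta>" using bds[of w] s by auto
        then have "cmod (f w) \<le> \<delta> / (s/2)^k" using 2 s
          unfolding f_def norm_divide norm_power dist_norm norm_minus_commute[of c]
          by (simp only:) (intro divide_right_mono, auto)
        then show ?thesis unfolding M_def by (rule max.coboundedI1)
      qed
    qed
  qed
  then have "cmod (u z) \<le> M * cmod (z - c)^k"
  proof -
    assume *: "cmod (f z) \<le> M"
    have "cmod (z - c) > 0" using False s by auto
    with * show ?thesis by (simp add: f_def norm_divide norm_power pos_divide_le_eq)
  qed
  also have "M * cmod (z - c)^k \<le> M * (R/2)^k"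
  proof (intro mult_left_mono power_mono)
    have "0 \<le> B" using bd[of c] R order_trans[OF norm_ge_zero] by simp
    then show "0 \<le> M" using R by (auto simp: M_def le_max_iff_disj)
  qed (use z in \<open>auto simp: dist_norm norm_minus_commute\<close>)
  also have "\<dots> = max (\<delta> * (R/s)^k) (B * (2/3)^k)"
  proof -
    have "(R/s)^k = (R/2)^k / (s/2)^k" "(2/3::real)^k = (R/2)^k / (3*R/4)^k"
      using R s by (simp_all flip: power_divide)
    moreover have "(R/2)^k \<ge> 0" using R by simp
    ultimately show ?thesis by (simp add: M_def max_mult_distrib_right)
  qed
  finally show ?thesis .
qed

text \<open>Divide out the zeros one at a time, applying the maximum principle at each step.\<close>

lemma many_zeros_imp_small:
  assumes "finite Z" "Z \<subseteq> ball c (R/8)" "0 < R"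
    and "u holomorphic_on ball c R" "\<And>w. w \<in> ball c R \<Longrightarrow> cmod (u w) \<le> B"
    and "\<And>w. w \<in> Z \<Longrightarrow> u w = 0"
  shows "\<forall>z\<in>cball c (R/2). cmod (u z) \<le> B * (5/6) ^ card Z"
proof -
  have B: "0 \<le> B" using assms(3) assms(5)[of c] order_trans[OF norm_ge_zero] by simp
  define P where "P = (\<lambda>Z (w::complex). \<Prod>a\<in>Z. (w - a))"
  have "\<exists>v. v holomorphic_on ball c R \<and> (\<forall>w\<in>ball c R. u w = P Z w * v w)"
    using assms(1,2,6)
  proof (induction Z rule: finite_induct)
    case empty
    then show ?case using assms(4) by (auto simp: P_def)
  next
    case (insert a Z)
    then obtain v where v: "v holomorphic_on ball c R" "\<And>w. w \<in> ball c R \<Longrightarrow> u w = P Z w * v w" by auto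
    have a: "a \<in> ball c R" using insert.prems(1) assms(3) by auto
    have "P Z a \<noteq> 0" using insert.hyps by (auto simp: P_def)
    then have va: "v a = 0" using v(2)[OF a] insert.prems(2)[of a] by auto
    define v' where "v' = (\<lambda>w. if w = a then deriv v a else (v w - v a) / (w - a))"
    have "v' holomorphic_on ball c R"
      unfolding v'_def using pole_lemma[OF v(1)] a by simp
    moreover have "u w = P (insert a Z) w * v' w" if "w \<in> ball c R" for w
      using v(2)[OF that] insert.hyps va by (auto simp: P_def v'_def)
    ultimately show ?case by blast
  qed
  then obtain v where v: "v holomorphic_on ball c R" "\<And>w. w \<in> ball c R \<Longrightarrow> u w = P Z w * v w" by auto
  have sub: "cball c (7*R/8) \<subseteq> ball c R" using assms(3) by auto
  \<comment> \<open>All zeros having been divided out, the maximum principle is applied to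
    \<open>v\<close> on radius 7R/8, where every factor has modulus at least 7R/8 - R/8 = 3R/4. On
    the disc of half the radius a factor is at most R/2 + R/8 = 5R/8. The quotient 5/6 is the gain
    per zero.\<close>
  have vb: "cmod (v z) \<le> B / (3*R/4) ^ card Z" if "z \<in> cball c (7*R/8)" for z
  proof (rule maximum_modulus_frontier[of v "cball c (7*R/8)"])
    show "v holomorphic_on interior (cball c (7*R/8))"
      by (rule holomorphic_on_subset[OF v(1)]) (use sub interior_subset in blast)
    show "continuous_on (closure (cball c (7*R/8))) v"
      using v(1) sub by (simp add: holomorphic_on_imp_continuous_on holomorphic_on_subset)
    show "z \<in> cball c (7*R/8)" by fact
    show "bounded (cball c (7*R/8))" by simp
    show "cmod (v w) \<le> B / (3*R/4) ^ card Z" if "w \<in> frontier (cball c (7*R/8))" for w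
    proof -
      have dw: "dist c w = 7*R/8" using that by simp
      then have wb: "w \<in> ball c R" using assms(3) by auto
      have "(3*R/4) ^ card Z = (\<Prod>a\<in>Z. 3*R/4)" by simp
      also have "\<dots> \<le> (\<Prod>a\<in>Z. cmod (w - a))"
      proof (rule prod_mono)
        fix a assume "a \<in> Z"
        then have "dist c a < R/8" using assms(2) by auto
        then have "dist w a \<ge> 3*R/4" using dw dist_triangle[of c w a] by (simp add: dist_commute)
        then show "0 \<le> 3*R/4 \<and> 3*R/4 \<le> cmod (w - a)" using assms(3) by (simp add: dist_norm)
      qed
      also have "\<dots> = cmod (P Z w)" by (simp add: P_def prod_norm)
      finally have "(3*R/4) ^ card Z * cmod (v w) \<le> cmod (P Z w) * cmod (v w)"
        by (intro mult_right_mono) auto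
      also have "\<dots> \<le> B" using v(2)[OF wb] assms(5)[OF wb] by (simp add: norm_mult)
      finally show ?thesis using assms(3) by (simp add: field_simps)
    qed
  qed
  show ?thesis
  proof
    fix z assume z: "z \<in> cball c (R/2)"
    then have zb: "z \<in> ball c R" using assms(3) by auto
    have "cmod (P Z z) = (\<Prod>a\<in>Z. cmod (z - a))" by (simp add: P_def prod_norm)
    also have "\<dots> \<le> (\<Prod>a\<in>Z. 5*R/8)"
    proof (rule prod_mono)
      fix a assume "a \<in> Z"
      then have "dist c a < R/8" using assms(2) by auto
      then have "dist z a \<le> 5*R/8" using z dist_triangle[of z a c] by (simp add: dist_commute)
      then show "0 \<le> cmod (z - a) \<and> cmod (z - a) \<le> 5*R/8" by (simp add: dist_norm)
    qed
    finally have P: "cmod (P Z z) \<le> (5*R/8) ^ card Z" by simp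
    have "cmod (u z) = cmod (P Z z) * cmod (v z)" using v(2)[OF zb] by (simp add: norm_mult)
    also have "\<dots> \<le> (5*R/8) ^ card Z * (B / (3*R/4) ^ card Z)"
      using z assms(3) by (intro mult_mono P vb) auto
    also have "\<dots> = B * ((5*R/8) / (3*R/4)) ^ card Z" by (simp only: power_divide) simp
    also have "(5*R/8) / (3*R/4) = 5/6" using assms(3) by (simp add: field_simps)
    finally show "cmod (u z) \<le> B * (5/6) ^ card Z" .
  qed
qed

section \<open>Functions smaller than every power of the shift\<close>

text \<open>The threshold for \<open>n\<close> may depend on \<open>N\<close>. A multiplicative
  constant would add nothing: in all uses \<open>e n\<close> tends to 0, so one more power absorbs
  it.\<close>

definition rapid :: "(nat \<Rightarrow> complex) \<Rightarrow> complex set \<Rightarrow> (nat \<Rightarrow> complex \<Rightarrow> complex) \<Rightarrow> bool" where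
  "rapid e S u \<longleftrightarrow> (\<forall>N::nat. \<forall>\<^sub>F n in sequentially. \<forall>x\<in>S. cmod (u n x) \<le> cmod (e n) ^ N)"

lemma rapid_subset: "rapid e S u \<Longrightarrow> T \<subseteq> S \<Longrightarrow> rapid e T u"
  unfolding rapid_def by (fastforce elim!: eventually_mono)

lemma eventually_mult_norm_le:
  fixes e :: "nat \<Rightarrow> complex"
  assumes "e \<longlonglongrightarrow> 0" "0 < d"
  shows "\<forall>\<^sub>F n in sequentially. B * cmod (e n) \<le> d"
proof -
  have "(\<lambda>n. B * cmod (e n)) \<longlonglongrightarrow> B * 0"
    by (intro tendsto_mult_left tendsto_norm_zero assms)
  then have "\<forall>\<^sub>F n in sequentially. B * cmod (e n) < d"
    using assms(2) by (intro order_tendstoD(2)[of _ 0]) auto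
  then show ?thesis by (rule eventually_mono) simp
qed

text \<open>The two radii bound costs a constant factor in the exponent, which is harmless because
  all exponents are at hand. This is what permits continuation over any number of discs.\<close>

lemma rapid_propagate:
  assumes e: "e \<longlonglongrightarrow> 0" "\<And>n. e n \<noteq> 0"
    and u: "\<forall>\<^sub>F n in sequentially. u n holomorphic_on ball c R \<and> (\<forall>w\<in>ball c R. cmod (u n w) \<le> B)"
    and R: "0 < R" and s: "0 < s" and rap: "rapid e (ball c s) u"
  shows "rapid e (ball c (R/2)) u"
  unfolding rapid_def
proof
  fix N
  define t where "t = min s (R/4)"
  have t: "0 < t" "t < R/2" "t \<le> s" using R s by (auto simp: t_def)
  obtain j where j: "R/t \<le> (3/2)^j"
    using real_arch_pow[of "3/2" "R/t"] by (auto intro: less_imp_le)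
  \<comment> \<open>With \<open>Q = q ^ (N+1)\<close> and (2/3)^k about \<open>Q\<close>, the factor
    (R/t)^k is at most ((3/2)^k)^j, of order \<open>Q\<close> to the power -j. The summand
    \<open>(N+1)*j\<close> cancels this; the summand \<open>N+1\<close> leaves one spare power of
    \<open>q\<close> to absorb the constants.\<close>
  have 1: "\<forall>\<^sub>F n in sequentially. \<forall>x\<in>ball c s. cmod (u n x) \<le> cmod (e n) ^ ((N+1)*j + (N+1))"
    using rap unfolding rapid_def by blast
  have 2: "\<forall>\<^sub>F n in sequentially. (3/2)^j * cmod (e n) \<le> 1" "\<forall>\<^sub>F n in sequentially. B * cmod (e n) \<le> 1"
    "\<forall>\<^sub>F n in sequentially. 1 * cmod (e n) \<le> 1/2"
    by (rule eventually_mult_norm_le[OF e(1)], simp)+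
  show "\<forall>\<^sub>F n in sequentially. \<forall>x\<in>ball c (R/2). cmod (u n x) \<le> cmod (e n) ^ N"
    using u 1 2
  proof eventually_elim
    case (elim n)
    define q where "q = cmod (e n)"
    define Q where "Q = q ^ (N+1)"
    have q: "0 < q" "q < 1" using e(2) elim by (auto simp: q_def)
    have Q: "0 < Q" "Q < 1" using q power_Suc_less_one[of q N] by (auto simp: Q_def)
    have ex: "\<exists>k. (2/3::real)^k < Q" using real_arch_pow_inv[OF Q(1), of "2/3"] by auto
    \<comment> \<open>Minimality gives the reverse estimate (2/3)^k >= 2/3 * Q, which bounds (3/2)^k
      from above.\<close>
    define k where "k = (LEAST k. (2/3::real)^k < Q)"
    have k1: "(2/3::real)^k < Q" unfolding k_def using ex by (rule LeastI_ex)
    have "k \<noteq> 0" using k1 Q by (cases k) auto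
    then obtain m where m: "k = Suc m" by (cases k) auto
    have "\<not> (2/3::real)^m < Q" using not_less_Least[of m "\<lambda>k. (2/3::real)^k < Q"] m by (simp add: k_def)
    then have "(2/3)^k \<ge> 2/3 * Q" by (simp add: m)
    then have "(3/2::real)^k * (2/3)^k \<ge> (3/2::real)^k * (2/3 * Q)" by (intro mult_left_mono) auto
    then have k2: "(3/2::real)^k * Q \<le> 3/2" by (simp flip: power_mult_distrib)
    show ?case
    proof
      fix x assume x: "x \<in> ball c (R/2)"
      have "cmod (u n x) \<le> max (q ^ ((N+1)*j + (N+1)) * (R/t)^k) (B * (2/3)^k)"
        by (rule two_radii_bound[of "u n" c R]) (use elim R t x in \<open>auto simp: q_def\<close>)
      also have "\<dots> \<le> q ^ N"
      proof (rule max.boundedI)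
        have "(R/t)^k \<le> ((3/2)^j)^k" using j R t by (intro power_mono) auto
        then have "q ^ ((N+1)*j + (N+1)) * (R/t)^k \<le> q ^ ((N+1)*j + (N+1)) * ((3/2)^j)^k"
          using q by (intro mult_left_mono) auto
        also have "\<dots> = ((3/2)^k * Q)^j * Q"
          unfolding power_mult_distrib power_add power_mult Q_def
          by (simp add: mult_ac flip: power_mult)
        also have "\<dots> \<le> (3/2)^j * Q"
          using k2 Q by (intro mult_right_mono power_mono) auto
        also have "\<dots> = ((3/2)^j * q) * q ^ N" by (simp add: Q_def)
        also have "\<dots> \<le> 1 * q ^ N" using elim q by (intro mult_right_mono) (auto simp: q_def)
        finally show "q ^ ((N+1)*j + (N+1)) * (R/t)^k \<le> q ^ N" by simp
        have "B \<ge> 0" using elim R by (metis centre_in_ball norm_ge_zero order_trans)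
        then have "B * (2/3)^k \<le> B * Q" using k1 by (intro mult_left_mono) auto
        also have "\<dots> = (B * q) * q ^ N" by (simp add: Q_def)
        also have "\<dots> \<le> 1 * q ^ N" using elim q by (intro mult_right_mono) (auto simp: q_def)
        finally show "B * (2/3)^k \<le> q ^ N" by simp
      qed
      finally show "cmod (u n x) \<le> cmod (e n) ^ N" by (simp add: q_def)
    qed
  qed
qed

text \<open>The factor (5/6)^(n ln (1 / |e n|)) equals |e n|^(n ln (6/5)), with an exponent that
  grows with n. The logarithm in the final bound originates here.\<close>

lemma rapid_of_many_zeros:
  assumes e: "e \<longlonglongrightarrow> 0" "\<And>n. e n \<noteq> 0" and R: "0 < R"
    and u: "\<forall>\<^sub>F n in sequentially. u n holomorphic_on ball c R \<and> (\<forall>w\<in>ball c R. cmod (u n w) \<le> B) \<and>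
      finite (Z n) \<and> Z n \<subseteq> ball c (R/8) \<and> (\<forall>w\<in>Z n. u n w = 0) \<and>
      real n * ln (1 / cmod (e n)) \<le> real (card (Z n))"
  shows "rapid e (ball c (R/2)) u"
  unfolding rapid_def
proof
  fix N
  have 2: "\<forall>\<^sub>F n in sequentially. B * cmod (e n) \<le> 1" "\<forall>\<^sub>F n in sequentially. 1 * cmod (e n) \<le> 1/2"
    by (rule eventually_mult_norm_le[OF e(1)], simp)+
  \<comment> \<open>From \<open>n0\<close> on the exponent n ln (6/5) is at least N + 1; the
    additional power absorbs \<open>B\<close>.\<close>
  obtain n0 where n0: "real (Suc N) / ln (6/5) \<le> real n0" using real_arch_simple by blast
  show "\<forall>\<^sub>F n in sequentially. \<forall>x\<in>ball c (R/2). cmod (u n x) \<le> cmod (e n) ^ N"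
    using u 2 eventually_ge_at_top[of n0]
  proof eventually_elim
    case (elim n)
    define q where "q = cmod (e n)"
    have q: "0 < q" "q < 1" using e(2) elim by (auto simp: q_def)
    have B: "B \<ge> 0" using elim R by (metis centre_in_ball norm_ge_zero order_trans)
    have "real (Suc N) / ln (6/5) \<le> real n" using n0 elim by linarith
    then have "real (Suc N) \<le> real n * ln (6/5)" by (simp add: pos_divide_le_eq)
    then have "real (Suc N) * ln (1/q) \<le> (real n * ln (6/5)) * ln (1/q)"
      using q by (intro mult_right_mono) auto
    also have "\<dots> = ln (6/5) * (real n * ln (1/q))" by simp
    also have "\<dots> \<le> ln (6/5) * real (card (Z n))" using elim by (intro mult_left_mono) (auto simp: q_def)
    finally have "real (Suc N) * ln (1/q) \<le> real (card (Z n)) * ln (6/5)" by (simp add: mult.commute)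
    then have "real (card (Z n)) * ln (5/6) \<le> real (Suc N) * ln q"
      using q by (simp add: ln_div algebra_simps)
    then have "exp (real (card (Z n)) * ln (5/6)) \<le> exp (real (Suc N) * ln q)" by simp
    then have *: "(5/6) ^ card (Z n) \<le> q ^ Suc N"
      using q unfolding exp_of_nat_mult by simp
    show ?case
    proof
      fix x assume x: "x \<in> ball c (R/2)"
      have "cmod (u n x) \<le> B * (5/6) ^ card (Z n)"
        using many_zeros_imp_small[of "Z n" c R "u n" B] elim R x by auto
      also have "\<dots> \<le> B * q ^ Suc N" using * B by (intro mult_left_mono)
      also have "\<dots> = (B * q) * q ^ N" by simp
      also have "\<dots> \<le> 1 * q ^ N" using elim q by (intro mult_right_mono) (auto simp: q_def)
      finally show "cmod (u n x) \<le> cmod (e n) ^ N" by (simp add: q_def)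
    qed
  qed
qed

section \<open>Limits of sequences of leaves\<close>

text \<open>The alternative in \<open>F\<close> is the one satisfied by two leaves, which are
  disjoint or equal. Harnack's inequality for the difference then spreads convergence from the
  centre, at the cost of a cube root. \<open>M = 2 * B + 1\<close> provides the strict bound that it
  requires.\<close>

lemma Harnack_uniform_limit:
  assumes f: "f holomorphic_on ball c R" "\<And>w. w \<in> ball c R \<Longrightarrow> cmod (f w) \<le> B" and R: "0 < R"
    and F: "\<forall>\<^sub>F n in sequentially. F n holomorphic_on ball c R \<and> (\<forall>w\<in>ball c R. cmod (F n w) \<le> B) \<and>
      ((\<forall>w\<in>ball c R. F n w \<noteq> f w) \<or> (\<forall>w\<in>ball c R. F n w = f w))"
    and lim: "(\<lambda>n. F n c) \<longlonglongrightarrow> f c"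
  shows "uniform_limit (cball c (R/2)) F f sequentially"
proof (rule uniform_limitI)
  fix \<eta> :: real assume \<eta>: "\<eta> > 0"
  define M where "M = 2 * B + 1"
  have B: "B \<ge> 0" using f(2)[of c] R order_trans[OF norm_ge_zero] by simp
  have "(\<lambda>n. F n c - f c) \<longlonglongrightarrow> 0" using lim by (simp add: LIM_zero)
  from eventually_mult_norm_le[OF this, of "\<eta>^3/2" "M\<^sup>2"]
  have "\<forall>\<^sub>F n in sequentially. M\<^sup>2 * cmod (F n c - f c) \<le> \<eta>^3/2" using \<eta> by simp
  then show "\<forall>\<^sub>F n in sequentially. \<forall>x\<in>cball c (R/2). dist (F n x) (f x) < \<eta>"
    using F
  proof eventually_elim
    case (elim n)
    show ?case
    proof
      fix x assume x: "x \<in> cball c (R/2)"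
      have "cmod (F n x - f x) ^ 3 \<le> M\<^sup>2 * cmod (F n c - f c)"
      proof (rule Harnack_nonvanishing[of "\<lambda>x. F n x - f x" c R M x])
        show "(\<lambda>x. F n x - f x) holomorphic_on ball c R" using elim f by (intro holomorphic_intros) auto
        show "cmod (F n w - f w) < M" if "w \<in> ball c R" for w
          using norm_triangle_ineq4[of "F n w" "f w"] elim f(2)[OF that] that B by (force simp: M_def)
      qed (use elim R x in auto)
      also have "\<dots> < \<eta>^3"
      proof -
        have "0 < \<eta>^3" using \<eta> by simp
        then show ?thesis using elim(1) by linarith
      qed
      finally show "dist (F n x) (f x) < \<eta>" using \<eta> by (auto simp: dist_norm intro: power_less_imp_less_base)
    qed
  qed
qed

lemma uniform_limit_deriv:
  assumes "f holomorphic_on ball c R"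
    and "\<forall>\<^sub>F n in sequentially. F n holomorphic_on ball c R"
    and "uniform_limit (ball c R) F f sequentially" "s < R"
  shows "uniform_limit (ball c s) (\<lambda>n. deriv (F n)) (deriv f) sequentially"
proof (rule uniform_limitI)
  fix \<eta> :: real assume \<eta>: "\<eta> > 0"
  have "\<forall>\<^sub>F n in sequentially. \<forall>x\<in>ball c R. dist (F n x) (f x) < \<eta> * (R - s) / 4"
    using assms \<eta> by (intro uniform_limitD) auto
  then show "\<forall>\<^sub>F n in sequentially. \<forall>x\<in>ball c s. dist (deriv (F n) x) (deriv f x) < \<eta>"
    using assms(2)
  proof eventually_elim
    case (elim n)
    show ?case
    proof
      fix x assume x: "x \<in> ball c s"
      then have xR: "x \<in> ball c R" using assms(4) by auto
      have "cmod (deriv (\<lambda>x. F n x - f x) x) \<le> 2 * (\<eta> * (R - s) / 4) / (R - s)"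
        by (rule norm_deriv_le_ball'[of _ c R])
          (use elim assms x in \<open>auto simp: dist_norm less_imp_le intro!: holomorphic_intros\<close>)
      moreover have "deriv (\<lambda>x. F n x - f x) x = deriv (F n) x - deriv f x"
        using elim assms(1) xR by (intro deriv_diff) (auto intro: holomorphic_on_imp_differentiable_at)
      ultimately show "dist (deriv (F n) x) (deriv f x) < \<eta>"
      proof -
        assume *: "cmod (deriv (\<lambda>x. F n x - f x) x) \<le> 2 * (\<eta> * (R - s) / 4) / (R - s)"
          "deriv (\<lambda>x. F n x - f x) x = deriv (F n) x - deriv f x"
        have "2 * (\<eta> * (R - s) / 4) / (R - s) = \<eta>/2" using assms(4) by (simp add: divide_eq_eq)
        with * have "cmod (deriv (F n) x - deriv f x) \<le> \<eta>/2" by metis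
        then show ?thesis using \<eta> unfolding dist_norm by linarith
      qed
    qed
  qed
qed

text \<open>If two graphs, one of them shifted by \<open>e\<close>, agree to infinite order in \<open>e\<close>, then
  \<open>(h1 - h2) / e\<close> converges to \<open>- h'\<close>; by Hurwitz the limit inherits the absence of zeros.\<close>

lemma shifted_graphs_deriv_nonzero:
  assumes e: "e \<longlonglongrightarrow> 0" "\<And>n. e n \<noteq> 0" and R: "0 < R" and s: "0 < s"
    and h: "h holomorphic_on ball b R" "\<And>w. w \<in> ball b R \<Longrightarrow> cmod (h w) \<le> B"
    and nc: "\<not> deriv h constant_on ball b R"
    and H: "\<forall>\<^sub>F n in sequentially. h1 n holomorphic_on ball b R \<and> h2 n holomorphic_on ball b R \<and>
      (\<forall>w\<in>ball b R. cmod (h1 n w) \<le> B \<and> cmod (h2 n w) \<le> B) \<and>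
      ((\<forall>w\<in>ball b R. h1 n w \<noteq> h2 n w) \<or> (\<forall>w\<in>ball b R. h1 n w = h2 n w)) \<and>
      ((\<forall>w\<in>ball b R. h2 n w \<noteq> h w) \<or> (\<forall>w\<in>ball b R. h2 n w = h w))"
    and lim: "(\<lambda>n. h2 n b) \<longlonglongrightarrow> h b"
    and rap: "rapid e (ball b s) (\<lambda>n y. h1 n y - h2 n (y - e n))"
    and y: "y \<in> ball b (R/4)"
  shows "deriv h y \<noteq> 0"
proof -
  define S where "S = ball b (R/4)"
  define k where "k = (\<lambda>n y. (h1 n y - h2 n y) / e n)"
  have holdh: "deriv h holomorphic_on ball b R" using h by (intro holomorphic_deriv) auto
  \<comment> \<open>Convergence of \<open>h2 n\<close> is known at \<open>b\<close> only; the
    alternative against \<open>h\<close> makes it uniform.\<close>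
  have ulim2: "uniform_limit (ball b (R/2)) h2 h sequentially"
    by (rule uniform_limit_on_subset[OF Harnack_uniform_limit[where F = h2, OF h R _ lim]])
       (use H in \<open>auto elim: eventually_mono\<close>)
  have ulimd: "uniform_limit (ball b (3*R/8)) (\<lambda>n. deriv (h2 n)) (deriv h) sequentially"
  proof (rule uniform_limit_deriv[OF _ _ ulim2])
    show "h holomorphic_on ball b (R/2)" using h R by (auto intro: holomorphic_on_subset)
    show "\<forall>\<^sub>F n in sequentially. h2 n holomorphic_on ball b (R/2)"
      using H by (rule eventually_mono) (use R in \<open>auto intro: holomorphic_on_subset\<close>)
  qed (use R in auto)
  have ev1: "\<forall>\<^sub>F n in sequentially. 1 * cmod (e n) \<le> d" if "0 < d" for d
    using eventually_mult_norm_le[OF e(1) that] .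
  have R5: "0 < R/5" using R by simp
  \<comment> \<open>Smallness on the radius \<open>s\<close>, which may be tiny, is spread to a
    radius depending on \<open>R\<close> alone. On \<open>3*R/4\<close> the shifted argument still
    lies in the disc of radius \<open>R\<close>.\<close>
  have rap2: "rapid e (ball b ((3*R/4)/2)) (\<lambda>n y. h1 n y - h2 n (y - e n))"
  proof (rule rapid_propagate[OF e _ _ s rap])
    show "\<forall>\<^sub>F n in sequentially. (\<lambda>y. h1 n y - h2 n (y - e n)) holomorphic_on ball b (3*R/4) \<and>
      (\<forall>w\<in>ball b (3*R/4). cmod (h1 n w - h2 n (w - e n)) \<le> 2 * B)"
      using H ev1[of "R/5", OF R5]
    proof eventually_elim
      case (elim n)
      have en: "cmod (e n) < R/4" using elim R by auto
      have sub: "w - e n \<in> ball b R" if "w \<in> ball b (3*R/4)" for w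
        using that norm_triangle_ineq[of "b - w" "e n"] en by (auto simp: dist_norm algebra_simps)
      have sub1: "w \<in> ball b R" if "w \<in> ball b (3*R/4)" for w using that R by auto
      have "(h2 n \<circ> (\<lambda>y. y - e n)) holomorphic_on ball b (3*R/4)"
        by (rule holomorphic_on_compose_gen[of _ _ _ "ball b R"])
           (use elim sub in \<open>auto intro!: holomorphic_intros\<close>)
      moreover have "h1 n holomorphic_on ball b (3*R/4)"
        using elim sub1 by (auto intro: holomorphic_on_subset)
      moreover have "cmod (h1 n w - h2 n (w - e n)) \<le> 2 * B" if "w \<in> ball b (3*R/4)" for w
      proof -
        have "cmod (h1 n w) \<le> B" "cmod (h2 n (w - e n)) \<le> B"
          using elim(1) sub[OF that] sub1[OF that] by blast+
        then show ?thesis using norm_triangle_ineq4[of "h1 n w" "h2 n (w - e n)"] by linarith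
      qed
      ultimately show ?case by (auto simp: o_def intro!: holomorphic_intros)
    qed
  qed (use R in auto)
  have ucont: "uniformly_continuous_on (cball b (R/2)) (deriv h)"
    by (intro compact_uniformly_continuous holomorphic_on_imp_continuous_on holomorphic_on_subset[OF holdh])
       (use R in auto)
  \<comment> \<open>The error has two parts. The defect of the shifted graphs is used at order 2, so
    it is negligible after division by \<open>e n\<close>; rapid decrease was spent on enlarging the
    disc. What remains is the first order Taylor error of \<open>h2 n\<close>.\<close>
  have ulimk: "uniform_limit S k (\<lambda>y. - deriv h y) sequentially"
  proof (rule uniform_limitI)
    fix \<eta> :: real assume \<eta>: "\<eta> > 0"
    obtain d where d: "d > 0" "\<And>x x'. \<lbrakk>x \<in> cball b (R/2); x' \<in> cball b (R/2); dist x' x < d\<rbrakk> \<Longrightarrow> dist (deriv h x') (deriv h x) < \<eta>/4"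
      using ucont \<eta> unfolding uniformly_continuous_on_def by (metis divide_pos_pos zero_less_numeral)
    define m where "m = min (R/9) (d/2)"
    have m: "0 < m" and \<eta>4: "0 < \<eta>/4" using d(1) R \<eta> by (auto simp: m_def)
    have "\<forall>\<^sub>F n in sequentially. \<forall>x\<in>ball b ((3*R/4)/2). cmod (h1 n x - h2 n (x - e n)) \<le> cmod (e n) ^ 2"
      using rap2 unfolding rapid_def by blast
    moreover have "\<forall>\<^sub>F n in sequentially. \<forall>x\<in>ball b (3*R/8). dist (deriv (h2 n) x) (deriv h x) < \<eta>/4"
      using uniform_limitD[OF ulimd, of "\<eta>/4"] \<eta> by simp
    ultimately show "\<forall>\<^sub>F n in sequentially. \<forall>y\<in>S. dist (k n y) (- deriv h y) < \<eta>"
      using H ev1[of m, OF m] ev1[of "\<eta>/4", OF \<eta>4]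
    proof eventually_elim
      case (elim n)
      have en: "cmod (e n) < R/8" "cmod (e n) < d" using elim R d(1) by (auto simp: m_def)
      show ?case
      proof
        fix y assume y: "y \<in> S"
        have y1: "y \<in> ball b (3*R/8)" using y R by (auto simp: S_def)
        have sub: "y - \<zeta> \<in> ball b (3*R/8)" if "\<zeta> \<in> cball 0 (cmod (e n))" for \<zeta>
          using that y norm_triangle_ineq[of "b - y" \<zeta>] en by (auto simp: dist_norm algebra_simps S_def)
        \<comment> \<open>The derivative of \<open>g\<close> is
          \<open>deriv h y - deriv (h2 n) (y - \<zeta>)\<close>, small by uniform convergence of the
          derivatives together with uniform continuity of \<open>deriv h\<close>.\<close>
        define g where "g = (\<lambda>\<zeta>. h2 n (y - \<zeta>) + \<zeta> * deriv h y)"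
        have "cmod (g (e n) - g 0) \<le> (\<eta>/2) * cmod (e n - 0)"
        proof (rule field_differentiable_bound[of "cball 0 (cmod (e n))" g "\<lambda>\<zeta>. - deriv (h2 n) (y - \<zeta>) + deriv h y"])
          fix \<zeta> :: complex assume z: "\<zeta> \<in> cball 0 (cmod (e n))"
          have "y - \<zeta> \<in> ball b R" using sub[OF z] R by auto
          then have "(h2 n has_field_derivative deriv (h2 n) (y - \<zeta>)) (at (y - \<zeta>))"
            using elim by (auto intro: holomorphic_derivI)
          then show "(g has_field_derivative - deriv (h2 n) (y - \<zeta>) + deriv h y) (at \<zeta> within cball 0 (cmod (e n)))"
          proof -
            assume d2: "(h2 n has_field_derivative deriv (h2 n) (y - \<zeta>)) (at (y - \<zeta>))"
            have "((\<lambda>\<zeta>. h2 n (y - \<zeta>)) has_field_derivative deriv (h2 n) (y - \<zeta>) * (-1))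
                (at \<zeta> within cball 0 (cmod (e n)))"
              by (rule DERIV_chain2[where f = "h2 n" and g = "\<lambda>\<zeta>. y - \<zeta>", OF d2]) (auto intro!: derivative_eq_intros)
            moreover have "((\<lambda>\<zeta>. \<zeta> * deriv h y) has_field_derivative deriv h y) (at \<zeta> within cball 0 (cmod (e n)))"
              by (auto intro!: derivative_eq_intros)
            ultimately show ?thesis unfolding g_def using DERIV_add by fastforce
          qed
          have "dist (deriv (h2 n) (y - \<zeta>)) (deriv h (y - \<zeta>)) < \<eta>/4" using elim sub[OF z] by blast
          moreover have "dist (deriv h (y - \<zeta>)) (deriv h y) < \<eta>/4"
            by (rule d(2)) (use sub[OF z] y1 R z en in \<open>auto simp: dist_norm\<close>)
          ultimately have "dist (deriv (h2 n) (y - \<zeta>)) (deriv h y) < \<eta>/2"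
            using dist_triangle[of "deriv (h2 n) (y - \<zeta>)" "deriv h y" "deriv h (y - \<zeta>)"] by simp
          then show "cmod (- deriv (h2 n) (y - \<zeta>) + deriv h y) \<le> \<eta>/2"
            by (simp add: dist_norm norm_minus_commute)
        qed auto
        then have 1: "cmod (h2 n (y - e n) + e n * deriv h y - h2 n y) \<le> (\<eta>/2) * cmod (e n)"
          by (simp add: g_def)
        have "cmod (h1 n y - h2 n (y - e n)) \<le> cmod (e n) ^ 2" using elim(1) y1 by simp
        also have "\<dots> \<le> (\<eta>/4) * cmod (e n)" using elim(5)
          unfolding power2_eq_square by (intro mult_right_mono) auto
        finally have 2: "cmod (h1 n y - h2 n (y - e n)) \<le> (\<eta>/4) * cmod (e n)" .
        have "cmod ((h1 n y - h2 n (y - e n)) + (h2 n (y - e n) + e n * deriv h y - h2 n y)) \<le> (3*\<eta>/4) * cmod (e n)"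
          by (rule order_trans[OF norm_triangle_ineq]) (use 1 2 in \<open>simp add: algebra_simps\<close>)
        moreover have "(h1 n y - h2 n (y - e n)) + (h2 n (y - e n) + e n * deriv h y - h2 n y) = e n * (k n y - (- deriv h y))"
          using e(2) by (simp add: k_def field_simps)
        ultimately have "cmod (e n) * cmod (k n y - (- deriv h y)) \<le> cmod (e n) * (3*\<eta>/4)"
          by (simp add: norm_mult mult.commute)
        then have "cmod (k n y - (- deriv h y)) \<le> 3*\<eta>/4" using e(2)[of n] by simp
        then show "dist (k n y) (- deriv h y) < \<eta>" unfolding dist_norm using \<eta> by linarith
      qed
    qed
  qed
  \<comment> \<open>If \<open>h1 n\<close> and \<open>h2 n\<close> coincided for infinitely many n,
    then \<open>k n\<close> would vanish for these n and so would the limit. Nonconstancy on the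
    smaller ball excludes this and makes Hurwitz's theorem applicable.\<close>
  have ncS: "\<not> (\<lambda>y. - deriv h y) constant_on S"
  proof
    assume "(\<lambda>y. - deriv h y) constant_on S"
    then obtain a where a: "\<And>y. y \<in> S \<Longrightarrow> - deriv h y = a" by (auto simp: constant_on_def)
    have "deriv h x = - a" if "x \<in> ball b R" for x
    proof (rule holomorphic_eqI_ball[OF holdh])
      show "deriv h x = - a" if "x \<in> ball b (R/4)" for x
        using a[of x] that unfolding S_def by (metis minus_minus)
    qed (use that R in auto)
    with nc show False by (auto simp: constant_on_def)
  qed
  have "\<forall>\<^sub>F n in sequentially. \<forall>y\<in>S. h1 n y \<noteq> h2 n y"
  proof (rule ccontr)
    assume "\<not> ?thesis"
    then have fr: "\<exists>\<^sub>F n in sequentially. \<not> (\<forall>y\<in>S. h1 n y \<noteq> h2 n y)" by (simp add: not_eventually)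
    have "- deriv h y = 0" if "y \<in> S" for y
    proof (rule ccontr)
      assume "- deriv h y \<noteq> 0"
      then have "\<forall>\<^sub>F n in sequentially. \<forall>y'\<in>S. dist (k n y') (- deriv h y') < cmod (- deriv h y)"
        by (intro uniform_limitD[OF ulimk]) simp
      then have ev: "\<forall>\<^sub>F n in sequentially. dist (k n y) (- deriv h y) < cmod (- deriv h y) \<and> (\<forall>y\<in>S. h1 n y \<noteq> h2 n y)"
        using H
      proof eventually_elim
        case (elim n)
        have "k n y \<noteq> 0" using elim(1) that by force
        then have "h1 n y \<noteq> h2 n y" by (auto simp: k_def)
        then have "\<forall>y\<in>ball b R. h1 n y \<noteq> h2 n y" using elim(2) that R by (auto simp: S_def)
        then show ?case using elim(1) that R by (auto simp: S_def)
      qed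
      from frequently_eventually_frequently[OF fr ev] show False
        by (auto dest!: frequently_ex)
    qed
    then show False using ncS by (auto simp: constant_on_def)
  qed
  with H have "\<forall>\<^sub>F n in sequentially. (\<forall>y\<in>S. h1 n y \<noteq> h2 n y) \<and> h1 n holomorphic_on ball b R \<and> h2 n holomorphic_on ball b R"
    by eventually_elim auto
  then obtain n0 where n0: "\<And>n. n \<ge> n0 \<Longrightarrow> (\<forall>y\<in>S. h1 n y \<noteq> h2 n y) \<and> h1 n holomorphic_on ball b R \<and> h2 n holomorphic_on ball b R"
    by (auto simp: eventually_sequentially)
  have SR: "S \<subseteq> ball b R" using R by (auto simp: S_def)
  have "- deriv h y \<noteq> 0"
  proof (rule Hurwitz_no_zeros[of S "\<lambda>n. k (n + n0)" "\<lambda>y. - deriv h y"])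
    show "k (n + n0) holomorphic_on S" for n
      unfolding k_def using n0[of "n + n0"] e(2) SR
      by (intro holomorphic_intros) (auto intro: holomorphic_on_subset)
    show "(\<lambda>y. - deriv h y) holomorphic_on S"
      by (intro holomorphic_on_minus holomorphic_on_subset[OF holdh SR])
    show "uniform_limit K (\<lambda>n. k (n + n0)) (\<lambda>y. - deriv h y) sequentially" if "K \<subseteq> S" for K
    proof -
      have "uniform_limit K k (\<lambda>y. - deriv h y) sequentially"
        using ulimk that by (rule uniform_limit_on_subset)
      then show ?thesis
        unfolding uniform_limit_iff
        unfolding eventually_sequentially by (meson le_add1 order_trans)
    qed
    show "k (n + n0) z \<noteq> 0" if "z \<in> S" for n z
      using n0[of "n + n0"] that e(2) by (auto simp: k_def)
    show "y \<in> S" using y by (simp add: S_def)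
  qed (use ncS in \<open>auto simp: S_def\<close>)
  then show ?thesis by simp
qed

section \<open>Topology of flow boxes\<close>

text \<open>A degree argument. Along the circle \<open>u\<close> winds around 0 as many times as the
  order of its zero, and the homotopy passes this to \<open>\<tau>\<close>. If \<open>\<tau>\<close>
  omitted a value \<open>y\<close> below its minimum modulus on the circle,
  \<open>\<tau> - y\<close> would have no zero on the whole disc, and its loop would be contractible
  in the punctured plane. The function \<open>\<tau>\<close> is only continuous because it will be
  built from the transversal parameter of a flow box.\<close>

lemma covers_ball_of_homotopic_to_holomorphic:
  assumes u: "u holomorphic_on ball w0 \<rho>" "u w0 = 0" "\<And>w. w \<in> ball w0 \<rho> \<Longrightarrow> w \<noteq> w0 \<Longrightarrow> u w \<noteq> 0"
    and \<delta>: "0 < \<delta>" "\<delta> < \<rho>"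
    and \<tau>: "continuous_on (cball w0 \<delta>) \<tau>"
    and H: "continuous_on ({0..1::real} \<times> sphere w0 \<delta>) H"
      "\<And>s w. s \<in> {0..1} \<Longrightarrow> w \<in> sphere w0 \<delta> \<Longrightarrow> H (s, w) \<noteq> 0"
      "\<And>w. w \<in> sphere w0 \<delta> \<Longrightarrow> H (0, w) = u w" "\<And>w. w \<in> sphere w0 \<delta> \<Longrightarrow> H (1, w) = \<tau> w"
  obtains m :: real where "0 < m" "ball 0 m \<subseteq> \<tau> ` cball w0 \<delta>"
proof -
  define \<gamma> where "\<gamma> = circlepath w0 \<delta>"
  have \<gamma>: "path_image \<gamma> = sphere w0 \<delta>" "path \<gamma>" "valid_path \<gamma>" "pathfinish \<gamma> = pathstart \<gamma>"
    using \<delta> by (auto simp: \<gamma>_def)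
  have \<gamma>s: "\<gamma> t \<in> sphere w0 \<delta>" if "t \<in> {0..1}" for t using \<gamma>(1) that by (auto simp: path_image_def)
  have sub: "sphere w0 \<delta> \<subseteq> ball w0 \<rho> - {w0}" using \<delta> by auto
  have nconst: "\<not> u constant_on ball w0 \<rho>"
  proof
    assume "u constant_on ball w0 \<rho>"
    then have "u (w0 + of_real \<delta>) = u w0"
      using \<delta> by (auto simp: constant_on_def dist_norm)
    moreover have "u (w0 + of_real \<delta>) \<noteq> 0" using \<delta> by (intro u(3)) (auto simp: dist_norm)
    ultimately show False using u(2) by simp
  qed
  have analytic: "u analytic_on ball w0 \<rho>" using u(1) by (simp add: analytic_on_open)
  have cu: "contour_integral (u \<circ> \<gamma>) (\<lambda>w. 1 / w) = contour_integral \<gamma> (\<lambda>w. deriv u w * (1 / u w))"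
    by (rule contour_integral_comp_analyticW[OF analytic \<gamma>(3)]) (use \<gamma>(1) sub in auto)
  \<comment> \<open>The argument principle with weight 1 and no poles; \<open>w0\<close> being the
    only zero, the integral is 2 pi i times its order.\<close>
  have "contour_integral \<gamma> (\<lambda>w. deriv u w * 1 / u w) = 2 * pi * \<i> *
      (\<Sum>p\<in>{w \<in> ball w0 \<rho>. u w = 0 \<or> w \<in> {}}. winding_number \<gamma> p * 1 * zorder u p)"
  proof (rule argument_principle)
    have "{w \<in> ball w0 \<rho>. u w = 0 \<or> w \<in> {}} = {w0}" using u(2,3) \<delta> by auto
    then show "path_image \<gamma> \<subseteq> ball w0 \<rho> - {w \<in> ball w0 \<rho>. u w = 0 \<or> w \<in> {}}"
      "finite {w \<in> ball w0 \<rho>. u w = 0 \<or> w \<in> {}}" using \<gamma>(1) sub by auto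
    show "\<forall>z. z \<notin> ball w0 \<rho> \<longrightarrow> winding_number \<gamma> z = 0"
      using \<gamma> sub by (intro allI impI winding_number_zero_outside[of _ "ball w0 \<rho>"]) auto
  qed (use u(1) \<gamma> in auto)
  moreover have "{w \<in> ball w0 \<rho>. u w = 0 \<or> w \<in> {}} = {w0}" using u(2,3) \<delta> by auto
  moreover have "winding_number \<gamma> w0 = 1" using \<delta> by (simp add: \<gamma>_def winding_number_circlepath_centre)
  moreover have "zorder u w0 > 0"
  proof (rule zorder_pos_iff'[THEN iffD2])
    show "u analytic_on {w0}" using analytic \<delta> by (auto intro: analytic_on_subset)
    show "\<exists>\<^sub>F w in at w0. u w \<noteq> 0"
    proof -
      have "\<forall>\<^sub>F w in at w0. w \<in> ball w0 \<rho> - {w0}"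
        using \<delta> eventually_at_in_open[of "ball w0 \<rho>" w0] by auto
      then have "\<forall>\<^sub>F w in at w0. u w \<noteq> 0" by eventually_elim (use u(3) in auto)
      then show ?thesis by (intro eventually_frequently) auto
    qed
  qed (use u(2) in auto)
  ultimately have "contour_integral (u \<circ> \<gamma>) (\<lambda>w. 1 / w) \<noteq> 0" using cu by simp
  moreover have "winding_number (u \<circ> \<gamma>) 0 = 1 / (2 * pi * \<i>) * contour_integral (u \<circ> \<gamma>) (\<lambda>w. 1 / (w - 0))"
  proof (rule winding_number_valid_path)
    show "valid_path (u \<circ> \<gamma>)"
      by (rule valid_path_compose_holomorphic[OF \<gamma>(3) u(1)]) (use \<gamma>(1) sub in auto)
    show "0 \<notin> path_image (u \<circ> \<gamma>)" using \<gamma>(1) sub u(3) by (fastforce simp: path_image_compose)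
  qed
  ultimately have wn: "winding_number (u \<circ> \<gamma>) 0 \<noteq> 0" by simp
  have hom: "homotopic_loops (- {0}) (u \<circ> \<gamma>) (\<tau> \<circ> \<gamma>)"
    unfolding homotopic_loops
  proof (intro exI conjI ballI)
    show "continuous_on ({0..1} \<times> {0..1}) (\<lambda>p. H (fst p, \<gamma> (snd p)))"
      by (rule continuous_on_compose2[OF H(1)])
        (use \<gamma>(2) \<gamma>s in \<open>auto intro!: continuous_intros continuous_on_compose2[of "{0..1}" \<gamma>] simp: path_def\<close>)
    show "(\<lambda>p. H (fst p, \<gamma> (snd p))) \<in> {0..1} \<times> {0..1} \<rightarrow> - {0}" using H(2) \<gamma>s by auto
  qed (use H \<gamma>s \<gamma>(4) in \<open>auto simp: pathfinish_def pathstart_def\<close>)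
  have \<tau>0: "\<tau> w \<noteq> 0" if "w \<in> sphere w0 \<delta>" for w using H(2)[of 1 w] H(4)[OF that] that by simp
  have c\<tau>: "continuous_on (sphere w0 \<delta>) \<tau>" using \<tau> by (rule continuous_on_subset) auto
  have ne: "sphere w0 \<delta> \<noteq> {}" using \<delta> by simp
  obtain w1 where w1: "w1 \<in> sphere w0 \<delta>" "\<And>w. w \<in> sphere w0 \<delta> \<Longrightarrow> cmod (\<tau> w1) \<le> cmod (\<tau> w)"
    using continuous_attains_inf[OF compact_sphere ne continuous_on_norm[OF c\<tau>]] by auto
  have "ball 0 (cmod (\<tau> w1)) \<subseteq> \<tau> ` cball w0 \<delta>"
  proof (rule ccontr)
    assume "\<not> ?thesis"
    then obtain y where y: "cmod y < cmod (\<tau> w1)" "y \<notin> \<tau> ` cball w0 \<delta>"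
      by (force simp: subset_iff)
    have p\<tau>: "path (\<tau> \<circ> \<gamma>)" by (rule path_continuous_image) (use \<gamma> c\<tau> in auto)
    have "homotopic_loops (- {0}) (\<tau> \<circ> \<gamma>) (\<lambda>t. \<tau> (\<gamma> t) - y)"
    proof (rule homotopic_loops_linear)
      show "path (\<lambda>t. \<tau> (\<gamma> t) - y)" using p\<tau> by (auto simp: path_def o_def intro!: continuous_intros)
      show "closed_segment ((\<tau> \<circ> \<gamma>) t) (\<tau> (\<gamma> t) - y) \<subseteq> - {0}" if "t \<in> {0..1}" for t
      proof -
        have "0 \<notin> closed_segment (\<tau> (\<gamma> t)) (\<tau> (\<gamma> t) - y)"
        proof
          assume "0 \<in> closed_segment (\<tau> (\<gamma> t)) (\<tau> (\<gamma> t) - y)"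
          then have "cmod (0 - \<tau> (\<gamma> t)) \<le> cmod ((\<tau> (\<gamma> t) - y) - \<tau> (\<gamma> t))" by (rule segment_bound1)
          then show False using w1(2)[OF \<gamma>s[OF that]] y(1) by simp
        qed
        then show ?thesis by auto
      qed
    qed (use p\<tau> \<gamma>(4) in \<open>auto simp: pathfinish_def pathstart_def\<close>)
    moreover have "homotopic_loops (- {0}) ((\<lambda>w. \<tau> w - y) \<circ> \<gamma>) ((\<lambda>w. \<tau> w - y) \<circ> linepath w0 w0)"
    proof (rule homotopic_loops_continuous_image)
      show "homotopic_loops (cball w0 \<delta>) \<gamma> (linepath w0 w0)"
      proof (rule homotopic_loops_linear)
        show "closed_segment (\<gamma> t) (linepath w0 w0 t) \<subseteq> cball w0 \<delta>" if "t \<in> {0..1}" for t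
          using \<gamma>s[OF that] \<delta> by (intro closed_segment_subset) (auto simp: linepath_refl)
      qed (use \<gamma> in auto)
    qed (use y \<tau> in \<open>auto intro!: continuous_intros\<close>)
    ultimately have "homotopic_loops (- {0}) (u \<circ> \<gamma>) ((\<lambda>w. \<tau> w - y) \<circ> linepath w0 w0)"
      using hom unfolding o_def by (meson homotopic_loops_trans)
    then have "winding_number (u \<circ> \<gamma>) 0 = winding_number ((\<lambda>w. \<tau> w - y) \<circ> linepath w0 w0) 0"
      by (rule winding_number_homotopic_loops)
    also have "(\<lambda>w. \<tau> w - y) \<circ> linepath w0 w0 = linepath (\<tau> w0 - y) (\<tau> w0 - y)"
      by (auto simp: linepath_refl)
    also have "winding_number (linepath (\<tau> w0 - y) (\<tau> w0 - y)) 0 = 0"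
      by (rule winding_number_trivial) (use y \<delta> in auto)
    finally show False using wn by (simp add: o_def)
  qed
  then show ?thesis using that \<tau>0[OF w1(1)] by (meson zero_less_norm_iff)
qed

lemma flow_box_inverse:
  assumes fb: "flow_box \<Lambda> X U T \<phi>" and z0: "z0 \<in> ball 0 1" and t0: "t0 \<in> T"
    and nz: "deriv (\<lambda>w. fst (\<phi> (w, t0))) z0 \<noteq> 0"
  obtains r s d G where "0 < r" "0 < s" "0 < d" "ball z0 s \<subseteq> ball 0 1"
    "\<And>t. t \<in> T \<inter> ball t0 d \<Longrightarrow> G t holomorphic_on ball (fst (\<phi> (z0, t0))) r"
    "\<And>t x. t \<in> T \<inter> ball t0 d \<Longrightarrow> x \<in> ball (fst (\<phi> (z0, t0))) r \<Longrightarrow> G t x \<in> ball z0 s \<and> fst (\<phi> (G t x, t)) = x"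
    "\<And>t z. t \<in> T \<inter> ball t0 d \<Longrightarrow> z \<in> ball z0 s \<Longrightarrow> fst (\<phi> (z, t)) \<in> ball (fst (\<phi> (z0, t0))) r \<Longrightarrow>
      G t (fst (\<phi> (z, t))) = z"
    "continuous_on ((T \<inter> ball t0 d) \<times> ball (fst (\<phi> (z0, t0))) r) (\<lambda>(t, x). G t x)"
    "\<And>t z. t \<in> T \<inter> ball t0 d \<Longrightarrow> z \<in> ball z0 s \<Longrightarrow> dist (\<phi> (z, t)) (\<phi> (z0, t0)) \<le> 1"
proof -
  define \<psi> where "\<psi> = (\<lambda>t z. fst (\<phi> (z, t)))"
  define p where "p = \<phi> (z0, t0)"
  define c where "c = deriv (\<psi> t0) z0"
  have c: "c \<noteq> 0" using nz by (simp add: c_def \<psi>_def)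
  have cont: "continuous_on (ball 0 1 \<times> T) \<phi>"
    using fb unfolding flow_box_def homeomorphism_def by blast
  have hol: "\<psi> t holomorphic_on ball 0 1" if "t \<in> T" for t
    using fb that unfolding flow_box_def \<psi>_def by blast
  have "continuous_on (ball 0 1) (\<lambda>z. \<phi> (z, t0))"
    by (rule continuous_on_compose2[OF cont]) (use t0 in \<open>auto intro!: continuous_intros\<close>)
  moreover have "continuous_on (ball 0 1) (deriv (\<psi> t0))"
    using hol[OF t0] by (intro holomorphic_on_imp_continuous_on holomorphic_deriv) auto
  ultimately have "isCont (\<lambda>z. \<phi> (z, t0)) z0" "isCont (deriv (\<psi> t0)) z0"
    using z0 by (auto simp: continuous_on_eq_continuous_at)
  then have lim: "((\<lambda>z. \<phi> (z, t0)) \<longlongrightarrow> p) (nhds z0)" "(deriv (\<psi> t0) \<longlongrightarrow> c) (nhds z0)"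
    using tendsto_at_iff_tendsto_nhds[of "\<lambda>z. \<phi> (z, t0)" z0] tendsto_at_iff_tendsto_nhds[of "deriv (\<psi> t0)" z0]
    unfolding isCont_def p_def c_def by auto
  have "\<forall>\<^sub>F z in nhds z0. dist (\<phi> (z, t0)) p < 1/2" by (rule tendstoD[OF lim(1)]) simp
  moreover have "\<forall>\<^sub>F z in nhds z0. dist (deriv (\<psi> t0) z) c < cmod c/8"
    by (rule tendstoD[OF lim(2)]) (use c in simp)
  moreover have "\<forall>\<^sub>F z in nhds z0. z \<in> ball 0 1"
    using z0 by (intro eventually_nhds_in_open) auto
  ultimately have "\<forall>\<^sub>F z in nhds z0. dist (\<phi> (z, t0)) p < 1/2 \<and> dist (deriv (\<psi> t0) z) c < cmod c/8 \<and> z \<in> ball 0 1"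
    by eventually_elim auto
  then obtain e where e: "e > 0" "\<And>z. dist z z0 < e \<Longrightarrow> dist (\<phi> (z, t0)) p < 1/2 \<and> dist (deriv (\<psi> t0) z) c < cmod c/8 \<and> z \<in> ball 0 1"
    unfolding eventually_nhds_metric by blast
  define s where "s = e/3"
  have s: "0 < s" using e by (simp add: s_def)
  have in_e: "dist z z0 < e" if "z \<in> cball z0 (2 * s)" for z using that e(1) by (auto simp: s_def dist_commute)
  have sub2: "cball z0 (2 * s) \<subseteq> ball 0 1" using e(2) in_e by blast
  \<comment> \<open>Cauchy's estimate between the radii \<open>3*s/2\<close> and \<open>2*s\<close>
    turns \<open>\<eta>\<close> into \<open>4*\<eta>/s\<close>, at most |c|/8. Together with the
    |c|/8 from the continuity of \<open>deriv (\<psi> t0)\<close> the deviation from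
    \<open>c\<close> is at most |c|/4.\<close>
  define \<eta> where "\<eta> = min (1/2) (s * cmod c / 32)"
  have \<eta>: "0 < \<eta>" "\<eta> \<le> 1/2" "\<eta> \<le> s * cmod c / 32" using s c by (auto simp: \<eta>_def)
  have "continuous_on (T \<times> cball z0 (2 * s)) (\<lambda>(t, z). \<phi> (z, t))"
    unfolding case_prod_beta
    by (rule continuous_on_compose2[OF cont]) (use sub2 in \<open>auto intro!: continuous_intros\<close>)
  \<comment> \<open>The tube lemma: closeness to the plaque of \<open>t0\<close> is uniform over the
    compact disc.\<close>
  then obtain X0 where X0: "t0 \<in> X0" "open X0"
    "\<forall>t\<in>X0 \<inter> T. \<forall>z\<in>cball z0 (2 * s). dist (\<phi> (z, t)) (\<phi> (z, t0)) \<le> \<eta>"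
    using continuous_on_prod_compactE[of T "cball z0 (2 * s)" "\<lambda>(t, z). \<phi> (z, t)" t0 \<eta>] t0 \<eta>(1) by auto
  then obtain d where d: "d > 0" "ball t0 d \<subseteq> X0" by (meson openE)
  have close: "dist (\<phi> (z, t)) (\<phi> (z, t0)) \<le> \<eta>" if "t \<in> T \<inter> ball t0 d" "z \<in> cball z0 (2 * s)" for t z
    using X0(3) d(2) that by blast
  have close1: "cmod (\<psi> t z - \<psi> t0 z) \<le> \<eta>" if "t \<in> T \<inter> ball t0 d" "z \<in> cball z0 (2 * s)" for t z
    using order_trans[OF dist_fst_le close[OF that]] by (simp add: \<psi>_def dist_norm)
  have dclose: "cmod (deriv (\<psi> t) z - c) \<le> cmod c / 4" if t: "t \<in> T \<inter> ball t0 d" and z: "z \<in> ball z0 (3 * s/2)" for t z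
  proof -
    have zb: "z \<in> cball z0 (2 * s)" "z \<in> ball 0 1" using z subsetD[OF sub2, of z] s by auto
    have "cmod (deriv (\<lambda>z. \<psi> t z - \<psi> t0 z) z) \<le> 2 * \<eta> / (2 * s - 3 * s/2)"
    proof (rule norm_deriv_le_ball'[OF _ _ z])
      show "(\<lambda>z. \<psi> t z - \<psi> t0 z) holomorphic_on ball z0 (2 * s)"
        using t t0 sub2 by (intro holomorphic_intros holomorphic_on_subset[OF hol]) auto
    qed (use close1[OF t] s in auto)
    also have "\<dots> = 4 * \<eta> / s" using s by (simp add: field_simps)
    also have "\<dots> \<le> cmod c / 8" using \<eta>(3) s by (simp add: field_simps)
    finally have "cmod (deriv (\<lambda>z. \<psi> t z - \<psi> t0 z) z) \<le> cmod c / 8" .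
    moreover have "deriv (\<lambda>z. \<psi> t z - \<psi> t0 z) z = deriv (\<psi> t) z - deriv (\<psi> t0) z"
      using t t0 zb(2) by (intro deriv_diff holomorphic_on_imp_differentiable_at[OF hol]) auto
    moreover have "cmod (deriv (\<psi> t0) z - c) < cmod c / 8" using e(2)[OF in_e[OF zb(1)]] by (simp add: dist_norm)
    ultimately show ?thesis
      using norm_triangle_ineq[of "deriv (\<psi> t) z - deriv (\<psi> t0) z" "deriv (\<psi> t0) z - c"] by simp
  qed
  have expand: "3/4 * cmod c * cmod (z - w) \<le> cmod (\<psi> t z - \<psi> t w)"
    if t: "t \<in> T \<inter> ball t0 d" and z: "z \<in> ball z0 (3 * s/2)" and w: "w \<in> ball z0 (3 * s/2)" for t z w
  proof -
    have sub: "ball z0 (3 * s/2) \<subseteq> ball 0 1" using sub2 s by (auto simp: subset_iff)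
    have "cmod ((\<psi> t z - c * z) - (\<psi> t w - c * w)) \<le> cmod c / 4 * cmod (z - w)"
    proof (rule field_differentiable_bound[of "ball z0 (3 * s/2)" "\<lambda>z. \<psi> t z - c * z" "\<lambda>z. deriv (\<psi> t) z - c"])
      fix x assume x: "x \<in> ball z0 (3 * s/2)"
      have "(\<psi> t has_field_derivative deriv (\<psi> t) x) (at x)"
        using hol[of t] t x sub by (intro holomorphic_derivI[of _ "ball 0 1"]) auto
      then show "((\<lambda>z. \<psi> t z - c * z) has_field_derivative deriv (\<psi> t) x - c) (at x within ball z0 (3 * s/2))"
        by (intro DERIV_diff DERIV_cmult_Id) (rule has_field_derivative_at_within)
      show "cmod (deriv (\<psi> t) x - c) \<le> cmod c / 4" by (rule dclose[OF t x])
    qed (use z w in auto)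
    then have 1: "cmod ((\<psi> t z - \<psi> t w) - c * (z - w)) \<le> cmod c / 4 * cmod (z - w)"
      by (simp add: algebra_simps)
    have "cmod (c * (z - w)) \<le> cmod (\<psi> t z - \<psi> t w) + cmod ((\<psi> t z - \<psi> t w) - c * (z - w))"
      using norm_triangle_ineq4[of "\<psi> t z - \<psi> t w" "(\<psi> t z - \<psi> t w) - c * (z - w)"] by simp
    with 1 show ?thesis by (simp add: norm_mult)
  qed
  \<comment> \<open>The point \<open>\<psi> t z0\<close> is within \<open>r\<close> of
    \<open>fst p\<close>, so a disc of radius 2r = s |c| / 16 around it is enough. Bloch's lemma
    covers a radius of at least (3 - 2 sqrt 2) s (3/4) |c|, and 3 - 2 sqrt 2 exceeds 1/8.\<close>
  define r where "r = s * cmod c / 32"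
  have r: "0 < r" using s c by (simp add: r_def)
  have sub1: "ball z0 s \<subseteq> ball 0 1" "ball z0 s \<subseteq> ball z0 (3 * s/2)" using sub2 s by (auto simp: subset_iff)
  have cover: "ball (fst p) r \<subseteq> \<psi> t ` ball z0 s" if t: "t \<in> T \<inter> ball t0 d" for t
  proof -
    have dz0: "3/4 * cmod c \<le> cmod (deriv (\<psi> t) z0)"
      using dclose[OF t, of z0] s norm_triangle_ineq2[of c "deriv (\<psi> t) z0"] by (simp add: norm_minus_commute)
    have "ball (\<psi> t z0) ((3 - 2 * sqrt 2) * s * cmod (deriv (\<psi> t) z0)) \<subseteq> \<psi> t ` ball z0 s"
    proof (rule Bloch_lemma)
      show "\<psi> t holomorphic_on cball z0 s"
        using hol[of t] t sub2 s by (auto intro!: holomorphic_on_subset[OF hol] simp: subset_iff)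
      show "cmod (deriv (\<psi> t) z) \<le> 2 * cmod (deriv (\<psi> t) z0)" if "z \<in> ball z0 s" for z
      proof -
        have "cmod (deriv (\<psi> t) z) \<le> cmod c + cmod c / 4"
          using dclose[OF t, of z] that sub1(2) norm_triangle_ineq2[of "deriv (\<psi> t) z" c] by force
        then show ?thesis using dz0 norm_ge_zero[of c] by linarith
      qed
    qed (use s in auto)
    moreover have "ball (fst p) r \<subseteq> ball (\<psi> t z0) ((3 - 2 * sqrt 2) * s * cmod (deriv (\<psi> t) z0))"
    proof
      fix x assume x: "x \<in> ball (fst p) r"
      have "cmod (\<psi> t z0 - fst p) \<le> r" using close1[OF t, of z0] s \<eta>(3) by (simp add: p_def \<psi>_def r_def)
      then have "dist (\<psi> t z0) x < 2 * r"
        using x dist_triangle[of "\<psi> t z0" x "fst p"] by (simp add: dist_norm)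
      also have "2 * r \<le> 1/8 * s * (3/4 * cmod c)" using s by (simp add: r_def)
      also have "\<dots> \<le> (3 - 2 * sqrt 2) * s * cmod (deriv (\<psi> t) z0)"
      proof (intro mult_mono dz0)
        have "sqrt 2 \<le> 23/16" by (rule real_le_lsqrt) (auto simp: power2_eq_square)
        then show "1/8 \<le> 3 - 2 * sqrt 2" "0 \<le> 3 - 2 * sqrt 2" "0 \<le> (3 - 2 * sqrt 2) * s" using s by auto
      qed (use s in auto)
      finally show "x \<in> ball (\<psi> t z0) ((3 - 2 * sqrt 2) * s * cmod (deriv (\<psi> t) z0))" by simp
    qed
    ultimately show ?thesis by blast
  qed
  have inj: "inj_on (\<psi> t) (ball z0 s)" if t: "t \<in> T \<inter> ball t0 d" for t
  proof (rule inj_onI)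
    fix z w assume "z \<in> ball z0 s" "w \<in> ball z0 s" "\<psi> t z = \<psi> t w"
    then have "3/4 * cmod c * cmod (z - w) \<le> 0" using expand[OF t, of z w] sub1(2) by (simp add: subset_iff)
    then show "z = w" using c by (simp add: mult_le_0_iff)
  qed
  define G where "G = (\<lambda>t. inv_into (ball z0 s) (\<psi> t))"
  have G1: "G t x \<in> ball z0 s" "\<psi> t (G t x) = x" if "t \<in> T \<inter> ball t0 d" "x \<in> ball (fst p) r" for t x
  proof -
    have "x \<in> \<psi> t ` ball z0 s" using cover[OF that(1)] that(2) by blast
    then show "G t x \<in> ball z0 s" "\<psi> t (G t x) = x" unfolding G_def by (rule inv_into_into, rule f_inv_into_f)
  qed
  have G2: "G t (\<psi> t z) = z" if "t \<in> T \<inter> ball t0 d" "z \<in> ball z0 s" for t z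
    unfolding G_def using inj[OF that(1)] that(2) by simp
  have holG: "G t holomorphic_on ball (fst p) r" if t: "t \<in> T \<inter> ball t0 d" for t
  proof -
    obtain g where g: "g holomorphic_on \<psi> t ` ball z0 s" "\<And>z. z \<in> ball z0 s \<Longrightarrow> g (\<psi> t z) = z"
      using holomorphic_has_inverse[OF holomorphic_on_subset[OF hol sub1(1)] _ inj[OF t]] t by (metis IntD1 open_ball)
    have "g holomorphic_on ball (fst p) r" using g(1) cover[OF t] holomorphic_on_subset by blast
    moreover have "g x = G t x" if "x \<in> ball (fst p) r" for x
      using g(2)[OF G1(1)[OF t that]] G1(2)[OF t that] by simp
    ultimately show ?thesis by (rule holomorphic_transform)
  qed
  \<comment> \<open>The expansion estimate bounds |G t x - z'| by a multiple of |x - \<psi> t z'|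
    with \<open>z'\<close> fixed, and this tends to 0 by the continuity of
    \<open>\<phi>\<close>.\<close>
  have contG: "continuous_on ((T \<inter> ball t0 d) \<times> ball (fst p) r) (\<lambda>(t, x). G t x)"
    unfolding continuous_on_def
  proof
    fix q assume q: "q \<in> (T \<inter> ball t0 d) \<times> ball (fst p) r"
    obtain t' x' where tx: "q = (t', x')" "t' \<in> T \<inter> ball t0 d" "x' \<in> ball (fst p) r" using q by auto
    define S where "S = (T \<inter> ball t0 d) \<times> ball (fst p) r"
    define z' where "z' = G t' x'"
    have z': "z' \<in> ball z0 s" "\<psi> t' z' = x'" using G1[OF tx(2,3)] by (auto simp: z'_def)
    have "continuous_on S (\<lambda>q. \<psi> (fst q) z')"
      unfolding \<psi>_def S_def
      by (intro continuous_on_fst continuous_on_compose2[OF cont]) (use z' sub1 in \<open>auto intro!: continuous_intros\<close>)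
    then have "continuous_on S (\<lambda>q. 4 / (3 * cmod c) * cmod (snd q - \<psi> (fst q) z'))"
      by (intro continuous_intros)
    then have "((\<lambda>q. 4 / (3 * cmod c) * cmod (snd q - \<psi> (fst q) z')) \<longlongrightarrow> 4 / (3 * cmod c) * cmod (snd q - \<psi> (fst q) z')) (at q within S)"
      using q unfolding continuous_on_def S_def by blast
    then have lim: "((\<lambda>q. 4 / (3 * cmod c) * cmod (snd q - \<psi> (fst q) z')) \<longlongrightarrow> 0) (at q within S)"
      using tx z' by simp
    have "((\<lambda>(t, x). G t x - z') \<longlongrightarrow> 0) (at q within S)"
    proof (rule Lim_null_comparison[OF _ lim])
      have "norm (case y of (t, x) \<Rightarrow> G t x - z') \<le> 4 / (3 * cmod c) * cmod (snd y - \<psi> (fst y) z')" if "y \<in> S" for y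
      proof -
        obtain t x where y: "y = (t, x)" "t \<in> T \<inter> ball t0 d" "x \<in> ball (fst p) r" using \<open>y \<in> S\<close> by (auto simp: S_def)
        have "3/4 * cmod c * cmod (G t x - z') \<le> cmod (\<psi> t (G t x) - \<psi> t z')"
          by (rule expand[OF y(2)]) (use G1[OF y(2,3)] z' sub1(2) in blast)+
        then show ?thesis using c G1[OF y(2,3)] y(1) by (simp add: field_simps)
      qed
      then show "\<forall>\<^sub>F y in at q within S. norm (case y of (t, x) \<Rightarrow> G t x - z') \<le> 4 / (3 * cmod c) * cmod (snd y - \<psi> (fst y) z')"
        by (auto simp: eventually_at_filter)
    qed
    then have "((\<lambda>y. (case y of (t, x) \<Rightarrow> G t x) - z') \<longlongrightarrow> 0) (at q within S)"
      unfolding case_prod_beta .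
    then show "((\<lambda>(t, x). G t x) \<longlongrightarrow> (case q of (t, x) \<Rightarrow> G t x)) (at q within (T \<inter> ball t0 d) \<times> ball (fst p) r)"
      using tx(1) by (simp add: LIM_zero_iff z'_def S_def)
  qed
  have "dist (\<phi> (z, t)) p \<le> 1" if "t \<in> T \<inter> ball t0 d" "z \<in> ball z0 s" for t z
  proof -
    have zb: "z \<in> cball z0 (2 * s)" using that s by auto
    show ?thesis using close[OF that(1) zb] e(2)[OF in_e[OF zb]] \<eta>(2) dist_triangle[of "\<phi> (z, t)" p "\<phi> (z, t0)"] by simp
  qed
  note close' = this
  have G1': "\<And>t x. t \<in> T \<inter> ball t0 d \<Longrightarrow> x \<in> ball (fst (\<phi> (z0, t0))) r \<Longrightarrow> G t x \<in> ball z0 s \<and> fst (\<phi> (G t x, t)) = x"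
    using G1 unfolding p_def \<psi>_def by blast
  have G2': "\<And>t z. t \<in> T \<inter> ball t0 d \<Longrightarrow> z \<in> ball z0 s \<Longrightarrow> fst (\<phi> (z, t)) \<in> ball (fst (\<phi> (z0, t0))) r \<Longrightarrow>
      G t (fst (\<phi> (z, t))) = z"
    using G2 unfolding \<psi>_def by blast
  show thesis
    by (rule that[OF r s d(1) sub1(1) holG[unfolded p_def] G1' G2' contG[unfolded p_def] close'[unfolded p_def]])
qed

section \<open>Holomorphic graphs contained in the lamination\<close>

text \<open>The graph is only required to lie in the set \<open>X\<close>, without reference to flow
  boxes; that it follows a single leaf is a consequence of the absence of lines. Applied to the
  image of \<open>X\<close> under \<open>prod.swap\<close>, the notion describes graphs over the
  second coordinate.\<close>

definition vgraph :: "c2 set \<Rightarrow> (complex \<Rightarrow> complex) \<Rightarrow> complex \<Rightarrow> real \<Rightarrow> bool" where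
  "vgraph X f a r \<longleftrightarrow> f holomorphic_on ball a r \<and> (\<forall>x\<in>ball a r. (x, f x) \<in> X)"

lemma vgraph_subset: "vgraph X f a r \<Longrightarrow> ball b s \<subseteq> ball a r \<Longrightarrow> vgraph X f b s"
  by (auto simp: vgraph_def intro: holomorphic_on_subset)

section \<open>Exchanging the two coordinates\<close>

lemma open_swap_image:
  fixes U :: "('a::topological_space \<times> 'b::topological_space) set"
  assumes "open U" shows "open (prod.swap ` U)"
proof -
  have "prod.swap ` U = prod.swap -` U" by (force simp: image_iff)
  moreover have "continuous_on UNIV (prod.swap :: 'b \<times> 'a \<Rightarrow> _)"
    unfolding prod.swap_def by (intro continuous_intros)
  ultimately show ?thesis using assms open_vimage by metis
qed

lemma homeomorphism_swap:
  fixes S :: "('a::topological_space \<times> 'b::topological_space) set"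
  shows "homeomorphism S (prod.swap ` S) prod.swap prod.swap"
  unfolding homeomorphism_def prod.swap_def by (auto intro!: continuous_intros simp: image_image)

lemma flow_box_swap:
  assumes "flow_box \<Lambda> X U T \<phi>"
  shows "flow_box (prod.swap ` \<Lambda>) (prod.swap ` X) (prod.swap ` U) T (prod.swap \<circ> \<phi>)"
proof -
  obtain \<psi> where \<psi>: "homeomorphism (ball 0 1 \<times> T) (X \<inter> U) \<phi> \<psi>"
    using assms by (auto simp: flow_box_def)
  have "homeomorphism (ball 0 1 \<times> T) (prod.swap ` (X \<inter> U)) (prod.swap \<circ> \<phi>) (\<psi> \<circ> prod.swap)"
    by (rule homeomorphism_compose[OF \<psi> homeomorphism_swap])
  also have "prod.swap ` (X \<inter> U) = prod.swap ` X \<inter> prod.swap ` U" by (simp add: image_Int)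
  finally have "\<exists>\<psi>. homeomorphism (ball 0 1 \<times> T) (prod.swap ` X \<inter> prod.swap ` U) (prod.swap \<circ> \<phi>) \<psi>" by blast
  moreover have "\<forall>x\<in>prod.swap ` U. \<forall>y\<in>prod.swap ` U. x - y \<in> prod.swap ` \<Lambda> \<longrightarrow> x = y"
  proof (intro ballI impI)
    fix x y assume xy: "x \<in> prod.swap ` U" "y \<in> prod.swap ` U" "x - y \<in> prod.swap ` \<Lambda>"
    then have "prod.swap x \<in> U" "prod.swap y \<in> U" "prod.swap x - prod.swap y \<in> \<Lambda>"
      by (auto simp: prod.swap_def)
    then have "prod.swap x = prod.swap y" using assms unfolding flow_box_def by blast
    then show "x = y" by (simp add: prod_eq_iff)
  qed
  moreover have "open (prod.swap ` U)" using assms by (auto simp: flow_box_def intro: open_swap_image)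
  ultimately show ?thesis using assms unfolding flow_box_def by auto
qed

lemma lamination_swap:
  assumes "lamination \<Lambda> X" shows "lamination (prod.swap ` \<Lambda>) (prod.swap ` X)"
  unfolding lamination_def
proof (intro conjI ballI)
  have "closed X" using assms by (simp add: lamination_def)
  then have "open (- X)" by (rule open_Compl)
  then have "open (prod.swap ` (- X))" by (rule open_swap_image)
  moreover have "prod.swap ` (- X) = - (prod.swap ` X)" by (auto simp: set_eq_iff)
  ultimately show "closed (prod.swap ` X)" by (simp add: closed_def)
next
  fix l assume "l \<in> prod.swap ` \<Lambda>"
  then obtain l' where l': "l' \<in> \<Lambda>" "l = prod.swap l'" by auto
  have "(\<lambda>x. x + l) ` prod.swap ` X = prod.swap ` ((\<lambda>x. x + l') ` X)"
    unfolding image_image l'(2) by (simp add: prod.swap_def)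
  also have "(\<lambda>x. x + l') ` X = X" using assms l' by (auto simp: lamination_def)
  finally show "(\<lambda>x. x + l) ` prod.swap ` X = prod.swap ` X" .
next
  fix x assume "x \<in> prod.swap ` X"
  then obtain y where y: "y \<in> X" "x = prod.swap y" by auto
  then obtain U T \<phi> where "flow_box \<Lambda> X U T \<phi>" "y \<in> U" using assms unfolding lamination_def by blast
  then show "\<exists>U T \<phi>. flow_box (prod.swap ` \<Lambda>) (prod.swap ` X) U T \<phi> \<and> x \<in> U"
    using flow_box_swap y by blast
qed

lemma swap_swap_image [simp]: "prod.swap ` prod.swap ` X = X"
  by (force simp: image_iff)

lemma no_line_swap:
  assumes "\<not> has_invariant_line_segment X" shows "\<not> has_invariant_line_segment (prod.swap ` X)"
proof
  assume "has_invariant_line_segment (prod.swap ` X)"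
  then obtain p v U where 1: "v \<noteq> 0" "open U" "cline p v \<inter> U \<noteq> {}" "cline p v \<inter> U \<subseteq> prod.swap ` X \<inter> U"
    unfolding has_invariant_line_segment_def by blast
  have c: "cline (prod.swap p) (prod.swap v) = prod.swap ` cline p v" by (force simp: cline_def image_iff)
  have "prod.swap ` (cline p v \<inter> U) \<subseteq> prod.swap ` (prod.swap ` X \<inter> U)" using 1(4) by blast
  then have "cline (prod.swap p) (prod.swap v) \<inter> prod.swap ` U \<subseteq> X \<inter> prod.swap ` U"
    by (simp add: c image_Int)
  moreover have "cline (prod.swap p) (prod.swap v) \<inter> prod.swap ` U \<noteq> {}"
    using 1(3) unfolding c by auto
  moreover have "prod.swap v \<noteq> 0" using 1(1) by (auto simp: prod_eq_iff)
  ultimately show False using assms open_swap_image[OF 1(2)] unfolding has_invariant_line_segment_def by blast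
qed

section \<open>Recognising line segments in the lamination\<close>

lemma vertical_disc_imp_line:
  assumes "0 < m" "\<And>y. cmod (y - b) < m \<Longrightarrow> (a, y) \<in> X"
  shows "has_invariant_line_segment X"
  unfolding has_invariant_line_segment_def
proof (intro exI conjI)
  show "(0, 1) \<noteq> (0 :: c2)" by (simp add: zero_prod_def)
  show "open (UNIV \<times> ball b m :: c2 set)" by (intro open_Times) auto
  have "(a, b) \<in> cline (a, b) (0, 1)" unfolding cline_def by (auto intro!: exI[of _ 0])
  then show "cline (a, b) (0, 1) \<inter> UNIV \<times> ball b m \<noteq> {}" using assms(1) by auto
  show "cline (a, b) (0, 1) \<inter> UNIV \<times> ball b m \<subseteq> X \<inter> UNIV \<times> ball b m"
    using assms(2) by (auto simp: cline_def dist_norm norm_minus_commute)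
qed

text \<open>Its contrapositive makes the derivative of every graph in \<open>X\<close> nonconstant,
  as Hurwitz's theorem requires. It also gives the final contradiction in
  \<open>not_osculating\<close>.\<close>

lemma affine_vgraph_imp_line:
  assumes "vgraph X f a r" "0 < r" "deriv f constant_on ball a r"
  shows "has_invariant_line_segment X"
proof -
  obtain k where k: "\<And>x. x \<in> ball a r \<Longrightarrow> deriv f x = k" using assms(3) by (auto simp: constant_on_def)
  have f: "f holomorphic_on ball a r" "\<And>x. x \<in> ball a r \<Longrightarrow> (x, f x) \<in> X"
    using assms(1) by (auto simp: vgraph_def)
  have lin: "f x = f a + k * (x - a)" if "x \<in> ball a r" for x
  proof -
    have "(\<lambda>x. f x - k * (x - a)) constant_on ball a r"
    proof (rule has_field_derivative_0_imp_constant_on)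
      fix z assume z: "z \<in> ball a r"
      have "(f has_field_derivative k) (at z)" using holomorphic_derivI[OF f(1) _ z] k[OF z] by simp
      then show "((\<lambda>x. f x - k * (x - a)) has_field_derivative 0) (at z)"
        by (auto intro!: derivative_eq_intros)
    qed auto
    then obtain C where C: "\<And>x. x \<in> ball a r \<Longrightarrow> f x - k * (x - a) = C" by (auto simp: constant_on_def)
    have "f x - k * (x - a) = f a - k * (a - a)" using C[OF that] C[of a] assms(2) by simp
    then show ?thesis by (simp add: algebra_simps)
  qed
  show ?thesis unfolding has_invariant_line_segment_def
  proof (intro exI conjI)
    show "(1, k) \<noteq> (0 :: c2)" by (simp add: zero_prod_def)
    show "open (ball a r \<times> UNIV :: c2 set)" by (intro open_Times) auto
    have "(a, f a) \<in> cline (a, f a) (1, k)" unfolding cline_def by (auto intro!: exI[of _ 0])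
    then show "cline (a, f a) (1, k) \<inter> ball a r \<times> UNIV \<noteq> {}" using assms(2) by auto
    show "cline (a, f a) (1, k) \<inter> ball a r \<times> UNIV \<subseteq> X \<inter> ball a r \<times> UNIV"
    proof
      fix q assume "q \<in> cline (a, f a) (1, k) \<inter> ball a r \<times> UNIV"
      then obtain c where c: "q = (a + c, f a + c * k)" "a + c \<in> ball a r" by (auto simp: cline_def)
      then have "q = (a + c, f (a + c))" using lin[of "a + c"] by (simp add: mult.commute)
      then show "q \<in> X \<inter> ball a r \<times> UNIV" using f(2)[OF c(2)] c by auto
    qed
  qed
qed

section \<open>Local graphs obtained from a flow box\<close>

lemma flow_box_in_X: "flow_box \<Lambda> X U T \<phi> \<Longrightarrow> z \<in> ball 0 1 \<Longrightarrow> t \<in> T \<Longrightarrow> \<phi> (z, t) \<in> X \<inter> U"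
  unfolding flow_box_def homeomorphism_def by blast

lemma flow_box_near:
  assumes fb: "flow_box \<Lambda> X U T \<phi>" and "z0 \<in> ball 0 1" "t0 \<in> T" "0 < d"
  obtains \<rho> where "0 < \<rho>"
    "\<And>q. q \<in> X \<inter> ball (\<phi> (z0, t0)) \<rho> \<Longrightarrow> \<exists>z t. z \<in> ball 0 1 \<inter> ball z0 d \<and> t \<in> T \<inter> ball t0 d \<and> q = \<phi> (z, t)"
proof -
  obtain \<psi> where \<psi>: "homeomorphism (ball 0 1 \<times> T) (X \<inter> U) \<phi> \<psi>" and U: "open U"
    using fb by (auto simp: flow_box_def)
  have p: "\<phi> (z0, t0) \<in> X \<inter> U" using flow_box_in_X[OF fb assms(2,3)] .
  have "continuous_on (X \<inter> U) \<psi>" using \<psi> by (simp add: homeomorphism_def)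
  then obtain e where e: "e > 0" "\<And>q. q \<in> X \<inter> U \<Longrightarrow> dist q (\<phi> (z0, t0)) < e \<Longrightarrow> dist (\<psi> q) (\<psi> (\<phi> (z0, t0))) < d"
    using p assms(4) unfolding continuous_on_iff by metis
  obtain e' where e': "e' > 0" "ball (\<phi> (z0, t0)) e' \<subseteq> U" using U p by (meson IntD2 openE)
  have \<psi>p: "\<psi> (\<phi> (z0, t0)) = (z0, t0)" using \<psi> assms by (auto simp: homeomorphism_def)
  show thesis
  proof (rule that[of "min e e'"])
    fix q assume q: "q \<in> X \<inter> ball (\<phi> (z0, t0)) (min e e')"
    then have q': "q \<in> X \<inter> U" "dist (\<psi> q) (z0, t0) < d"
      using e'(2) e(2)[of q] \<psi>p by (auto simp: dist_commute)
    have "\<psi> q \<in> ball 0 1 \<times> T" "\<phi> (\<psi> q) = q" using \<psi> q'(1) unfolding homeomorphism_def by blast+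
    moreover have "dist (fst (\<psi> q)) z0 < d" "dist (snd (\<psi> q)) t0 < d"
      using q'(2) dist_fst_le[of "\<psi> q" "(z0, t0)"] dist_snd_le[of "\<psi> q" "(z0, t0)"] by simp_all
    ultimately show "\<exists>z t. z \<in> ball 0 1 \<inter> ball z0 d \<and> t \<in> T \<inter> ball t0 d \<and> q = \<phi> (z, t)"
      by (intro exI[of _ "fst (\<psi> q)"] exI[of _ "snd (\<psi> q)"]) (auto simp: dist_commute mem_Times_iff)
  qed (use e e' in auto)
qed

text \<open>Each \<open>f\<close> is the second coordinate composed with the local inverse of the
  first. A common radius \<open>r\<close> for all plaques near \<open>t0\<close> allows their
  differences to be formed. The base points are confined to \<open>r/16\<close> so that
  intersections fall into the inner disc \<open>R/8\<close> of the zero count even for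
  \<open>R = 3*r/4\<close>, the radius that leaves room for a shifted argument.\<close>

lemma flow_box_chart:
  assumes fb: "flow_box \<Lambda> X U T \<phi>" and z0: "z0 \<in> ball 0 1" and t0: "t0 \<in> T"
    and nz: "deriv (\<lambda>w. fst (\<phi> (w, t0))) z0 \<noteq> 0"
  obtains r d where "0 < r" "0 < d" "ball z0 d \<subseteq> ball 0 1"
    "\<And>t. t \<in> T \<inter> ball t0 d \<Longrightarrow> \<exists>f. vgraph X f (fst (\<phi> (z0, t0))) r \<and>
        (\<forall>x\<in>ball (fst (\<phi> (z0, t0))) r. cmod (f x - snd (\<phi> (z0, t0))) \<le> 1) \<and>
        (\<forall>z\<in>ball z0 d. fst (\<phi> (z, t)) \<in> ball (fst (\<phi> (z0, t0))) (r/16) \<and> f (fst (\<phi> (z, t))) = snd (\<phi> (z, t)))"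
proof -
  define p where "p = \<phi> (z0, t0)"
  obtain r s d G where G: "0 < r" "0 < s" "0 < d" "ball z0 s \<subseteq> ball 0 1"
    and G1: "\<And>t. t \<in> T \<inter> ball t0 d \<Longrightarrow> G t holomorphic_on ball (fst p) r"
    and G2: "\<And>t x. t \<in> T \<inter> ball t0 d \<Longrightarrow> x \<in> ball (fst p) r \<Longrightarrow> G t x \<in> ball z0 s \<and> fst (\<phi> (G t x, t)) = x"
    and G3: "\<And>t z. t \<in> T \<inter> ball t0 d \<Longrightarrow> z \<in> ball z0 s \<Longrightarrow> fst (\<phi> (z, t)) \<in> ball (fst p) r \<Longrightarrow> G t (fst (\<phi> (z, t))) = z"
    and G4: "\<And>t z. t \<in> T \<inter> ball t0 d \<Longrightarrow> z \<in> ball z0 s \<Longrightarrow> dist (\<phi> (z, t)) p \<le> 1"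
    by (rule flow_box_inverse[OF assms, folded p_def]) (rule that, assumption+)
  have cont: "continuous_on (ball 0 1 \<times> T) \<phi>"
    using fb unfolding flow_box_def homeomorphism_def by blast
  have "(z0, t0) \<in> ball 0 1 \<times> T" using z0 t0 by auto
  then obtain e where e: "e > 0" "\<And>q. q \<in> ball 0 1 \<times> T \<Longrightarrow> dist q (z0, t0) < e \<Longrightarrow> dist (\<phi> q) p < r/16"
    using cont G(1) unfolding continuous_on_iff p_def by (metis divide_pos_pos zero_less_numeral)
  define d' where "d' = min (e/2) (min s d)"
  have d': "0 < d'" "d' \<le> s" "d' \<le> d" "d' \<le> e/2" using G e by (auto simp: d'_def)
  show thesis
  proof (rule that[of r d'])
    show sub: "ball z0 d' \<subseteq> ball 0 1" using d' G(4) by (auto simp: subset_iff)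
    fix t assume "t \<in> T \<inter> ball t0 d'"
    then have t: "t \<in> T \<inter> ball t0 d" "t \<in> T" "dist t t0 < e/2" using d' by (auto simp: dist_commute)
    define f where "f = (\<lambda>x. snd (\<phi> (G t x, t)))"
    have "((\<lambda>z. snd (\<phi> (z, t))) \<circ> G t) holomorphic_on ball (fst p) r"
      by (rule holomorphic_on_compose_gen[OF G1[OF t(1)]])
        (use fb t(2) G2[OF t(1)] G(4) in \<open>auto simp: flow_box_def\<close>)
    moreover have "(x, f x) \<in> X" if "x \<in> ball (fst p) r" for x
    proof -
      have "\<phi> (G t x, t) \<in> X" using flow_box_in_X[OF fb _ t(2)] G2[OF t(1) that] G(4) by blast
      moreover have "\<phi> (G t x, t) = (x, f x)" using G2[OF t(1) that] by (simp add: f_def prod_eq_iff)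
      ultimately show ?thesis by simp
    qed
    ultimately have "vgraph X f (fst p) r" by (auto simp: vgraph_def f_def o_def)
    moreover have "cmod (f x - snd p) \<le> 1" if "x \<in> ball (fst p) r" for x
      using G4[OF t(1), of "G t x"] G2[OF t(1) that] dist_snd_le[of "\<phi> (G t x, t)" p] by (simp add: f_def dist_norm)
    moreover have "fst (\<phi> (z, t)) \<in> ball (fst p) (r/16) \<and> f (fst (\<phi> (z, t))) = snd (\<phi> (z, t))" if z: "z \<in> ball z0 d'" for z
    proof -
      have "dist z z0 < e/2" "z \<in> ball 0 1" using z sub d' by (auto simp: dist_commute)
      then have "dist (z, t) (z0, t0) < e"
        using t(3) dist_Pair_Pair[of z t z0 t0] sqrt_sum_squares_le_sum[of "dist z z0" "dist t t0"] by simp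
      then have "dist (\<phi> (z, t)) p < r/16" using e(2)[of "(z, t)"] \<open>z \<in> ball 0 1\<close> t(2) by auto
      then have 1: "fst (\<phi> (z, t)) \<in> ball (fst p) (r/16)"
        using dist_fst_le[of "\<phi> (z, t)" p] by (simp add: dist_commute)
      moreover have "G t (fst (\<phi> (z, t))) = z" by (rule G3[OF t(1)]) (use z d' 1 G(1) in auto)
      ultimately show ?thesis by (simp add: f_def)
    qed
    ultimately show "\<exists>f. vgraph X f (fst (\<phi> (z0, t0))) r \<and>
        (\<forall>x\<in>ball (fst (\<phi> (z0, t0))) r. cmod (f x - snd (\<phi> (z0, t0))) \<le> 1) \<and>
        (\<forall>z\<in>ball z0 d'. fst (\<phi> (z, t)) \<in> ball (fst (\<phi> (z0, t0))) (r/16) \<and> f (fst (\<phi> (z, t))) = snd (\<phi> (z, t)))"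
      unfolding p_def by blast
  qed (use G d' in auto)
qed

text \<open>Local uniqueness of the leaf through \<open>p\<close>, tested on parametrised
  holomorphic discs. Since \<open>\<alpha>1\<close> may have a critical point, graphs over either
  coordinate are covered by the same notion.\<close>

definition absorbing :: "c2 set \<Rightarrow> (complex \<Rightarrow> complex) \<Rightarrow> c2 \<Rightarrow> bool" where
  "absorbing X f p \<longleftrightarrow> (\<forall>\<alpha>1 \<alpha>2 w0 \<delta>. 0 < \<delta> \<longrightarrow> \<alpha>1 holomorphic_on ball w0 \<delta> \<longrightarrow> \<alpha>2 holomorphic_on ball w0 \<delta> \<longrightarrow>
     (\<forall>w\<in>ball w0 \<delta>. (\<alpha>1 w, \<alpha>2 w) \<in> X) \<longrightarrow> (\<alpha>1 w0, \<alpha>2 w0) = p \<longrightarrow>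
     (\<exists>d>0. d \<le> \<delta> \<and> (\<forall>w\<in>ball w0 d. \<alpha>2 w = f (\<alpha>1 w))))"

text \<open>A holomorphic disc in \<open>X\<close> through a point of a plaque cannot leave it: otherwise, by a
  winding number argument, the plaques met by the disc would fill a disc on the vertical line
  through that point.\<close>

lemma flow_box_absorbing:
  assumes fb: "flow_box \<Lambda> X U T \<phi>" and z0: "z0 \<in> ball 0 1" and t0: "t0 \<in> T"
    and nz: "deriv (\<lambda>w. fst (\<phi> (w, t0))) z0 \<noteq> 0" and nl: "\<not> has_invariant_line_segment X"
  obtains f r where "0 < r" "vgraph X f (fst (\<phi> (z0, t0))) r"
    "f (fst (\<phi> (z0, t0))) = snd (\<phi> (z0, t0))" "absorbing X f (\<phi> (z0, t0))"
proof -
  define p where "p = \<phi> (z0, t0)"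
  obtain r s d G where G: "0 < r" "0 < s" "0 < d" "ball z0 s \<subseteq> ball 0 1"
    and G1: "\<And>t. t \<in> T \<inter> ball t0 d \<Longrightarrow> G t holomorphic_on ball (fst p) r"
    and G2: "\<And>t x. t \<in> T \<inter> ball t0 d \<Longrightarrow> x \<in> ball (fst p) r \<Longrightarrow> G t x \<in> ball z0 s \<and> fst (\<phi> (G t x, t)) = x"
    and G3: "\<And>t z. t \<in> T \<inter> ball t0 d \<Longrightarrow> z \<in> ball z0 s \<Longrightarrow> fst (\<phi> (z, t)) \<in> ball (fst p) r \<Longrightarrow> G t (fst (\<phi> (z, t))) = z"
    and Gc: "continuous_on ((T \<inter> ball t0 d) \<times> ball (fst p) r) (\<lambda>(t, x). G t x)"
    by (rule flow_box_inverse[OF assms(1-4), folded p_def]) (rule that, assumption+)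
  obtain \<psi> where \<psi>: "homeomorphism (ball 0 1 \<times> T) (X \<inter> U) \<phi> \<psi>" and U: "open U"
    using fb by (auto simp: flow_box_def)
  have cont: "continuous_on (ball 0 1 \<times> T) \<phi>" and cont\<psi>: "continuous_on (X \<inter> U) \<psi>"
    using \<psi> by (auto simp: homeomorphism_def)
  have inj: "q = q'" if "\<phi> q = \<phi> q'" "q \<in> ball 0 1 \<times> T" "q' \<in> ball 0 1 \<times> T" for q q'
    using \<psi> that unfolding homeomorphism_def by metis
  have pX: "p \<in> X \<inter> U" unfolding p_def by (rule flow_box_in_X[OF fb z0 t0])
  have t0d: "t0 \<in> T \<inter> ball t0 d" using t0 G by auto
  define F where "F = (\<lambda>t x. snd (\<phi> (G t x, t)))"
  define f where "f = F t0"
  have Fpt: "\<phi> (G t x, t) = (x, F t x)" if "t \<in> T \<inter> ball t0 d" "x \<in> ball (fst p) r" for t x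
    using G2[OF that] by (simp add: F_def prod_eq_iff)
  have FX: "(x, F t x) \<in> X" if "t \<in> T \<inter> ball t0 d" "x \<in> ball (fst p) r" for t x
    using flow_box_in_X[OF fb, of "G t x" t] G2[OF that] G(4) that Fpt[OF that] by auto
  have Fz: "F t (fst (\<phi> (z, t))) = snd (\<phi> (z, t))"
    if "t \<in> T \<inter> ball t0 d" "z \<in> ball z0 s" "fst (\<phi> (z, t)) \<in> ball (fst p) r" for t z
    using G3[OF that] by (simp add: F_def)
  have Fcont: "continuous_on ((T \<inter> ball t0 d) \<times> ball (fst p) r) (\<lambda>q. F (fst q) (snd q))"
  proof -
    have "continuous_on ((T \<inter> ball t0 d) \<times> ball (fst p) r) (\<lambda>q. \<phi> (G (fst q) (snd q), fst q))"
    proof (rule continuous_on_compose2[OF cont])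
      show "continuous_on ((T \<inter> ball t0 d) \<times> ball (fst p) r) (\<lambda>q. (G (fst q) (snd q), fst q))"
        using Gc unfolding case_prod_beta by (intro continuous_intros)
      show "(\<lambda>q. (G (fst q) (snd q), fst q)) ` ((T \<inter> ball t0 d) \<times> ball (fst p) r) \<subseteq> ball 0 1 \<times> T"
        using G2 G(4) by (fastforce simp: subset_iff)
    qed
    then show ?thesis unfolding F_def by (intro continuous_intros)
  qed
  have Fne: "F t x \<noteq> f x" if "t \<in> T \<inter> ball t0 d" "x \<in> ball (fst p) r" "t \<noteq> t0" for t x
  proof
    assume "F t x = f x"
    then have "\<phi> (G t x, t) = \<phi> (G t0 x, t0)" using Fpt[OF that(1,2)] Fpt[OF t0d that(2)] by (simp add: f_def)
    then have "(G t x, t) = (G t0 x, t0)"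
      by (rule inj) (use G2[OF that(1,2)] G2[OF t0d that(2)] G(4) that(1) t0 in auto)
    then show False using that(3) by simp
  qed
  have holf: "f holomorphic_on ball (fst p) r"
  proof -
    have "((\<lambda>z. snd (\<phi> (z, t0))) \<circ> G t0) holomorphic_on ball (fst p) r"
      by (rule holomorphic_on_compose_gen[OF G1[OF t0d]])
        (use fb t0 G2[OF t0d] G(4) in \<open>auto simp: flow_box_def\<close>)
    then show ?thesis by (simp add: f_def F_def o_def)
  qed
  have vg: "vgraph X f (fst p) r" using holf FX[OF t0d] by (auto simp: vgraph_def f_def)
  have fp: "f (fst p) = snd p" using Fz[OF t0d, of z0] G by (simp add: f_def p_def)
  have "absorbing X f p"
    unfolding absorbing_def
  proof (intro allI impI)
    fix \<alpha>1 \<alpha>2 w0 and \<delta> :: real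
    assume \<delta>: "0 < \<delta>" and hol1: "\<alpha>1 holomorphic_on ball w0 \<delta>" and hol2: "\<alpha>2 holomorphic_on ball w0 \<delta>"
      and inX: "\<forall>w\<in>ball w0 \<delta>. (\<alpha>1 w, \<alpha>2 w) \<in> X" and \<alpha>p: "(\<alpha>1 w0, \<alpha>2 w0) = p"
    define \<alpha> where "\<alpha> = (\<lambda>w. (\<alpha>1 w, \<alpha>2 w))"
    have c\<alpha>: "continuous_on (ball w0 \<delta>) \<alpha>"
      unfolding \<alpha>_def using hol1 hol2 by (intro continuous_on_Pair holomorphic_on_imp_continuous_on)
    define W where "W = {w \<in> ball w0 \<delta>. \<alpha> w \<in> U}"
    have oW: "open W"
      using continuous_open_preimage[OF c\<alpha> open_ball U] by (simp add: W_def vimage_def Int_def)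
    have w0W: "w0 \<in> W" using \<delta> pX \<alpha>p by (auto simp: W_def \<alpha>_def)
    have cW: "continuous_on W (\<lambda>w. \<psi> (\<alpha> w))"
      by (rule continuous_on_compose2[OF cont\<psi> continuous_on_subset[OF c\<alpha>]])
        (use inX in \<open>auto simp: W_def \<alpha>_def\<close>)
    have c1: "continuous_on W \<alpha>1" using hol1 by (auto intro!: holomorphic_on_imp_continuous_on holomorphic_on_subset[OF hol1] simp: W_def)
    have \<psi>w0: "\<psi> (\<alpha> w0) = (z0, t0)" using \<psi> \<alpha>p z0 t0 by (auto simp: homeomorphism_def \<alpha>_def p_def)
    define m0 where "m0 = min s d"
    have m0: "m0 > 0" using G by (simp add: m0_def)
    obtain e1 where e1: "e1 > 0" "\<And>w. w \<in> W \<Longrightarrow> dist w w0 < e1 \<Longrightarrow> dist (\<psi> (\<alpha> w)) (z0, t0) < m0"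
      using cW w0W m0 \<psi>w0 unfolding continuous_on_iff by metis
    obtain e2 where e2: "e2 > 0" "\<And>w. w \<in> W \<Longrightarrow> dist w w0 < e2 \<Longrightarrow> dist (\<alpha>1 w) (\<alpha>1 w0) < r"
      using c1 w0W G(1) unfolding continuous_on_iff by metis
    obtain e3 where e3: "e3 > 0" "ball w0 e3 \<subseteq> W" using oW w0W by (meson openE)
    define \<delta>2 where "\<delta>2 = min e1 (min e2 e3)"
    have \<delta>2: "\<delta>2 > 0" using e1 e2 e3 by (simp add: \<delta>2_def)
    have inW: "w \<in> W" if "w \<in> ball w0 \<delta>2" for w using that e3 by (auto simp: \<delta>2_def)
    have sub\<delta>: "ball w0 \<delta>2 \<subseteq> ball w0 \<delta>" using inW by (auto simp: W_def)
    have \<delta>2\<delta>: "\<delta>2 \<le> \<delta>" using sub\<delta> \<delta>2 by (simp add: ball_subset_ball_iff)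
    define tt where "tt = (\<lambda>w. snd (\<psi> (\<alpha> w)))"
    define zz where "zz = (\<lambda>w. fst (\<psi> (\<alpha> w)))"
    have tz: "tt w \<in> T \<inter> ball t0 d" "zz w \<in> ball z0 s" "\<phi> (zz w, tt w) = \<alpha> w" "\<alpha>1 w \<in> ball (fst p) r"
      if w: "w \<in> ball w0 \<delta>2" for w
    proof -
      have wW: "w \<in> W" "dist w w0 < e1" "dist w w0 < e2" using inW[OF w] w by (auto simp: \<delta>2_def dist_commute)
      then have "\<alpha> w \<in> X \<inter> U" using inX by (auto simp: W_def \<alpha>_def)
      then have 1: "\<psi> (\<alpha> w) \<in> ball 0 1 \<times> T" "\<phi> (\<psi> (\<alpha> w)) = \<alpha> w" using \<psi> unfolding homeomorphism_def by blast+
      have "dist (\<psi> (\<alpha> w)) (z0, t0) < m0" using e1(2) wW by blast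
      then have "dist (zz w) z0 < m0" "dist (tt w) t0 < m0"
        using dist_fst_le[of "\<psi> (\<alpha> w)" "(z0, t0)"] dist_snd_le[of "\<psi> (\<alpha> w)" "(z0, t0)"] by (simp_all add: zz_def tt_def)
      with 1 show "tt w \<in> T \<inter> ball t0 d" "zz w \<in> ball z0 s" "\<phi> (zz w, tt w) = \<alpha> w"
        by (auto simp: m0_def dist_commute tt_def zz_def mem_Times_iff)
      have "dist (\<alpha>1 w) (\<alpha>1 w0) < r" using e2(2) wW by blast
      then show "\<alpha>1 w \<in> ball (fst p) r" using \<alpha>p by (auto simp: dist_commute)
    qed
    have F\<alpha>: "F (tt w) (\<alpha>1 w) = \<alpha>2 w" if "w \<in> ball w0 \<delta>2" for w
      using Fz[of "tt w" "zz w"] tz[OF that] by (simp add: \<alpha>_def)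
    \<comment> \<open>\<open>u\<close> measures the departure of the disc from the plaque of
      \<open>t0\<close>. Where it is nonzero, the disc lies on a plaque with parameter
      \<open>tt w\<close> different from \<open>t0\<close>. As \<open>tt\<close> is merely
      continuous, isolation of zeros is obtained from the holomorphic \<open>u\<close>.\<close>
    define u where "u = (\<lambda>w. \<alpha>2 w - f (\<alpha>1 w))"
    have "(f \<circ> \<alpha>1) holomorphic_on ball w0 \<delta>2"
      by (rule holomorphic_on_compose_gen[OF holomorphic_on_subset[OF hol1 sub\<delta>] holf]) (use tz(4) in auto)
    then have holu: "u holomorphic_on ball w0 \<delta>2"
      unfolding u_def o_def by (intro holomorphic_intros holomorphic_on_subset[OF hol2 sub\<delta>])
    have u0: "u w0 = 0" using \<alpha>p fp by (auto simp: u_def)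
    have tt_u: "u w = 0" if "w \<in> ball w0 \<delta>2" "tt w = t0" for w
      using F\<alpha>[OF that(1)] that(2) by (simp add: u_def f_def)
    show "\<exists>d>0. d \<le> \<delta> \<and> (\<forall>w\<in>ball w0 d. \<alpha>2 w = f (\<alpha>1 w))"
    proof (cases "\<forall>w\<in>ball w0 \<delta>2. u w = 0")
      case True
      then show ?thesis using \<delta>2 \<delta>2\<delta> by (auto simp: u_def)
    next
      case False
      then obtain w1 where w1: "w1 \<in> ball w0 \<delta>2" "u w1 \<noteq> 0" by blast
      obtain \<rho> where \<rho>: "0 < \<rho>" "ball w0 \<rho> \<subseteq> ball w0 \<delta>2" "\<And>w. w \<in> ball w0 \<rho> - {w0} \<Longrightarrow> u w \<noteq> 0"
        using isolated_zeros[OF holu open_ball connected_ball _ u0 w1] \<delta>2 by auto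
      have sub: "cball w0 (\<rho>/2) \<subseteq> ball w0 \<delta>2" using \<rho> by (auto simp: subset_iff)
      have ctt: "continuous_on (cball w0 (\<rho>/2)) tt"
        unfolding tt_def by (intro continuous_on_snd continuous_on_subset[OF cW]) (use sub inW in auto)
      \<comment> \<open>The homotopy slides the base point from \<open>\<alpha>1 w\<close> to
        \<open>fst p\<close>. The height difference between the plaques of \<open>tt w\<close> and
        \<open>t0\<close> is \<open>u w\<close> at time 0, and at time 1 it is taken on the vertical
        line through \<open>p\<close>. Plaques with distinct parameters are disjoint, so it does not
        vanish on the circle.\<close>
      define x where "x = (\<lambda>q :: real \<times> complex. (1 - of_real (fst q)) * \<alpha>1 (snd q) + of_real (fst q) * fst p)"
      have xin: "x q \<in> ball (fst p) r" if "q \<in> {0..1} \<times> sphere w0 (\<rho>/2)" for q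
      proof -
        have "snd q \<in> ball w0 \<delta>2" using that sub by (auto simp: mem_Times_iff)
        then have a: "\<alpha>1 (snd q) \<in> ball (fst p) r" by (rule tz(4))
        have "x q = (1 - fst q) *\<^sub>R \<alpha>1 (snd q) + fst q *\<^sub>R fst p" by (simp add: x_def scaleR_conv_of_real)
        then show ?thesis using convexD_alt[OF convex_ball a, of "fst p" "fst q"] that G(1) by (auto simp: mem_Times_iff)
      qed
      have cx: "continuous_on ({0..1} \<times> sphere w0 (\<rho>/2)) x"
        unfolding x_def
        by (intro continuous_intros continuous_on_compose2[OF c1 continuous_on_snd]) (use sub inW in auto)
      obtain m where m: "0 < m" "ball 0 m \<subseteq> (\<lambda>w. F (tt w) (fst p) - snd p) ` cball w0 (\<rho>/2)"
      proof (rule covers_ball_of_homotopic_to_holomorphic[of u w0 \<rho> "\<rho>/2" "\<lambda>w. F (tt w) (fst p) - snd p"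
            "\<lambda>q. F (tt (snd q)) (x q) - f (x q)"])
        show "u holomorphic_on ball w0 \<rho>" using holu \<rho>(2) by (rule holomorphic_on_subset)
        show "u w \<noteq> 0" if "w \<in> ball w0 \<rho>" "w \<noteq> w0" for w using \<rho>(3) that by auto
        show "continuous_on (cball w0 (\<rho>/2)) (\<lambda>w. F (tt w) (fst p) - snd p)"
        proof -
          have "continuous_on (cball w0 (\<rho>/2)) (\<lambda>w. F (fst (tt w, fst p)) (snd (tt w, fst p)))"
            by (rule continuous_on_compose2[OF Fcont]) (use ctt tz(1) sub G(1) in \<open>auto intro!: continuous_intros\<close>)
          then show ?thesis by (auto intro!: continuous_intros)
        qed
        show "continuous_on ({0..1} \<times> sphere w0 (\<rho>/2)) (\<lambda>q. F (tt (snd q)) (x q) - f (x q))"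
        proof -
          have ct: "continuous_on ({0..1::real} \<times> sphere w0 (\<rho>/2)) (\<lambda>q. tt (snd q))"
            by (rule continuous_on_compose2[OF ctt]) (auto intro!: continuous_intros)
          have "continuous_on ({0..1} \<times> sphere w0 (\<rho>/2)) (\<lambda>q. F (fst (tt (snd q), x q)) (snd (tt (snd q), x q)))"
          proof (rule continuous_on_compose2[OF Fcont])
            show "continuous_on ({0..1} \<times> sphere w0 (\<rho>/2)) (\<lambda>q. (tt (snd q), x q))" by (intro continuous_on_Pair ct cx)
            show "(\<lambda>q. (tt (snd q), x q)) ` ({0..1} \<times> sphere w0 (\<rho>/2)) \<subseteq> (T \<inter> ball t0 d) \<times> ball (fst p) r"
            proof (intro image_subsetI SigmaI)
              fix q assume q: "q \<in> {0..1::real} \<times> sphere w0 (\<rho>/2)"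
              then have "snd q \<in> ball w0 \<delta>2" using sub by (auto simp: mem_Times_iff)
              then show "tt (snd q) \<in> T \<inter> ball t0 d" by (rule tz(1))
              show "x q \<in> ball (fst p) r" by (rule xin[OF q])
            qed
          qed
          moreover have "continuous_on ({0..1} \<times> sphere w0 (\<rho>/2)) (\<lambda>q. f (x q))"
            by (rule continuous_on_compose2[OF holomorphic_on_imp_continuous_on[OF holf] cx]) (use xin in auto)
          ultimately show ?thesis by (auto intro!: continuous_intros)
        qed
        show "F (tt (snd (a, w))) (x (a, w)) - f (x (a, w)) \<noteq> 0" if a: "a \<in> {0..1}" and w: "w \<in> sphere w0 (\<rho>/2)" for a w
        proof -
          have wb: "w \<in> ball w0 \<delta>2" "w \<in> ball w0 \<rho> - {w0}" using w sub \<rho>(1) by auto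
          then have "tt w \<noteq> t0" using tt_u \<rho>(3) by blast
          then show ?thesis using Fne[OF tz(1)[OF wb(1)] xin[of "(a, w)"]] a w by simp
        qed
        show "F (tt (snd (0, w))) (x (0, w)) - f (x (0, w)) = u w" if "w \<in> sphere w0 (\<rho>/2)" for w
          using F\<alpha>[of w] that sub by (auto simp: x_def u_def)
        show "F (tt (snd (1, w))) (x (1, w)) - f (x (1, w)) = F (tt w) (fst p) - snd p" for w
          using fp by (simp add: x_def)
      qed (use u0 \<rho> in auto)
      \<comment> \<open>Every height within \<open>m\<close> of \<open>snd p\<close> is attained
        over \<open>fst p\<close> by some plaque, so \<open>X\<close> contains a vertical
        disc.\<close>
      have "has_invariant_line_segment X"
      proof (rule vertical_disc_imp_line[OF m(1)])
        fix y assume "cmod (y - snd p) < m"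
        then have "y - snd p \<in> ball 0 m" by simp
        then obtain w where w: "w \<in> cball w0 (\<rho>/2)" "y - snd p = F (tt w) (fst p) - snd p" using m(2) by blast
        then show "(fst p, y) \<in> X" using FX[OF tz(1), of w "fst p"] sub G(1) by auto
      qed
      with nl show ?thesis by blast
    qed
  qed
  then show thesis using that[of r f] G(1) vg fp unfolding p_def by blast
qed

lemma lamination_flow_box:
  assumes "lamination \<Lambda> X" "p \<in> X"
  obtains U T \<phi> z0 t0 where "flow_box \<Lambda> X U T \<phi>" "z0 \<in> ball 0 1" "t0 \<in> T" "\<phi> (z0, t0) = p"
proof -
  obtain U T \<phi> where fb: "flow_box \<Lambda> X U T \<phi>" "p \<in> U" using assms by (auto simp: lamination_def)
  then obtain \<psi> where "homeomorphism (ball 0 1 \<times> T) (X \<inter> U) \<phi> \<psi>" by (auto simp: flow_box_def)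
  then have "p \<in> \<phi> ` (ball 0 1 \<times> T)" using assms(2) fb(2) unfolding homeomorphism_def by blast
  then show thesis using fb that by auto
qed

lemma flow_box_immersion:
  assumes "flow_box \<Lambda> X U T \<phi>" "z0 \<in> ball 0 1" "t0 \<in> T"
  shows "deriv (\<lambda>w. fst (\<phi> (w, t0))) z0 \<noteq> 0 \<or> deriv (\<lambda>w. snd (\<phi> (w, t0))) z0 \<noteq> 0"
  using assms by (auto simp: flow_box_def)

text \<open>A plaque is immersed, so one of the two coordinates is a local parameter; which one
  depends on \<open>p\<close>, hence the disjunction.\<close>

lemma lamination_absorbing:
  assumes lam: "lamination \<Lambda> X" and nl: "\<not> has_invariant_line_segment X" and p: "p \<in> X"
  shows "(\<exists>f r. 0 < r \<and> vgraph X f (fst p) r \<and> f (fst p) = snd p \<and> absorbing X f p) \<or>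
    (\<exists>h r. 0 < r \<and> vgraph (prod.swap ` X) h (snd p) r \<and> h (snd p) = fst p \<and> absorbing (prod.swap ` X) h (prod.swap p))"
proof -
  obtain U T \<phi> z0 t0 where fb: "flow_box \<Lambda> X U T \<phi>" "z0 \<in> ball 0 1" "t0 \<in> T" "\<phi> (z0, t0) = p"
    using lamination_flow_box[OF lam p] .
  from flow_box_immersion[OF fb(1-3)] show ?thesis
  proof
    assume "deriv (\<lambda>w. fst (\<phi> (w, t0))) z0 \<noteq> 0"
    from flow_box_absorbing[OF fb(1-3) this nl] show ?thesis unfolding fb(4) by blast
  next
    assume "deriv (\<lambda>w. snd (\<phi> (w, t0))) z0 \<noteq> 0"
    then have "deriv (\<lambda>w. fst ((prod.swap \<circ> \<phi>) (w, t0))) z0 \<noteq> 0" by simp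
    from flow_box_absorbing[OF flow_box_swap[OF fb(1)] fb(2,3) this no_line_swap[OF nl]]
    obtain h r where "0 < r" "vgraph (prod.swap ` X) h (fst (prod.swap p)) r"
      "h (fst (prod.swap p)) = snd (prod.swap p)" "absorbing (prod.swap ` X) h (prod.swap p)"
      unfolding o_apply fb(4) by metis
    then show ?thesis by auto
  qed
qed

text \<open>Near a common point both graphs are absorbed by the same local leaf, and the identity
  theorem does the rest. If that leaf is given over the second coordinate by \<open>h0\<close>, then
  h0 (f x) = x = h0 (g x). Differentiating the first equation shows that \<open>deriv h0\<close> is
  nonzero, so \<open>h0\<close> is locally injective and can be cancelled. Plaques of different flow
  boxes are thereby compared without transition maps.\<close>

lemma vgraph_unique:
  assumes lam: "lamination \<Lambda> X" and nl: "\<not> has_invariant_line_segment X"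
    and f: "vgraph X f a r" and g: "vgraph X g a r" and w: "w \<in> ball a r" "f w = g w" and x: "x \<in> ball a r"
  shows "f x = g x"
proof -
  define \<delta> where "\<delta> = r - dist a w"
  have \<delta>: "0 < \<delta>" "ball w \<delta> \<subseteq> ball a r" using w(1) by (auto simp: \<delta>_def intro!: ball_subset_ballI)
  have hol: "f holomorphic_on ball w \<delta>" "g holomorphic_on ball w \<delta>"
    using f g \<delta>(2) by (auto simp: vgraph_def intro: holomorphic_on_subset)
  have inX: "(x, f x) \<in> X" "(x, g x) \<in> X" if "x \<in> ball w \<delta>" for x
    using f g \<delta>(2) that by (auto simp: vgraph_def)
  have "(w, f w) \<in> X" using inX(1)[of w] \<delta>(1) by simp
  have "\<exists>d>0. \<forall>x\<in>ball w d. f x = g x"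
    using lamination_absorbing[OF lam nl \<open>(w, f w) \<in> X\<close>]
  proof (elim disjE exE conjE)
    fix f0 s assume ab: "absorbing X f0 (w, f w)"
    obtain d1 where d1: "d1 > 0" "\<And>x. x \<in> ball w d1 \<Longrightarrow> f x = f0 x"
      using ab[unfolded absorbing_def, rule_format, of \<delta> "\<lambda>x. x" w f] \<delta>(1) hol(1) inX by auto
    obtain d2 where d2: "d2 > 0" "\<And>x. x \<in> ball w d2 \<Longrightarrow> g x = f0 x"
      using ab[unfolded absorbing_def, rule_format, of \<delta> "\<lambda>x. x" w g] \<delta>(1) hol(2) inX w(2) by auto
    show ?thesis using d1 d2 by (intro exI[of _ "min d1 d2"]) auto
  next
    fix h0 s
    assume s: "0 < s" and ab: "absorbing (prod.swap ` X) h0 (prod.swap (w, f w))"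
      and h0: "vgraph (prod.swap ` X) h0 (snd (w, f w)) s"
    obtain d1 where d1: "d1 > 0" "\<And>x. x \<in> ball w d1 \<Longrightarrow> x = h0 (f x)"
      using ab[unfolded absorbing_def, rule_format, of \<delta> f w "\<lambda>x. x"] \<delta>(1) hol(1) inX by auto
    obtain d2 where d2: "d2 > 0" "\<And>x. x \<in> ball w d2 \<Longrightarrow> x = h0 (g x)"
      using ab[unfolded absorbing_def, rule_format, of \<delta> g w "\<lambda>x. x"] \<delta>(1) hol(2) inX w(2) by auto
    have holh: "h0 holomorphic_on ball (f w) s" using h0 by (simp add: vgraph_def)
    have dh: "(h0 has_field_derivative deriv h0 (f w)) (at (f w))" using holomorphic_derivI[OF holh] s by simp
    have df: "(f has_field_derivative deriv f w) (at w)" using holomorphic_derivI[OF hol(1)] \<delta>(1) by simp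
    have "((\<lambda>x. h0 (f x)) has_field_derivative deriv h0 (f w) * deriv f w) (at w)"
      by (rule DERIV_chain2[OF dh df])
    moreover have "\<forall>\<^sub>F x in nhds w. h0 (f x) = x"
      unfolding eventually_nhds using d1 by (intro exI[of _ "ball w d1"]) auto
    ultimately have "((\<lambda>x. x) has_field_derivative deriv h0 (f w) * deriv f w) (at w)"
      using DERIV_cong_ev[OF refl, of "\<lambda>x. h0 (f x)" "\<lambda>x. x" w] by blast
    then have "deriv h0 (f w) * deriv f w = 1" using DERIV_ident DERIV_unique by blast
    then have nz: "deriv h0 (f w) \<noteq> 0" by auto
    obtain k where k: "k > 0" "ball (f w) k \<subseteq> ball (f w) s" "inj_on h0 (ball (f w) k)"
      using has_complex_derivative_locally_injective[OF holh _ _ nz] s by auto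
    have "isCont f w" "isCont g w"
      using hol \<delta>(1) by (metis centre_in_ball continuous_on_eq_continuous_at holomorphic_on_imp_continuous_on open_ball)+
    then have lim: "(f \<longlongrightarrow> f w) (nhds w)" "(g \<longlongrightarrow> f w) (nhds w)"
      using w(2) tendsto_at_iff_tendsto_nhds[of f w] tendsto_at_iff_tendsto_nhds[of g w] unfolding isCont_def by auto
    have "\<forall>\<^sub>F x in nhds w. dist (f x) (f w) < k" "\<forall>\<^sub>F x in nhds w. dist (g x) (f w) < k"
      using tendstoD[OF lim(1) k(1)] tendstoD[OF lim(2) k(1)] .
    then have "\<forall>\<^sub>F x in nhds w. dist (f x) (f w) < k \<and> dist (g x) (f w) < k" by eventually_elim auto
    then obtain d3 where d3: "d3 > 0" "\<And>x. dist x w < d3 \<Longrightarrow> dist (f x) (f w) < k \<and> dist (g x) (f w) < k"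
      unfolding eventually_nhds_metric by blast
    show ?thesis
    proof (intro exI[of _ "min d3 (min d1 d2)"] conjI ballI)
      fix x assume x: "x \<in> ball w (min d3 (min d1 d2))"
      have "h0 (f x) = h0 (g x)" using d1(2)[of x] d2(2)[of x] x by auto
      then show "f x = g x" using k(3) d3(2)[of x] x by (auto simp: inj_on_def dist_commute)
    qed (use d1 d2 d3 in auto)
  qed
  then obtain d where d: "d > 0" "\<And>x. x \<in> ball w d \<Longrightarrow> f x = g x" by blast
  show ?thesis
    by (rule holomorphic_eqI_ball[OF _ _ w(1) d x]) (use f g in \<open>auto simp: vgraph_def\<close>)
qed

lemma vgraph_dichotomy:
  assumes "lamination \<Lambda> X" "\<not> has_invariant_line_segment X" "vgraph X f a r" "vgraph X g a r"
  shows "(\<forall>w\<in>ball a r. f w \<noteq> g w) \<or> (\<forall>w\<in>ball a r. f w = g w)"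
  using vgraph_unique[OF assms] by blast

text \<open>Both graphs are absorbed by one local leaf. If it is a graph over the first coordinate,
  this gives f (h y) = y, the composition in the other order; the chain rule then makes
  \<open>deriv f a\<close> nonzero, and local injectivity of \<open>f\<close> yields h (f x) =
  x.\<close>

lemma vgraph_hgraph_inverse:
  assumes lam: "lamination \<Lambda> X" and nl: "\<not> has_invariant_line_segment X"
    and f: "vgraph X f a r" "0 < r" and h: "vgraph (prod.swap ` X) h b s" "0 < s" and ab: "f a = b" "h b = a"
  shows "\<exists>d>0. \<forall>x\<in>ball a d. h (f x) = x"
proof -
  have hol: "f holomorphic_on ball a r" "h holomorphic_on ball b s" using f h by (auto simp: vgraph_def)
  have inX: "\<And>x. x \<in> ball a r \<Longrightarrow> (x, f x) \<in> X" "\<And>y. y \<in> ball b s \<Longrightarrow> (h y, y) \<in> X"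
    using f h by (auto simp: vgraph_def)
  have p: "(a, b) \<in> X" using inX(1)[of a] f ab by simp
  have cont: "isCont f a" "isCont h b"
    using hol f(2) h(2) by (metis centre_in_ball continuous_on_eq_continuous_at holomorphic_on_imp_continuous_on open_ball)+
  have lim: "(f \<longlongrightarrow> b) (nhds a)" "(h \<longlongrightarrow> a) (nhds b)"
    using cont tendsto_at_iff_tendsto_nhds[of f a] tendsto_at_iff_tendsto_nhds[of h b] ab unfolding isCont_def by auto
  have ev: "\<forall>\<^sub>F x in nhds u. P x" if "d > 0" "\<And>x. x \<in> ball u d \<Longrightarrow> P x" for u :: complex and d P
    unfolding eventually_nhds using that by (intro exI[of _ "ball u d"]) auto
  have "\<forall>\<^sub>F x in nhds a. h (f x) = x"
    using lamination_absorbing[OF lam nl p]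
  proof (elim disjE exE conjE)
    fix f0 s' assume "absorbing X f0 (a, b)"
    then have ab': "absorbing X f0 (a, b)" by simp
    obtain d1 where d1: "d1 > 0" "\<And>x. x \<in> ball a d1 \<Longrightarrow> f x = f0 x"
      using ab'[unfolded absorbing_def, rule_format, of r "\<lambda>x. x" a f] f(2) hol(1) inX ab by auto
    obtain d2 where d2: "d2 > 0" "\<And>y. y \<in> ball b d2 \<Longrightarrow> y = f0 (h y)"
      using ab'[unfolded absorbing_def, rule_format, of s h b "\<lambda>y. y"] h(2) hol(2) inX ab by auto
    have e1: "\<forall>\<^sub>F x in nhds a. f x = f0 x" by (rule ev[OF d1])
    have e2: "\<forall>\<^sub>F y in nhds b. y = f0 (h y)" by (rule ev[OF d2])
    have e3: "\<forall>\<^sub>F y in nhds b. f (h y) = y"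
      using e2 eventually_compose_filterlim[OF e1 lim(2)] by eventually_elim simp
    have dh: "(h has_field_derivative deriv h b) (at b)" using holomorphic_derivI[OF hol(2)] h(2) by simp
    have df: "(f has_field_derivative deriv f a) (at a)" using holomorphic_derivI[OF hol(1)] f(2) by simp
    have "((\<lambda>y. f (h y)) has_field_derivative deriv f a * deriv h b) (at b)"
      using DERIV_chain2[of f "deriv f a" h b] df dh ab by simp
    then have "((\<lambda>y. y) has_field_derivative deriv f a * deriv h b) (at b)"
      using DERIV_cong_ev[OF refl e3] by blast
    then have "deriv f a * deriv h b = 1" using DERIV_ident DERIV_unique by blast
    then have nz: "deriv f a \<noteq> 0" by auto
    obtain k where k: "k > 0" "inj_on f (ball a k)"
      using has_complex_derivative_locally_injective[OF hol(1) _ _ nz] f(2) by auto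
    have limhf: "((\<lambda>x. h (f x)) \<longlongrightarrow> a) (nhds a)" by (rule filterlim_compose[OF lim(2) lim(1)])
    have "\<forall>\<^sub>F x in nhds a. x \<in> ball a k" "\<forall>\<^sub>F x in nhds a. dist (h (f x)) a < k"
      using eventually_nhds_in_open[of "ball a k" a] k(1) tendstoD[OF limhf k(1)] by auto
    then show ?thesis using eventually_compose_filterlim[OF e3 lim(1)]
    proof eventually_elim
      case (elim x)
      then show ?case using k(2) by (auto simp: inj_on_def dist_commute)
    qed
  next
    fix h0 s' assume "absorbing (prod.swap ` X) h0 (prod.swap (a, b))"
    then have ab': "absorbing (prod.swap ` X) h0 (b, a)" by simp
    obtain d1 where d1: "d1 > 0" "\<And>x. x \<in> ball a d1 \<Longrightarrow> x = h0 (f x)"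
      using ab'[unfolded absorbing_def, rule_format, of r f a "\<lambda>x. x"] f(2) hol(1) inX ab by auto
    obtain d2 where d2: "d2 > 0" "\<And>y. y \<in> ball b d2 \<Longrightarrow> h y = h0 y"
      using ab'[unfolded absorbing_def, rule_format, of s "\<lambda>y. y" b h] h(2) hol(2) inX ab by auto
    have e1: "\<forall>\<^sub>F x in nhds a. x = h0 (f x)" by (rule ev[OF d1])
    have e2: "\<forall>\<^sub>F y in nhds b. h y = h0 y" by (rule ev[OF d2])
    show ?thesis using e1 eventually_compose_filterlim[OF e2 lim(1)] by eventually_elim simp
  qed
  then show ?thesis unfolding eventually_nhds_metric by (auto simp: dist_commute)
qed

section \<open>Charts of uniform size\<close>

text \<open>One radius and one bound serve all points of \<open>X\<close> near \<open>p\<close>, and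
  every graph lives on the same disc around \<open>fst p\<close>. This uniformity makes Harnack's
  inequality applicable to families of leaves and determines the step length of the
  continuation.\<close>

definition vchart :: "c2 set \<Rightarrow> real \<Rightarrow> c2 \<Rightarrow> real \<Rightarrow> bool" where
  "vchart X B p r \<longleftrightarrow> (\<forall>q\<in>X \<inter> ball p r. \<exists>f. vgraph X f (fst p) r \<and>
     (\<forall>x\<in>ball (fst p) r. cmod (f x - snd p) \<le> B) \<and> f (fst q) = snd q)"

lemma flow_box_vchart:
  assumes fb: "flow_box \<Lambda> X U T \<phi>" and z0: "z0 \<in> ball 0 1" and t0: "t0 \<in> T"
    and nz: "deriv (\<lambda>w. fst (\<phi> (w, t0))) z0 \<noteq> 0"
  shows "\<exists>r>0. vchart X 1 (\<phi> (z0, t0)) r"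
proof -
  define p where "p = \<phi> (z0, t0)"
  obtain r d where rd: "0 < r" "0 < d" "ball z0 d \<subseteq> ball 0 1"
    and ch: "\<And>t. t \<in> T \<inter> ball t0 d \<Longrightarrow> \<exists>f. vgraph X f (fst p) r \<and>
        (\<forall>x\<in>ball (fst p) r. cmod (f x - snd p) \<le> 1) \<and>
        (\<forall>z\<in>ball z0 d. fst (\<phi> (z, t)) \<in> ball (fst p) (r/16) \<and> f (fst (\<phi> (z, t))) = snd (\<phi> (z, t)))"
    by (rule flow_box_chart[OF assms, folded p_def]) (rule that, assumption+)
  obtain \<rho> where \<rho>: "0 < \<rho>" "\<And>q. q \<in> X \<inter> ball p \<rho> \<Longrightarrow> \<exists>z t. z \<in> ball 0 1 \<inter> ball z0 d \<and> t \<in> T \<inter> ball t0 d \<and> q = \<phi> (z, t)"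
    by (rule flow_box_near[OF fb z0 t0 rd(2), folded p_def]) (rule that, assumption+)
  have "vchart X 1 p (min r \<rho>)" unfolding vchart_def
  proof
    fix q assume "q \<in> X \<inter> ball p (min r \<rho>)"
    then have "q \<in> X \<inter> ball p \<rho>" by auto
    then obtain z t where zt: "z \<in> ball z0 d" "t \<in> T \<inter> ball t0 d" "q = \<phi> (z, t)" using \<rho>(2) by blast
    obtain f where f: "vgraph X f (fst p) r" "\<forall>x\<in>ball (fst p) r. cmod (f x - snd p) \<le> 1" "f (fst q) = snd q"
      using ch[OF zt(2)] zt(1,3) by blast
    show "\<exists>f. vgraph X f (fst p) (min r \<rho>) \<and> (\<forall>x\<in>ball (fst p) (min r \<rho>). cmod (f x - snd p) \<le> 1) \<and> f (fst q) = snd q"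
      using f vgraph_subset[OF f(1), of "fst p" "min r \<rho>", OF subset_ball] by (intro exI[of _ f]) auto
  qed
  moreover have "0 < min r \<rho>" using rd(1) \<rho>(1) by simp
  ultimately show ?thesis unfolding p_def by blast
qed

lemma flow_box_tangent:
  assumes fb: "flow_box \<Lambda> X U T \<phi>" and z0: "z0 \<in> ball 0 1" and t0: "t0 \<in> T"
    and nz: "deriv (\<lambda>w. fst (\<phi> (w, t0))) z0 \<noteq> 0" and z: "deriv (\<lambda>w. snd (\<phi> (w, t0))) z0 = 0"
    and d: "0 < d" "ball z0 d \<subseteq> ball 0 1"
    and f: "f holomorphic_on ball (fst (\<phi> (z0, t0))) r" "0 < r" "\<And>z. z \<in> ball z0 d \<Longrightarrow> f (fst (\<phi> (z, t0))) = snd (\<phi> (z, t0))"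
  shows "deriv f (fst (\<phi> (z0, t0))) = 0"
proof -
  define u v where "u = (\<lambda>z. fst (\<phi> (z, t0)))" and "v = (\<lambda>z. snd (\<phi> (z, t0)))"
  have hol: "u holomorphic_on ball 0 1" "v holomorphic_on ball 0 1" using fb t0 by (auto simp: u_def v_def flow_box_def)
  have du: "(u has_field_derivative deriv u z0) (at z0)" and dv: "(v has_field_derivative deriv v z0) (at z0)"
    using holomorphic_derivI[OF hol(1) _ z0] holomorphic_derivI[OF hol(2) _ z0] by auto
  have df: "(f has_field_derivative deriv f (u z0)) (at (u z0))"
    using holomorphic_derivI[OF f(1), of "u z0"] f(2) by (simp add: u_def)
  have "((\<lambda>z. f (u z)) has_field_derivative deriv f (u z0) * deriv u z0) (at z0)" by (rule DERIV_chain2[OF df du])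
  moreover have e: "\<forall>\<^sub>F z in nhds z0. f (u z) = v z"
    unfolding eventually_nhds using d(1) f(3) by (intro exI[of _ "ball z0 d"]) (auto simp: u_def v_def)
  ultimately have "(v has_field_derivative deriv f (u z0) * deriv u z0) (at z0)"
    using DERIV_cong_ev[OF refl e] by blast
  then have "deriv f (u z0) * deriv u z0 = deriv v z0" using dv DERIV_unique by blast
  then show ?thesis using nz z by (simp add: u_def v_def)
qed

text \<open>The second alternative arises at a vertical tangency, where the plaque is a graph over
  the second coordinate with a critical point. The vanishing of \<open>deriv h\<close> is what later
  contradicts osculation.\<close>

lemma lamination_chart:
  assumes lam: "lamination \<Lambda> X" and p: "p \<in> X"
  shows "(\<exists>r>0. vchart X 1 p r) \<or>
    (\<exists>r>0. vchart (prod.swap ` X) 1 (prod.swap p) r \<and>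
       (\<exists>h. vgraph (prod.swap ` X) h (snd p) r \<and> (\<forall>y\<in>ball (snd p) r. cmod (h y - fst p) \<le> 1) \<and>
         h (snd p) = fst p \<and> deriv h (snd p) = 0))"
proof -
  obtain U T \<phi> z0 t0 where fb: "flow_box \<Lambda> X U T \<phi>" "z0 \<in> ball 0 1" "t0 \<in> T" "\<phi> (z0, t0) = p"
    using lamination_flow_box[OF lam p] .
  show ?thesis
  proof (cases "deriv (\<lambda>w. fst (\<phi> (w, t0))) z0 = 0")
    case False
    then show ?thesis using flow_box_vchart[OF fb(1-3) False] fb(4) by simp
  next
    case True
    define \<phi>' where "\<phi>' = prod.swap \<circ> \<phi>"
    have fb': "flow_box (prod.swap ` \<Lambda>) (prod.swap ` X) (prod.swap ` U) T \<phi>'"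
      unfolding \<phi>'_def by (rule flow_box_swap[OF fb(1)])
    have p': "\<phi>' (z0, t0) = prod.swap p" using fb(4) by (simp add: \<phi>'_def)
    have nz: "deriv (\<lambda>w. fst (\<phi>' (w, t0))) z0 \<noteq> 0" using flow_box_immersion[OF fb(1-3)] True by (simp add: \<phi>'_def)
    have z: "deriv (\<lambda>w. snd (\<phi>' (w, t0))) z0 = 0" using True by (simp add: \<phi>'_def)
    obtain r1 where r1: "r1 > 0" "vchart (prod.swap ` X) 1 (prod.swap p) r1"
      using flow_box_vchart[OF fb' fb(2,3) nz] p' by auto
    obtain r d where rd: "0 < r" "0 < d" "ball z0 d \<subseteq> ball 0 1"
      and ch: "\<And>t. t \<in> T \<inter> ball t0 d \<Longrightarrow> \<exists>f. vgraph (prod.swap ` X) f (fst (prod.swap p)) r \<and>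
        (\<forall>x\<in>ball (fst (prod.swap p)) r. cmod (f x - snd (prod.swap p)) \<le> 1) \<and>
        (\<forall>z\<in>ball z0 d. fst (\<phi>' (z, t)) \<in> ball (fst (prod.swap p)) (r/16) \<and> f (fst (\<phi>' (z, t))) = snd (\<phi>' (z, t)))"
      by (rule flow_box_chart[OF fb' fb(2,3) nz, unfolded p']) (rule that, assumption+)
    obtain h where h: "vgraph (prod.swap ` X) h (snd p) r" "\<forall>x\<in>ball (snd p) r. cmod (h x - fst p) \<le> 1"
      "\<And>z. z \<in> ball z0 d \<Longrightarrow> h (fst (\<phi>' (z, t0))) = snd (\<phi>' (z, t0))"
      using ch[of t0] fb(3) rd(2) by auto
    have hp: "h (snd p) = fst p" using h(3)[of z0] rd(2) p' by simp
    have "deriv h (fst (\<phi>' (z0, t0))) = 0"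
      by (rule flow_box_tangent[OF fb' fb(2,3) nz z rd(2,3) _ rd(1) h(3)]) (use h(1) p' in \<open>auto simp: vgraph_def\<close>)
    then have dh: "deriv h (snd p) = 0" by (simp add: p')
    define m where "m = min r r1"
    have "vchart (prod.swap ` X) 1 (prod.swap p) m" unfolding vchart_def
    proof
      fix q assume "q \<in> prod.swap ` X \<inter> ball (prod.swap p) m"
      then have "q \<in> prod.swap ` X \<inter> ball (prod.swap p) r1" by (auto simp: m_def)
      then obtain f where f: "vgraph (prod.swap ` X) f (fst (prod.swap p)) r1"
        "\<forall>x\<in>ball (fst (prod.swap p)) r1. cmod (f x - snd (prod.swap p)) \<le> 1" "f (fst q) = snd q"
        using r1(2) unfolding vchart_def by blast
      show "\<exists>f. vgraph (prod.swap ` X) f (fst (prod.swap p)) m \<and>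
          (\<forall>x\<in>ball (fst (prod.swap p)) m. cmod (f x - snd (prod.swap p)) \<le> 1) \<and> f (fst q) = snd q"
        using f vgraph_subset[OF f(1), of "fst (prod.swap p)" m, OF subset_ball] by (intro exI[of _ f]) (auto simp: m_def)
    qed
    moreover have "vgraph (prod.swap ` X) h (snd p) m" by (rule vgraph_subset[OF h(1)]) (auto simp: m_def)
    moreover have "m > 0" using rd(1) r1(1) by (simp add: m_def)
    ultimately show ?thesis using h(2) hp dh by (intro disjI2 exI[of _ m] conjI exI[of _ h]) (auto simp: m_def)
  qed
qed

section \<open>Leaves osculating their translates\<close>

lemma vchart_mono:
  assumes "vchart X B p r" "r' \<le> r" "B \<le> B'" shows "vchart X B' p r'"
  unfolding vchart_def
proof
  fix q assume "q \<in> X \<inter> ball p r'"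
  then have "q \<in> X \<inter> ball p r" using assms(2) by auto
  then obtain f where f: "vgraph X f (fst p) r" "\<forall>x\<in>ball (fst p) r. cmod (f x - snd p) \<le> B" "f (fst q) = snd q"
    using assms(1) unfolding vchart_def by blast
  have "vgraph X f (fst p) r'" by (rule vgraph_subset[OF f(1)]) (use assms(2) in auto)
  then show "\<exists>f. vgraph X f (fst p) r' \<and> (\<forall>x\<in>ball (fst p) r'. cmod (f x - snd p) \<le> B') \<and> f (fst q) = snd q"
  proof (intro exI[of _ f] conjI ballI)
    fix x assume "x \<in> ball (fst p) r'"
    then have "cmod (f x - snd p) \<le> B" using f(2) assms(2) by auto
    then show "cmod (f x - snd p) \<le> B'" using assms(3) by linarith
  qed (use f in auto)
qed

lemma vchart_shift:
  assumes "vchart X B p r" "dist p q \<le> r/2" shows "vchart X (B + r) q (r/2)"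
  unfolding vchart_def
proof
  have d: "dist (fst p) (fst q) \<le> r/2" "dist (snd p) (snd q) \<le> r/2"
    using assms(2) dist_fst_le[of p q] dist_snd_le[of p q] by auto
  have r: "0 \<le> r" using assms(2) zero_le_dist[of p q] by linarith
  have sub: "ball (fst q) (r/2) \<subseteq> ball (fst p) r" by (rule ball_subset_ballI) (use d in auto)
  fix q' assume "q' \<in> X \<inter> ball q (r/2)"
  moreover have "ball q (r/2) \<subseteq> ball p r"
  proof
    fix x assume "x \<in> ball q (r/2)"
    then show "x \<in> ball p r" using assms(2) dist_triangle[of p x q] by simp
  qed
  ultimately have "q' \<in> X \<inter> ball p r" by blast
  then obtain f where f: "vgraph X f (fst p) r" "\<forall>x\<in>ball (fst p) r. cmod (f x - snd p) \<le> B" "f (fst q') = snd q'"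
    using assms(1) unfolding vchart_def by blast
  have "cmod (f x - snd q) \<le> B + r" if "x \<in> ball (fst q) (r/2)" for x
  proof -
    have "cmod (f x - snd p) \<le> B" using f(2) sub that by blast
    then show ?thesis using d(2) r norm_triangle_ineq[of "f x - snd p" "snd p - snd q"] by (simp add: dist_norm)
  qed
  then show "\<exists>f. vgraph X f (fst q) (r/2) \<and> (\<forall>x\<in>ball (fst q) (r/2). cmod (f x - snd q) \<le> B + r) \<and> f (fst q') = snd q'"
    using f vgraph_subset[OF f(1) sub] by (intro exI[of _ f]) auto
qed

section \<open>Translation by the lattice\<close>

lemma vgraph_translate:
  assumes "\<And>x. x \<in> X \<Longrightarrow> x + l \<in> X" "vgraph X f a r"
  shows "vgraph X (\<lambda>x. f (x - fst l) + snd l) (a + fst l) r"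
proof -
  have in_ball: "x - fst l \<in> ball a r" if "x \<in> ball (a + fst l) r" for x
    using that by (simp add: dist_norm algebra_simps)
  have "(f \<circ> (\<lambda>x. x - fst l)) holomorphic_on ball (a + fst l) r"
    by (rule holomorphic_on_compose_gen[of _ _ _ "ball a r"])
      (use assms in_ball in \<open>auto simp: vgraph_def intro!: holomorphic_intros\<close>)
  moreover have "(x, f (x - fst l) + snd l) \<in> X" if "x \<in> ball (a + fst l) r" for x
  proof -
    have "(x - fst l, f (x - fst l)) + l \<in> X" using assms in_ball[OF that] by (auto simp: vgraph_def)
    then show ?thesis by (simp add: plus_prod_def)
  qed
  ultimately show ?thesis by (auto simp: vgraph_def o_def intro!: holomorphic_intros)
qed

lemma vchart_translate:
  assumes inv: "\<And>x. x \<in> X \<Longrightarrow> x + l \<in> X" "\<And>x. x \<in> X \<Longrightarrow> x - l \<in> X" and ch: "vchart X B p r"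
  shows "vchart X B (p + l) r"
  unfolding vchart_def
proof
  fix q assume q: "q \<in> X \<inter> ball (p + l) r"
  then have "q - l \<in> X \<inter> ball p r" using inv(2) by (auto simp: dist_norm algebra_simps)
  then obtain f where f: "vgraph X f (fst p) r" "\<forall>x\<in>ball (fst p) r. cmod (f x - snd p) \<le> B" "f (fst (q - l)) = snd (q - l)"
    using ch unfolding vchart_def by blast
  show "\<exists>f. vgraph X f (fst (p + l)) r \<and> (\<forall>x\<in>ball (fst (p + l)) r. cmod (f x - snd (p + l)) \<le> B) \<and> f (fst q) = snd q"
  proof (intro exI conjI ballI)
    show "vgraph X (\<lambda>x. f (x - fst l) + snd l) (fst (p + l)) r" using vgraph_translate[OF inv(1) f(1)] by simp
    show "cmod ((\<lambda>x. f (x - fst l) + snd l) x - snd (p + l)) \<le> B" if "x \<in> ball (fst (p + l)) r" for x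
    proof -
      have "x - fst l \<in> ball (fst p) r" using that by (simp add: dist_norm algebra_simps)
      then show ?thesis using f(2) by simp
    qed
  qed (use f(3) in simp)
qed

text \<open>The basis gives a linear isomorphism \<open>f\<close> carrying the integer points
  \<open>Z\<close> onto the lattice. The claims then reduce to rounding down real coordinates, and
  to integers of modulus below 1 being 0. The condition \<open>- l \<in> \<Lambda>\<close> is
  recorded because the lamination is translated in both directions.\<close>

lemma lattice_cocompact:
  assumes "lattice \<Lambda>"
  shows "\<exists>K. compact K \<and> (\<forall>x. \<exists>l\<in>\<Lambda>. - l \<in> \<Lambda> \<and> x - l \<in> K)"
    and "\<exists>\<eta>>0. \<forall>l\<in>\<Lambda>. norm l < \<eta> \<longrightarrow> l = 0"
proof -
  obtain v1 v2 v3 v4 :: c2 where v: "independent {v1, v2, v3, v4}" "card {v1, v2, v3, v4} = 4"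
    and \<Lambda>: "\<Lambda> = {real_of_int a *\<^sub>R v1 + real_of_int b *\<^sub>R v2 + real_of_int c *\<^sub>R v3 + real_of_int d *\<^sub>R v4 | a b c d. True}"
    using assms unfolding lattice_def by blast
  have dist: "v1 \<noteq> v2" "v1 \<noteq> v3" "v1 \<noteq> v4" "v2 \<noteq> v3" "v2 \<noteq> v4" "v3 \<noteq> v4"
    using v(2) by (auto simp: card_insert_if split: if_splits)
  define f :: "c2 \<Rightarrow> c2" where "f = (\<lambda>z. Re (fst z) *\<^sub>R v1 + Im (fst z) *\<^sub>R v2 + Re (snd z) *\<^sub>R v3 + Im (snd z) *\<^sub>R v4)"
  have lin: "linear f" unfolding f_def by (rule linearI) (simp_all add: algebra_simps)
  have ker: "z = 0" if "f z = 0" for z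
  proof -
    define u where "u = (\<lambda>v. if v = v1 then Re (fst z) else if v = v2 then Im (fst z) else if v = v3 then Re (snd z) else Im (snd z))"
    have "(\<Sum>v\<in>{v1, v2, v3, v4}. u v *\<^sub>R v) = f z"
      using dist by (simp add: u_def f_def)
    then have "\<forall>v\<in>{v1, v2, v3, v4}. u v = 0"
      using independentD[OF v(1), of "{v1, v2, v3, v4}" u] that by auto
    then have "Re (fst z) = 0" "Im (fst z) = 0" "Re (snd z) = 0" "Im (snd z) = 0"
      using dist by (auto simp: u_def)
    then show "z = 0" by (simp add: prod_eq_iff complex_eq_iff)
  qed
  have inj: "inj f" using linear_injective_0[OF lin] ker by blast
  have surj: "surj f" using linear_injective_imp_surjective[OF lin inj] by blast
  define Z :: "c2 set" where "Z = {(Complex (of_int a) (of_int b), Complex (of_int c) (of_int d)) | a b c d. True}"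
  have \<Lambda>f: "\<Lambda> = f ` Z"
  proof (intro set_eqI iffI)
    fix x assume "x \<in> \<Lambda>"
    then obtain a b c d where "x = real_of_int a *\<^sub>R v1 + real_of_int b *\<^sub>R v2 + real_of_int c *\<^sub>R v3 + real_of_int d *\<^sub>R v4"
      unfolding \<Lambda> by blast
    then have "x = f (Complex (of_int a) (of_int b), Complex (of_int c) (of_int d))" by (simp add: f_def)
    then show "x \<in> f ` Z" unfolding Z_def by blast
  next
    fix x assume "x \<in> f ` Z"
    then obtain a b c d :: int where "x = f (Complex (of_int a) (of_int b), Complex (of_int c) (of_int d))"
      unfolding Z_def by blast
    then have "x = real_of_int a *\<^sub>R v1 + real_of_int b *\<^sub>R v2 + real_of_int c *\<^sub>R v3 + real_of_int d *\<^sub>R v4"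
      by (simp add: f_def)
    then show "x \<in> \<Lambda>" unfolding \<Lambda> by blast
  qed
  show "\<exists>K. compact K \<and> (\<forall>x. \<exists>l\<in>\<Lambda>. - l \<in> \<Lambda> \<and> x - l \<in> K)"
  proof (intro exI conjI allI)
    show "compact (f ` (cball 0 2 \<times> cball 0 2))"
      by (intro compact_continuous_image linear_continuous_on compact_Times compact_cball)
        (use lin in \<open>auto simp: linear_conv_bounded_linear\<close>)
    fix x
    obtain z where z: "x = f z" using surj by (metis surjD)
    define k where "k = (Complex (of_int \<lfloor>Re (fst z)\<rfloor>) (of_int \<lfloor>Im (fst z)\<rfloor>), Complex (of_int \<lfloor>Re (snd z)\<rfloor>) (of_int \<lfloor>Im (snd z)\<rfloor>))"
    have kZ: "k \<in> Z" unfolding k_def Z_def by blast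
    have "- k = (Complex (of_int (- \<lfloor>Re (fst z)\<rfloor>)) (of_int (- \<lfloor>Im (fst z)\<rfloor>)), Complex (of_int (- \<lfloor>Re (snd z)\<rfloor>)) (of_int (- \<lfloor>Im (snd z)\<rfloor>)))"
      by (simp add: k_def complex_eq_iff)
    then have mkZ: "- k \<in> Z" unfolding Z_def by blast
    have small: "cmod (w - Complex (of_int \<lfloor>Re w\<rfloor>) (of_int \<lfloor>Im w\<rfloor>)) \<le> 2" for w
    proof -
      have "cmod (w - Complex (of_int \<lfloor>Re w\<rfloor>) (of_int \<lfloor>Im w\<rfloor>)) \<le> \<bar>Re w - of_int \<lfloor>Re w\<rfloor>\<bar> + \<bar>Im w - of_int \<lfloor>Im w\<rfloor>\<bar>"
        using cmod_le[of "w - Complex (of_int \<lfloor>Re w\<rfloor>) (of_int \<lfloor>Im w\<rfloor>)"] by simp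
      moreover have "\<bar>Re w - of_int \<lfloor>Re w\<rfloor>\<bar> \<le> 1" "\<bar>Im w - of_int \<lfloor>Im w\<rfloor>\<bar> \<le> 1" by linarith+
      ultimately show ?thesis by linarith
    qed
    have "z - k \<in> cball 0 2 \<times> cball 0 2" using small[of "fst z"] small[of "snd z"] by (simp add: k_def mem_Times_iff)
    then have "x - f k \<in> f ` (cball 0 2 \<times> cball 0 2)" unfolding z using linear_diff[OF lin, of z k] by (metis image_eqI)
    moreover have "f k \<in> \<Lambda>" "- f k \<in> \<Lambda>" unfolding \<Lambda>f using kZ mkZ linear_neg[OF lin, of k] by (metis image_eqI)+
    ultimately show "\<exists>l\<in>\<Lambda>. - l \<in> \<Lambda> \<and> x - l \<in> f ` (cball 0 2 \<times> cball 0 2)" by blast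
  qed
  obtain C where C: "C > 0" "\<And>z. C * norm z \<le> norm (f z)" using linear_inj_bounded_below_pos[OF lin inj] by blast
  show "\<exists>\<eta>>0. \<forall>l\<in>\<Lambda>. norm l < \<eta> \<longrightarrow> l = 0"
  proof (intro exI[of _ C] conjI ballI impI)
    fix l assume l: "l \<in> \<Lambda>" "norm l < C"
    then obtain a b c d :: int where l': "l = f (Complex (of_int a) (of_int b), Complex (of_int c) (of_int d))"
      unfolding \<Lambda>f Z_def by blast
    define z where "z = (Complex (of_int a) (of_int b), Complex (of_int c) (of_int d))"
    have "C * norm z < C * 1" using C(2)[of z] l l' by (simp add: z_def)
    then have n: "norm z < 1" using C(1) by simp
    then have "cmod (fst z) < 1" "cmod (snd z) < 1"
      using norm_fst_le[of "fst z" "snd z"] norm_snd_le[of "snd z" "fst z"] by simp_all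
    then have "\<bar>real_of_int a\<bar> < 1" "\<bar>real_of_int b\<bar> < 1" "\<bar>real_of_int c\<bar> < 1" "\<bar>real_of_int d\<bar> < 1"
      using abs_Re_le_cmod[of "fst z"] abs_Im_le_cmod[of "fst z"] abs_Re_le_cmod[of "snd z"] abs_Im_le_cmod[of "snd z"]
      by (simp_all add: z_def)
    then have "a = 0" "b = 0" "c = 0" "d = 0" by linarith+
    then show "l = 0" unfolding l' f_def by simp
  qed (use C in auto)
qed

lemma lamination_translate:
  assumes "lamination \<Lambda> X" "l \<in> \<Lambda>" "- l \<in> \<Lambda>" "x \<in> X"
  shows "x + l \<in> X" "x - l \<in> X"
  using assms unfolding lamination_def by (metis image_eqI, metis add_uminus_conv_diff image_eqI)

lemma bounded_of_vchart: "cmod (f x - c) \<le> B \<Longrightarrow> cmod (f x) \<le> cmod c + B"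
  using norm_triangle_ineq2[of "f x" c] by simp

text \<open>The sequence \<open>e\<close> is the one produced by negating the bound on the number of
  intersections. Only vertical shifts \<open>(0, e n)\<close> are considered; horizontal ones become
  vertical in the swapped lamination.\<close>

locale shifted_lamination =
  fixes \<Lambda> X :: "c2 set" and e :: "nat \<Rightarrow> complex"
  assumes lat: "lattice \<Lambda>" and lam: "lamination \<Lambda> X" and nl: "\<not> has_invariant_line_segment X"
    and e: "e \<longlonglongrightarrow> 0" "\<And>n. e n \<noteq> 0"
begin

lemmas uniq = vgraph_unique[OF lam nl]
lemmas dich = vgraph_dichotomy[OF lam nl]
lemmas uniqH = vgraph_unique[OF lamination_swap[OF lam] no_line_swap[OF nl]]
lemmas dichH = vgraph_dichotomy[OF lamination_swap[OF lam] no_line_swap[OF nl]]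

text \<open>Near \<open>p\<close> there are leaves tending to the leaf through \<open>p\<close> which, after the translation
  by \<open>(0, e n)\<close>, agree to infinite order in \<open>e n\<close>.\<close>

definition osculating :: "c2 \<Rightarrow> bool" where
  "osculating p \<longleftrightarrow> (\<exists>\<rho>>0. \<exists>B f1 f2.
     (\<forall>\<^sub>F n in sequentially. vgraph X (f1 n) (fst p) \<rho> \<and> vgraph X (f2 n) (fst p) \<rho> \<and>
        (\<forall>x\<in>ball (fst p) \<rho>. cmod (f1 n x) \<le> B \<and> cmod (f2 n x) \<le> B)) \<and>
     (\<lambda>n. f2 n (fst p)) \<longlonglongrightarrow> snd p \<and> rapid e (ball (fst p) \<rho>) (\<lambda>n x. f1 n x - f2 n x - e n))"

lemma rapid_center_limit:
  assumes "rapid e (ball a \<rho>) (\<lambda>n x. f1 n x - f2 n x - e n)" "0 < \<rho>" "(\<lambda>n. f2 n a) \<longlonglongrightarrow> b"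
  shows "(\<lambda>n. f1 n a) \<longlonglongrightarrow> b"
proof -
  have "\<forall>\<^sub>F n in sequentially. \<forall>x\<in>ball a \<rho>. cmod (f1 n x - f2 n x - e n) \<le> cmod (e n) ^ 1"
    using assms(1) unfolding rapid_def by blast
  then have "\<forall>\<^sub>F n in sequentially. cmod (f1 n a - f2 n a - e n) \<le> cmod (e n)"
    by eventually_elim (use assms(2) in simp)
  then have "(\<lambda>n. f1 n a - f2 n a - e n) \<longlonglongrightarrow> 0"
    by (rule Lim_null_comparison) (rule tendsto_norm_zero[OF e(1)])
  from tendsto_add[OF tendsto_add[OF this e(1)] assms(3)] show ?thesis by simp
qed

lemma osculating_in: "osculating p \<Longrightarrow> p \<in> X"
proof -
  assume "osculating p"
  then obtain \<rho> B f1 f2 where \<rho>: "0 < \<rho>" and ev: "\<forall>\<^sub>F n in sequentially. vgraph X (f1 n) (fst p) \<rho> \<and> vgraph X (f2 n) (fst p) \<rho> \<and>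
        (\<forall>x\<in>ball (fst p) \<rho>. cmod (f1 n x) \<le> B \<and> cmod (f2 n x) \<le> B)"
     and lim: "(\<lambda>n. f2 n (fst p)) \<longlonglongrightarrow> snd p"
    unfolding osculating_def by blast
  have "(\<lambda>n. (fst p, f2 n (fst p))) \<longlonglongrightarrow> (fst p, snd p)" by (intro tendsto_intros lim)
  moreover have "\<forall>\<^sub>F n in sequentially. (fst p, f2 n (fst p)) \<in> X"
    using ev by eventually_elim (use \<rho> in \<open>auto simp: vgraph_def\<close>)
  moreover have "closed X" using lam by (simp add: lamination_def)
  ultimately show "p \<in> X" using Lim_in_closed_set by (metis prod.collapse sequentially_bot)
qed

text \<open>Every point can be moved by the lattice into a fixed compact set; this invariance turns
  local statements on osculating points into uniform ones.\<close>

lemma osculating_translate: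
  assumes "l \<in> \<Lambda>" "- l \<in> \<Lambda>" "osculating p" shows "osculating (p + l)"
proof -
  note inv = lamination_translate[OF lam assms(1,2)]
  obtain \<rho> B f1 f2 where \<rho>: "0 < \<rho>" and ev: "\<forall>\<^sub>F n in sequentially. vgraph X (f1 n) (fst p) \<rho> \<and> vgraph X (f2 n) (fst p) \<rho> \<and>
        (\<forall>x\<in>ball (fst p) \<rho>. cmod (f1 n x) \<le> B \<and> cmod (f2 n x) \<le> B)"
     and lim: "(\<lambda>n. f2 n (fst p)) \<longlonglongrightarrow> snd p" and rap: "rapid e (ball (fst p) \<rho>) (\<lambda>n x. f1 n x - f2 n x - e n)"
    using assms(3) unfolding osculating_def by blast
  have in_ball: "x - fst l \<in> ball (fst p) \<rho>" if "x \<in> ball (fst p + fst l) \<rho>" for x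
    using that by (simp add: dist_norm algebra_simps)
  show ?thesis unfolding osculating_def
  proof (intro exI conjI)
    show "\<forall>\<^sub>F n in sequentially. vgraph X (\<lambda>x. f1 n (x - fst l) + snd l) (fst (p + l)) \<rho> \<and>
        vgraph X (\<lambda>x. f2 n (x - fst l) + snd l) (fst (p + l)) \<rho> \<and>
        (\<forall>x\<in>ball (fst (p + l)) \<rho>. cmod (f1 n (x - fst l) + snd l) \<le> B + cmod (snd l) \<and> cmod (f2 n (x - fst l) + snd l) \<le> B + cmod (snd l))"
      using ev
    proof eventually_elim
      case (elim n)
      have "cmod (f n (x - fst l) + snd l) \<le> B + cmod (snd l)"
        if "f = f1 \<or> f = f2" "x \<in> ball (fst (p + l)) \<rho>" for x f
      proof -
        have "cmod (f n (x - fst l)) \<le> B" using elim in_ball[of x] that by auto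
        then show ?thesis using norm_triangle_ineq[of "f n (x - fst l)" "snd l"] by linarith
      qed
      then show ?case using vgraph_translate[OF inv(1)] elim by (simp add: fst_add)
    qed
    show "(\<lambda>n. f2 n (fst (p + l) - fst l) + snd l) \<longlonglongrightarrow> snd (p + l)" using tendsto_add[OF lim tendsto_const[of "snd l"]] by simp
    show "rapid e (ball (fst (p + l)) \<rho>) (\<lambda>n x. f1 n (x - fst l) + snd l - (f2 n (x - fst l) + snd l) - e n)"
      unfolding rapid_def
    proof
      fix N
      have "\<forall>\<^sub>F n in sequentially. \<forall>x\<in>ball (fst p) \<rho>. cmod (f1 n x - f2 n x - e n) \<le> cmod (e n) ^ N"
        using rap unfolding rapid_def by blast
      then show "\<forall>\<^sub>F n in sequentially. \<forall>x\<in>ball (fst (p + l)) \<rho>. cmod (f1 n (x - fst l) + snd l - (f2 n (x - fst l) + snd l) - e n) \<le> cmod (e n) ^ N"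
        by eventually_elim (use in_ball in simp)
    qed
  qed (rule \<rho>)
qed

text \<open>The given graphs may live on a tiny disc, but by uniqueness they continue to chart
  graphs of radius \<open>r\<close>. Rapid smallness spreads to \<open>r/2\<close>, and Harnack's
  inequality makes the second family converge to the leaf \<open>F\<close> through \<open>p\<close>,
  so the points of \<open>F\<close> over this disc are osculating again. The radius gained depends
  on the chart and not on the disc of osculation, which makes iteration possible.\<close>

lemma osculating_extend:
  assumes osc: "osculating p" and ch: "vchart X B0 p r" and r: "0 < r"
  obtains F where "vgraph X F (fst p) r" "F (fst p) = snd p"
    "\<And>x. x \<in> ball (fst p) r \<Longrightarrow> cmod (F x - snd p) \<le> B0"
    "\<And>x. x \<in> ball (fst p) (r/2) \<Longrightarrow> osculating (x, F x)"
proof -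
  obtain \<rho> B f1 f2 where \<rho>: "0 < \<rho>" and ev: "\<forall>\<^sub>F n in sequentially. vgraph X (f1 n) (fst p) \<rho> \<and> vgraph X (f2 n) (fst p) \<rho> \<and>
        (\<forall>x\<in>ball (fst p) \<rho>. cmod (f1 n x) \<le> B \<and> cmod (f2 n x) \<le> B)"
     and lim2: "(\<lambda>n. f2 n (fst p)) \<longlonglongrightarrow> snd p" and rap: "rapid e (ball (fst p) \<rho>) (\<lambda>n x. f1 n x - f2 n x - e n)"
    using osc unfolding osculating_def by blast
  define a b where "a = fst p" and "b = snd p"
  have p: "p = (a, b)" by (simp add: a_def b_def)
  note lim1 = rapid_center_limit[OF rap \<rho> lim2]
  define B' where "B' = cmod b + B0"
  have chart: "\<exists>f. vgraph X f a r \<and> (\<forall>x\<in>ball a r. cmod (f x - b) \<le> B0) \<and> f a = y" if "(a, y) \<in> X" "dist y b < r" for y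
  proof -
    have "(a, y) \<in> X \<inter> ball p r" using that by (auto simp: p dist_Pair_Pair dist_commute)
    from ch[unfolded vchart_def, rule_format, OF this] show ?thesis by (simp add: a_def b_def)
  qed
  obtain F where F: "vgraph X F a r" "\<forall>x\<in>ball a r. cmod (F x - b) \<le> B0" "F a = b"
    using chart[of b] osculating_in[OF osc] r p by auto
  define good where "good = (\<lambda>(f :: nat \<Rightarrow> complex \<Rightarrow> complex) n g. vgraph X g a r \<and> (\<forall>x\<in>ball a r. cmod (g x - b) \<le> B0) \<and> g a = f n a)"
  \<comment> \<open>Suitable chart graphs exist only for large \<open>n\<close>; the choice operator
    gives total sequences whose remaining members are arbitrary.\<close>
  define g1 where "g1 = (\<lambda>n. SOME g. good f1 n g)"
  define g2 where "g2 = (\<lambda>n. SOME g. good f2 n g)"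
  have evg: "\<forall>\<^sub>F n in sequentially. good f1 n (g1 n) \<and> good f2 n (g2 n)"
    using ev tendstoD[OF lim1 r] tendstoD[OF lim2 r]
  proof eventually_elim
    case (elim n)
    have "(a, f1 n a) \<in> X" "(a, f2 n a) \<in> X" using elim(1) \<rho> by (auto simp: vgraph_def a_def)
    then have "\<exists>g. good f1 n g" "\<exists>g. good f2 n g" using chart elim(2,3) unfolding good_def a_def b_def by blast+
    then show ?case unfolding g1_def g2_def by (metis someI_ex)
  qed
  define m where "m = min \<rho> r"
  have m: "0 < m" "m \<le> \<rho>" "m \<le> r" using \<rho> r by (auto simp: m_def)
  have evfg: "\<forall>\<^sub>F n in sequentially. \<forall>x\<in>ball a m. f1 n x = g1 n x \<and> f2 n x = g2 n x"
    using ev evg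
  proof eventually_elim
    case (elim n)
    have s: "ball a m \<subseteq> ball a \<rho>" "ball a m \<subseteq> ball a r" using m by auto
    have "vgraph X (f1 n) a m" "vgraph X (g1 n) a m" "vgraph X (f2 n) a m" "vgraph X (g2 n) a m"
      using elim s unfolding good_def a_def by (auto intro: vgraph_subset)
    moreover have "f1 n a = g1 n a" "f2 n a = g2 n a" using elim(2) by (auto simp: good_def)
    ultimately show ?case using uniq[where w = a] m(1) by auto
  qed
  have bnd: "cmod (f x) \<le> B'" if "\<forall>x\<in>ball a r. cmod (f x - b) \<le> B0" "x \<in> ball a r" for f :: "complex \<Rightarrow> complex" and x
    using bounded_of_vchart[of f x b B0] that by (simp add: B'_def)
  have rapm: "rapid e (ball a m) (\<lambda>n x. g1 n x - g2 n x - e n)"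
    unfolding rapid_def
  proof
    fix N
    have "\<forall>\<^sub>F n in sequentially. \<forall>x\<in>ball a \<rho>. cmod (f1 n x - f2 n x - e n) \<le> cmod (e n) ^ N"
      using rap unfolding rapid_def a_def by blast
    then show "\<forall>\<^sub>F n in sequentially. \<forall>x\<in>ball a m. cmod (g1 n x - g2 n x - e n) \<le> cmod (e n) ^ N"
      using evfg
    proof eventually_elim
      case (elim n)
      show ?case
      proof
        fix x assume x: "x \<in> ball a m"
        then have "x \<in> ball a \<rho>" using m(2) by auto
        then show "cmod (g1 n x - g2 n x - e n) \<le> cmod (e n) ^ N" using elim x by metis
      qed
    qed
  qed
  have "\<forall>\<^sub>F n in sequentially. (\<lambda>x. g1 n x - g2 n x - e n) holomorphic_on ball a r \<and>
      (\<forall>w\<in>ball a r. cmod (g1 n w - g2 n w - e n) \<le> 2 * B' + 1)"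
    using evg eventually_mult_norm_le[OF e(1) zero_less_one, of 1]
  proof eventually_elim
    case (elim n)
    have "cmod (g1 n w - g2 n w - e n) \<le> 2 * B' + 1" if "w \<in> ball a r" for w
    proof -
      have "cmod (g1 n w) \<le> B'" "cmod (g2 n w) \<le> B'" using bnd that elim(1) by (auto simp: good_def)
      then show ?thesis using norm_triangle_ineq4[of "g1 n w - g2 n w" "e n"] norm_triangle_ineq4[of "g1 n w" "g2 n w"] elim(2) by linarith
    qed
    then show ?case using elim(1) unfolding good_def vgraph_def by (auto intro!: holomorphic_intros)
  qed
  from rapid_propagate[OF e this r m(1) rapm]
  have rap2: "rapid e (ball a (r/2)) (\<lambda>n x. g1 n x - g2 n x - e n)" .
  have ul: "uniform_limit (cball a (r/2)) g2 F sequentially"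
  proof (rule Harnack_uniform_limit[of F a r B'])
    show "\<forall>\<^sub>F n in sequentially. g2 n holomorphic_on ball a r \<and> (\<forall>w\<in>ball a r. cmod (g2 n w) \<le> B') \<and>
        ((\<forall>w\<in>ball a r. g2 n w \<noteq> F w) \<or> (\<forall>w\<in>ball a r. g2 n w = F w))"
      using evg by eventually_elim (use bnd dich[OF _ F(1)] in \<open>auto simp: good_def vgraph_def\<close>)
    have "\<forall>\<^sub>F n in sequentially. f2 n a = g2 n a" using evg by eventually_elim (simp add: good_def)
    then show "(\<lambda>n. g2 n a) \<longlonglongrightarrow> F a"
      using lim2 F(3) tendsto_cong[of "\<lambda>n. f2 n a" "\<lambda>n. g2 n a"] by (simp add: a_def b_def)
  qed (use F r bnd in \<open>auto simp: vgraph_def\<close>)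
  show thesis
  proof (rule that[of F])
    fix x assume "x \<in> ball (fst p) (r/2)"
    then have x: "x \<in> ball a (r/2)" by (simp add: a_def)
    define s where "s = r/2 - dist a x"
    have s: "0 < s" "ball x s \<subseteq> ball a (r/2)" using x by (auto simp: s_def intro!: ball_subset_ballI)
    have sr: "ball x s \<subseteq> ball a r" using s(2) r by auto
    show "osculating (x, F x)" unfolding osculating_def
    proof (intro exI conjI)
      show "0 < s" by fact
      show "\<forall>\<^sub>F n in sequentially. vgraph X (g1 n) (fst (x, F x)) s \<and> vgraph X (g2 n) (fst (x, F x)) s \<and>
          (\<forall>y\<in>ball (fst (x, F x)) s. cmod (g1 n y) \<le> B' \<and> cmod (g2 n y) \<le> B')"
        using evg by eventually_elim (use bnd sr in \<open>auto simp: good_def subset_iff intro: vgraph_subset\<close>)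
      show "(\<lambda>n. g2 n (fst (x, F x))) \<longlonglongrightarrow> snd (x, F x)"
        using tendsto_uniform_limitI[OF ul, of x] x by auto
      show "rapid e (ball (fst (x, F x)) s) (\<lambda>n x. g1 n x - g2 n x - e n)"
        using rapid_subset[OF rap2 s(2)] by simp
    qed
  qed (use F in \<open>auto simp: a_def b_def\<close>)
qed

end

lemma dist_swap: "dist (prod.swap p) (prod.swap q) = dist p q"
  by (simp add: dist_prod_def add.commute)

context shifted_lamination
begin

text \<open>Passing to inverse functions turns f1 = f2 + e into h1 (y) = h2 (y - e), again up to
  rapidly small terms, and \<open>shifted_graphs_deriv_nonzero\<close> applies. The ball obtained
  depends on the chart radius \<open>r\<close> alone, however small the disc on which osculation is
  given.\<close>

lemma osculating_hgraph_deriv: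
  assumes osc: "osculating p" and ch: "vchart (prod.swap ` X) B0 (prod.swap p) r" and r: "0 < r"
    and h: "vgraph (prod.swap ` X) h (snd p) r" "h (snd p) = fst p" and y: "y \<in> ball (snd p) (r/4)"
  shows "deriv h y \<noteq> 0"
proof -
  obtain \<rho> B f1 f2 where \<rho>: "0 < \<rho>" and ev: "\<forall>\<^sub>F n in sequentially. vgraph X (f1 n) (fst p) \<rho> \<and> vgraph X (f2 n) (fst p) \<rho> \<and>
        (\<forall>x\<in>ball (fst p) \<rho>. cmod (f1 n x) \<le> B \<and> cmod (f2 n x) \<le> B)"
     and lim2: "(\<lambda>n. f2 n (fst p)) \<longlonglongrightarrow> snd p" and rap: "rapid e (ball (fst p) \<rho>) (\<lambda>n x. f1 n x - f2 n x - e n)"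
    using osc unfolding osculating_def by blast
  define a b where "a = fst p" and "b = snd p"
  have p: "p = (a, b)" by (simp add: a_def b_def)
  note lim1 = rapid_center_limit[OF rap \<rho> lim2]
  define B1 where "B1 = \<bar>B\<bar> + 1"
  define M1 where "M1 = \<bar>cmod a + B0\<bar> + 1"
  have B1: "B1 > 0" "B \<le> B1" and M1: "M1 > 0" "cmod a + B0 \<le> M1" by (auto simp: B1_def M1_def)
  have chart: "\<exists>h. vgraph (prod.swap ` X) h b r \<and> (\<forall>y\<in>ball b r. cmod (h y) \<le> M1) \<and> h y = a"
    if "(a, y) \<in> X" "dist y b < r" for y
  proof -
    have "(y, a) \<in> prod.swap ` X \<inter> ball (prod.swap p) r" using that by (auto simp: p dist_Pair_Pair dist_commute)
    from ch[unfolded vchart_def, rule_format, OF this] obtain g where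
      g: "vgraph (prod.swap ` X) g b r" "\<forall>x\<in>ball b r. cmod (g x - a) \<le> B0" "g y = a" by (auto simp: a_def b_def)
    have "cmod (g x) \<le> M1" if "x \<in> ball b r" for x
      using bounded_of_vchart[of g x a B0] g(2) that M1(2) by force
    then show ?thesis using g by blast
  qed
  have pX: "(a, b) \<in> X" using osculating_in[OF osc] p by simp
  obtain h' where h': "vgraph (prod.swap ` X) h' b r" "\<forall>y\<in>ball b r. cmod (h' y) \<le> M1" "h' b = a"
    using chart[OF pX] r by auto
  have hh': "h y = h' y" if "y \<in> ball b r" for y
    using uniqH[OF h(1)[folded b_def] h'(1), of b y] that r h(2) h'(3) by (simp add: a_def b_def)
  have hb: "cmod (h y) \<le> M1" if "y \<in> ball b r" for y using h'(2) hh' that by auto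
  define L1 where "L1 = 2 * B1 / (\<rho> - \<rho>/2)"
  define L2 where "L2 = 2 * M1 / (r - r/2)"
  have L: "L1 > 0" "L2 > 0" using B1 M1 \<rho> r by (auto simp: L1_def L2_def)
  \<comment> \<open>\<open>L1\<close> and \<open>L2\<close> are Lipschitz constants of the graphs
    over the first and the second coordinate. \<open>\<rho>'\<close> lets \<open>f\<close> map its
    disc into radius r/8 + r/8 around \<open>b\<close>, and \<open>\<sigma>\<close> lets the inverse
    graph map \<open>ball b \<sigma>\<close> back into \<open>ball a \<rho>'\<close>.\<close>
  define \<rho>' where "\<rho>' = min (\<rho>/2) (r / (8 * L1))"
  have \<rho>': "0 < \<rho>'" "\<rho>' \<le> \<rho>/2" "L1 * \<rho>' \<le> r/8"
    using \<rho> r L by (auto simp: \<rho>'_def min_def field_simps)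
  define \<sigma> where "\<sigma> = min (r/8) (\<rho>' / (4 * L2))"
  have \<sigma>: "0 < \<sigma>" "\<sigma> \<le> r/8" "L2 * (2 * \<sigma>) \<le> \<rho>'/2"
    using \<rho>' r L by (auto simp: \<sigma>_def min_def field_simps)
  have inv: "(\<forall>x\<in>ball a \<rho>'. f x \<in> ball b (r/4) \<and> g (f x) = x) \<and> (\<forall>y\<in>ball b \<sigma>. g y \<in> ball a \<rho>' \<and> f (g y) = y)"
    if f: "vgraph X f a \<rho>" "\<forall>x\<in>ball a \<rho>. cmod (f x) \<le> B1" "dist (f a) b < \<sigma>"
      and g: "vgraph (prod.swap ` X) g b r" "\<forall>y\<in>ball b r. cmod (g y) \<le> M1" "g (f a) = a" for f g
  proof -
    have holf: "f holomorphic_on ball a \<rho>" and holg: "g holomorphic_on ball b r" using f g by (auto simp: vgraph_def)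
    have fx: "f x \<in> ball b (r/4)" if x: "x \<in> ball a \<rho>'" for x
    proof -
      have "cmod (f x - f a) \<le> L1 * cmod (x - a)"
        unfolding L1_def by (rule bounded_holomorphic_Lipschitz[OF holf]) (use f \<rho>' \<rho> x in auto)
      also have "\<dots> \<le> L1 * \<rho>'" using x L by (intro mult_left_mono) (auto simp: dist_norm norm_minus_commute)
      finally have "dist (f x) (f a) \<le> r/8" using \<rho>'(3) by (simp add: dist_norm)
      then show ?thesis using f(3) \<sigma>(2) dist_triangle[of "f x" b "f a"] by (simp add: dist_commute)
    qed
    have fab: "f a \<in> ball b \<sigma>" using f(3) by (simp add: dist_commute)
    have gy: "g y \<in> ball a \<rho>'" if y: "y \<in> ball b \<sigma>" for y
    proof -
      have "cmod (g y - g (f a)) \<le> L2 * cmod (y - f a)"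
        unfolding L2_def by (rule bounded_holomorphic_Lipschitz[OF holg]) (use g r y fab \<sigma> in auto)
      also have "cmod (y - f a) \<le> 2 * \<sigma>"
        using y fab dist_triangle[of y "f a" b] by (simp add: dist_norm norm_minus_commute)
      finally have "cmod (g y - a) \<le> \<rho>'/2" using \<sigma>(3) L g(3) by (simp add: mult_left_mono)
      then show ?thesis using \<rho>'(1) by (simp add: dist_norm norm_minus_commute)
    qed
    have gsub: "vgraph (prod.swap ` X) g (f a) (r/2)"
      by (rule vgraph_subset[OF g(1)]) (use fab \<sigma> r in \<open>auto intro!: ball_subset_ballI\<close>)
    \<comment> \<open>The inverse relations are known only as germs; the identity theorem extends
      them to the discs \<open>ball a \<rho>'\<close> and \<open>ball b \<sigma>\<close>, whose
      sizes are the same for all graphs considered.\<close>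
    obtain d where d: "d > 0" "\<And>x. x \<in> ball a d \<Longrightarrow> g (f x) = x"
      using vgraph_hgraph_inverse[OF lam nl f(1) \<rho> gsub _ refl g(3)] r by auto
    have fsw: "vgraph (prod.swap ` prod.swap ` X) f a \<rho>" using f(1) by simp
    have "\<exists>d>0. \<forall>y\<in>ball (f a) d. f (g y) = y"
      by (rule vgraph_hgraph_inverse[OF lamination_swap[OF lam] no_line_swap[OF nl] gsub _ fsw \<rho> g(3)]) (use r in auto)
    then obtain d' where d': "d' > 0" "\<And>y. y \<in> ball (f a) d' \<Longrightarrow> f (g y) = y" by blast
    have "g (f x) = x" if x: "x \<in> ball a \<rho>'" for x
    proof (rule holomorphic_eqI_ball[of "\<lambda>x. g (f x)" a \<rho>' "\<lambda>x. x" a d x])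
      have "(g \<circ> f) holomorphic_on ball a \<rho>'"
        by (rule holomorphic_on_compose_gen[OF holomorphic_on_subset[OF holf] holg]) (use fx r \<rho>' \<rho> in force)+
      then show "(\<lambda>x. g (f x)) holomorphic_on ball a \<rho>'" by (simp add: o_def)
    qed (use d x \<rho>' in auto)
    moreover have "f (g y) = y" if y: "y \<in> ball b \<sigma>" for y
    proof (rule holomorphic_eqI_ball[of "\<lambda>y. f (g y)" b \<sigma> "\<lambda>y. y" "f a" d' y])
      have "(f \<circ> g) holomorphic_on ball b \<sigma>"
        by (rule holomorphic_on_compose_gen[OF holomorphic_on_subset[OF holg] holf]) (use gy r \<sigma> \<rho>' \<rho> in force)+
      then show "(\<lambda>y. f (g y)) holomorphic_on ball b \<sigma>" by (simp add: o_def)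
    qed (use d' y fab in auto)
    ultimately show ?thesis using fx gy by blast
  qed
  define good where "good = (\<lambda>(f :: nat \<Rightarrow> complex \<Rightarrow> complex) n h. vgraph (prod.swap ` X) h b r \<and> (\<forall>y\<in>ball b r. cmod (h y) \<le> M1) \<and> h (f n a) = a)"
  define h1 where "h1 = (\<lambda>n. SOME h. good f1 n h)"
  define h2 where "h2 = (\<lambda>n. SOME h. good f2 n h)"
  have ev2: "\<forall>\<^sub>F n in sequentially. good f1 n (h1 n) \<and> good f2 n (h2 n) \<and> dist (f1 n a) b < \<sigma> \<and> dist (f2 n a) b < \<sigma> \<and>
      vgraph X (f1 n) a \<rho> \<and> vgraph X (f2 n) a \<rho> \<and> (\<forall>x\<in>ball a \<rho>. cmod (f1 n x) \<le> B1) \<and> (\<forall>x\<in>ball a \<rho>. cmod (f2 n x) \<le> B1)"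
    using ev tendstoD[OF lim1 \<sigma>(1)] tendstoD[OF lim2 \<sigma>(1)]
  proof eventually_elim
    case (elim n)
    have "(a, f1 n a) \<in> X" "(a, f2 n a) \<in> X" using elim(1) \<rho> by (auto simp: vgraph_def a_def)
    moreover have "dist (f1 n a) b < r" "dist (f2 n a) b < r" using elim(2,3) \<sigma>(2) r by (simp_all add: a_def b_def)
    ultimately have "\<exists>h. good f1 n h" "\<exists>h. good f2 n h" unfolding good_def using chart by blast+
    then have "good f1 n (h1 n)" "good f2 n (h2 n)" unfolding h1_def h2_def by (metis someI_ex)+
    moreover have "cmod (f1 n x) \<le> B1" "cmod (f2 n x) \<le> B1" if "x \<in> ball a \<rho>" for x
      using elim(1) that B1(2) unfolding a_def by force+
    ultimately show ?case using elim by (simp add: a_def b_def)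
  qed
  have rapw: "rapid e (ball b \<sigma>) (\<lambda>n y. h1 n y - h2 n (y - e n))"
    unfolding rapid_def
  proof
    fix N
    have "\<forall>\<^sub>F n in sequentially. \<forall>x\<in>ball a \<rho>. cmod (f1 n x - f2 n x - e n) \<le> cmod (e n) ^ (Suc N)"
      using rap unfolding rapid_def a_def by blast
    moreover have "\<forall>\<^sub>F n in sequentially. L2 * cmod (e n) \<le> 1" "\<forall>\<^sub>F n in sequentially. 1 * cmod (e n) \<le> r/9"
      by (rule eventually_mult_norm_le[OF e(1)], use r in simp)+
    ultimately show "\<forall>\<^sub>F n in sequentially. \<forall>y\<in>ball b \<sigma>. cmod (h1 n y - h2 n (y - e n)) \<le> cmod (e n) ^ N"
      using ev2
    proof eventually_elim
      case (elim n)
      note i1 = inv[of "f1 n" "h1 n"] and i2 = inv[of "f2 n" "h2 n"]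
      show ?case
      proof
        fix y assume y: "y \<in> ball b \<sigma>"
        \<comment> \<open>For this \<open>x\<close> one has f1 x = y and h2 (f2 x) = x, so the
          difference of the inverse graphs is at most \<open>L2\<close> times |f1 x - f2 x - e|. The
          extra power in \<open>Suc N\<close> absorbs \<open>L2\<close>.\<close>
        define x where "x = h1 n y"
        have x: "x \<in> ball a \<rho>'" "f1 n x = y" using i1 elim(4) y unfolding good_def x_def by blast+
        have x2: "f2 n x \<in> ball b (r/4)" "h2 n (f2 n x) = x" using i2 elim(4) x(1) unfolding good_def by blast+
        have yb: "y - e n \<in> ball b (r/2)"
        proof -
          have "dist b (y - e n) \<le> dist b y + cmod (e n)" using norm_triangle_ineq[of "b - y" "e n"] by (simp add: dist_norm algebra_simps)
          then show ?thesis using y \<sigma>(2) elim(3) r by simp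
        qed
        have "cmod (h2 n (f2 n x) - h2 n (y - e n)) \<le> L2 * cmod (f2 n x - (y - e n))"
          unfolding L2_def by (rule bounded_holomorphic_Lipschitz[of _ b])
            (use elim(4) x2(1) yb r in \<open>auto simp: good_def vgraph_def\<close>)
        also have "cmod (f2 n x - (y - e n)) = cmod (f1 n x - f2 n x - e n)"
          using x(2) by (simp add: norm_minus_commute algebra_simps)
        also have "L2 * \<dots> \<le> L2 * cmod (e n) ^ Suc N"
          using elim(1) x(1) \<rho>'(2) \<rho> L by (intro mult_left_mono) auto
        also have "\<dots> = (L2 * cmod (e n)) * cmod (e n) ^ N" by simp
        also have "\<dots> \<le> 1 * cmod (e n) ^ N" using elim(2) by (intro mult_right_mono) auto
        finally show "cmod (h1 n y - h2 n (y - e n)) \<le> cmod (e n) ^ N" using x2(2) by (simp add: x_def)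
      qed
    qed
  qed
  show ?thesis
  proof (rule shifted_graphs_deriv_nonzero[OF e r \<sigma>(1), where B = M1])
    show "h holomorphic_on ball b r" using h(1) by (simp add: vgraph_def b_def)
    show "\<not> deriv h constant_on ball b r"
      using affine_vgraph_imp_line[OF h(1) r] no_line_swap[OF nl] by (auto simp: b_def)
    show "\<forall>\<^sub>F n in sequentially. h1 n holomorphic_on ball b r \<and> h2 n holomorphic_on ball b r \<and>
      (\<forall>w\<in>ball b r. cmod (h1 n w) \<le> M1 \<and> cmod (h2 n w) \<le> M1) \<and>
      ((\<forall>w\<in>ball b r. h1 n w \<noteq> h2 n w) \<or> (\<forall>w\<in>ball b r. h1 n w = h2 n w)) \<and>
      ((\<forall>w\<in>ball b r. h2 n w \<noteq> h w) \<or> (\<forall>w\<in>ball b r. h2 n w = h w))"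
      using ev2
    proof eventually_elim
      case (elim n)
      have g: "good f1 n (h1 n)" "good f2 n (h2 n)" using elim by auto
      have v: "vgraph (prod.swap ` X) (h1 n) b r" "vgraph (prod.swap ` X) (h2 n) b r" using g by (auto simp: good_def)
      show ?case using g dichH[OF v] dichH[OF v(2) h(1)[folded b_def]] v by (simp add: good_def vgraph_def)
    qed
    show "(\<lambda>n. h2 n b) \<longlonglongrightarrow> h b"
    proof -
      have *: "\<forall>\<^sub>F n in sequentially. norm (h2 n b - a) \<le> L2 * norm (b - f2 n a)"
        using ev2
      proof eventually_elim
        case (elim n)
        have g: "good f2 n (h2 n)" using elim by auto
        have "cmod (h2 n b - h2 n (f2 n a)) \<le> L2 * cmod (b - f2 n a)"
          unfolding L2_def by (rule bounded_holomorphic_Lipschitz[of _ b])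
            (use g elim \<sigma> r in \<open>auto simp: good_def vgraph_def dist_commute\<close>)
        then show ?case using g by (simp add: good_def)
      qed
      have "(\<lambda>n. L2 * norm (b - f2 n a)) \<longlonglongrightarrow> L2 * norm (b - b)"
        using lim2 unfolding a_def b_def by (intro tendsto_intros)
      then have "(\<lambda>n. L2 * norm (b - f2 n a)) \<longlonglongrightarrow> 0" by simp
      from Lim_null_comparison[OF * this] have "(\<lambda>n. h2 n b - a) \<longlonglongrightarrow> 0" .
      then show ?thesis using h(2) by (simp add: LIM_zero_iff a_def b_def)
    qed
  qed (use hb rapw y in \<open>auto simp: b_def\<close>)
qed

text \<open>Excluding \<open>p\<close> alone would not serve a compactness argument, which needs a
  neighbourhood. If osculating points accumulated at \<open>p\<close>, the leaves through them would
  have nonvanishing derivatives on a common disc around \<open>snd p\<close>; these leaves converge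
  to \<open>h\<close>, and Hurwitz's theorem contradicts \<open>deriv h (snd p) = 0\<close>.\<close>

lemma no_osculating_near_vertical:
  assumes ch: "vchart (prod.swap ` X) 1 (prod.swap p) r" and r: "0 < r"
    and h: "vgraph (prod.swap ` X) h (snd p) r" "\<And>y. y \<in> ball (snd p) r \<Longrightarrow> cmod (h y - fst p) \<le> 1"
      "h (snd p) = fst p" "deriv h (snd p) = 0"
  shows "\<exists>\<delta>>0. \<forall>q\<in>ball p \<delta>. \<not> osculating q"
proof (rule ccontr)
  assume neg: "\<not> ?thesis"
  \<comment> \<open>Charts recentred at \<open>q k\<close> have radius \<open>r/2\<close>, so
    derivatives are nonzero within \<open>r/8\<close> of \<open>snd (q k)\<close>. As
    \<open>q k\<close> is within \<open>r/16\<close> of \<open>p\<close>, the disc of radius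
    \<open>r/16\<close> around \<open>snd p\<close> is covered for every \<open>k\<close>.\<close>
  define c where "c = r/16"
  have "\<exists>q. q \<in> ball p (c / Suc k) \<and> osculating q" for k
  proof -
    have "0 < c / Suc k" using r by (simp add: c_def)
    then show ?thesis using neg by blast
  qed
  then obtain q where q: "\<And>k. q k \<in> ball p (c / Suc k)" "\<And>k. osculating (q k)" by metis
  have lim0: "(\<lambda>k. c / real (Suc k)) \<longlonglongrightarrow> 0" by (rule LIMSEQ_Suc[OF lim_const_over_n])
  have "\<forall>\<^sub>F k in sequentially. norm (q k - p) \<le> c / real (Suc k)"
  proof (intro always_eventually allI)
    fix k show "norm (q k - p) \<le> c / real (Suc k)" using q(1)[of k] by (simp add: dist_norm norm_minus_commute)
  qed
  from Lim_null_comparison[OF this lim0] have "(\<lambda>k. q k - p) \<longlonglongrightarrow> 0" .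
  then have qlim: "q \<longlonglongrightarrow> p" by (simp add: LIM_zero_iff)
  have qc: "dist p (q k) < c" for k
  proof -
    have "c / Suc k \<le> c / 1" using r by (intro divide_left_mono) (auto simp: c_def)
    then show ?thesis using q(1)[of k] by simp
  qed
  define B where "B = cmod (fst p) + 1"
  have qd: "dist (snd p) (snd (q k)) < c" for k using le_less_trans[OF dist_snd_le qc] .
  have "\<exists>g. vgraph (prod.swap ` X) g (snd p) r \<and> (\<forall>y\<in>ball (snd p) r. cmod (g y) \<le> B) \<and> g (snd (q k)) = fst (q k)" for k
  proof -
    have "prod.swap (q k) \<in> prod.swap ` X \<inter> ball (prod.swap p) r"
      using osculating_in[OF q(2)] qc[of k] r dist_swap[of p "q k"] by (simp add: c_def del: swap_simp)
    from ch[unfolded vchart_def, rule_format, OF this] obtain g where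
      g: "vgraph (prod.swap ` X) g (snd p) r" "\<forall>x\<in>ball (snd p) r. cmod (g x - fst p) \<le> 1" "g (snd (q k)) = fst (q k)" by auto
    then show ?thesis using bounded_of_vchart[of g _ "fst p" 1] unfolding B_def by blast
  qed
  then obtain g where g: "\<And>k. vgraph (prod.swap ` X) (g k) (snd p) r" "\<And>k y. y \<in> ball (snd p) r \<Longrightarrow> cmod (g k y) \<le> B"
    "\<And>k. g k (snd (q k)) = fst (q k)" by metis
  have hB: "cmod (h y) \<le> B" if "y \<in> ball (snd p) r" for y
    using bounded_of_vchart[of h y, OF h(2)[OF that]] by (simp add: B_def)
  have holg: "g k holomorphic_on ball (snd p) r" for k using g(1) by (simp add: vgraph_def)
  have holh: "h holomorphic_on ball (snd p) r" using h(1) by (simp add: vgraph_def)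
  define S where "S = ball (snd p) c"
  have S: "S \<subseteq> ball (snd p) r" "S \<subseteq> ball (snd p) (r/4)" "snd p \<in> S" using r by (auto simp: S_def c_def)
  have nz: "deriv (g k) y \<noteq> 0" if y: "y \<in> S" for k y
  proof (rule osculating_hgraph_deriv[OF q(2)[of k], of "1 + r" "r/2"])
    show "vchart (prod.swap ` X) (1 + r) (prod.swap (q k)) (r/2)"
      by (rule vchart_shift[OF ch]) (use qc[of k] r in \<open>simp add: dist_swap c_def\<close>)
    show "vgraph (prod.swap ` X) (g k) (snd (q k)) (r/2)"
      by (rule vgraph_subset[OF g(1)]) (use qd[of k] r in \<open>auto simp: c_def intro!: ball_subset_ballI\<close>)
    have "dist (snd (q k)) y \<le> dist (snd (q k)) (snd p) + dist (snd p) y" by (rule dist_triangle)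
    then show "y \<in> ball (snd (q k)) (r/2/4)" using qd[of k] y by (simp add: S_def c_def dist_commute)
  qed (use g(3) r in auto)
  define L where "L = 2 * B / (r - r/2)"
  have glim: "(\<lambda>k. g k (snd p)) \<longlonglongrightarrow> h (snd p)"
  proof -
    have *: "norm (g k (snd p) - fst (q k)) \<le> L * norm (snd p - snd (q k))" for k
      using bounded_holomorphic_Lipschitz[OF holg[of k] g(2), of "r/2" "snd p" "snd (q k)"] r qd[of k] g(3)[of k]
      by (simp add: L_def c_def)
    have **: "(\<lambda>k. L * norm (snd p - snd (q k))) \<longlonglongrightarrow> L * norm (snd p - snd p)"
      by (intro tendsto_intros qlim)
    have "(\<lambda>k. g k (snd p) - fst (q k)) \<longlonglongrightarrow> 0"
      by (rule Lim_null_comparison[OF always_eventually]) (use * ** in auto)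
    from tendsto_add[OF this tendsto_fst[OF qlim]] show ?thesis using h(3) by simp
  qed
  have ul: "uniform_limit (ball (snd p) (r/2)) g h sequentially"
  proof (rule uniform_limit_on_subset[OF Harnack_uniform_limit[where F = g, OF holh hB r _ glim]])
    show "\<forall>\<^sub>F n in sequentially. g n holomorphic_on ball (snd p) r \<and> (\<forall>w\<in>ball (snd p) r. cmod (g n w) \<le> B) \<and>
      ((\<forall>w\<in>ball (snd p) r. g n w \<noteq> h w) \<or> (\<forall>w\<in>ball (snd p) r. g n w = h w))"
      using holg g(2) dichH[OF g(1) h(1)] by (intro always_eventually) auto
  qed auto
  have uld: "uniform_limit (ball (snd p) (r/4)) (\<lambda>k. deriv (g k)) (deriv h) sequentially"
    by (rule uniform_limit_deriv[OF _ _ ul])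
      (use r in \<open>auto intro!: always_eventually holomorphic_on_subset[OF holh] holomorphic_on_subset[OF holg]\<close>)
  have "deriv h (snd p) \<noteq> 0"
  proof (rule Hurwitz_no_zeros[of S "\<lambda>k. deriv (g k)" "deriv h"])
    show "deriv (g k) holomorphic_on S" for k
      using holg S(1) by (intro holomorphic_deriv holomorphic_on_subset[OF holg]) (auto simp: S_def)
    show "deriv h holomorphic_on S"
      using S(1) by (intro holomorphic_deriv holomorphic_on_subset[OF holh]) (auto simp: S_def)
    show "uniform_limit K (\<lambda>k. deriv (g k)) (deriv h) sequentially" if "K \<subseteq> S" for K
      using uniform_limit_on_subset[OF uld] that S(2) by blast
    show "\<not> deriv h constant_on S"
    proof
      assume "deriv h constant_on S"
      moreover have "vgraph (prod.swap ` X) h (snd p) c" using vgraph_subset[OF h(1) S(1)[unfolded S_def]] .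
      ultimately show False using affine_vgraph_imp_line[of _ h "snd p" c] no_line_swap[OF nl] r by (auto simp: S_def c_def)
    qed
  qed (use nz S in \<open>auto simp: S_def\<close>)
  then show False using h(4) by simp
qed

text \<open>Around a vertical tangency the local claim holds vacuously, no point nearby being
  osculating; elsewhere nearby points inherit a chart of half the size. A finite cover of the part
  of \<open>X\<close> in a compact set meeting every lattice orbit makes radius and bound
  uniform.\<close>

lemma osculating_uniform_chart:
  obtains r B where "0 < r" "\<And>p. osculating p \<Longrightarrow> vchart X B p r"
proof -
  have "\<exists>s B. 0 < s \<and> (\<forall>q\<in>ball p s. osculating q \<longrightarrow> vchart X B q s)" if p: "p \<in> X" for p
    using lamination_chart[OF lam p]
  proof (elim disjE exE conjE)
    fix r assume r: "0 < r" "vchart X 1 p r"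
    have "vchart X (1 + r) q (r/2)" if "q \<in> ball p (r/2)" for q using vchart_shift[OF r(2), of q] that by simp
    then show ?thesis using r(1) by (intro exI[of _ "r/2"] exI[of _ "1 + r"]) auto
  next
    fix r h assume "0 < r" "vchart (prod.swap ` X) 1 (prod.swap p) r" "vgraph (prod.swap ` X) h (snd p) r"
      "\<forall>y\<in>ball (snd p) r. cmod (h y - fst p) \<le> 1" "h (snd p) = fst p" "deriv h (snd p) = 0"
    then have "\<exists>\<delta>>0. \<forall>q\<in>ball p \<delta>. \<not> osculating q" by (intro no_osculating_near_vertical[of p r h]) auto
    then show ?thesis by blast
  qed
  then obtain s B where sB: "\<And>p. p \<in> X \<Longrightarrow> 0 < s p" "\<And>p q. p \<in> X \<Longrightarrow> q \<in> ball p (s p) \<Longrightarrow> osculating q \<Longrightarrow> vchart X (B p) q (s p)"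
    by metis
  obtain K where K: "compact K" "\<And>x. \<exists>l\<in>\<Lambda>. - l \<in> \<Lambda> \<and> x - l \<in> K" using lattice_cocompact(1)[OF lat] by blast
  have "compact (X \<inter> K)" using lam K(1) by (auto simp: lamination_def intro: closed_Int_compact)
  then obtain D where D: "D \<subseteq> X \<inter> K" "finite D" "X \<inter> K \<subseteq> (\<Union>p\<in>D. ball p (s p))"
  proof (rule compactE_image)
    show "X \<inter> K \<subseteq> (\<Union>p\<in>X \<inter> K. ball p (s p))" using sB(1) by force
  qed auto
  define r where "r = Min (insert 1 (s ` D))"
  define B' where "B' = Max (insert 0 (B ` D))"
  have r: "0 < r" "\<And>p. p \<in> D \<Longrightarrow> r \<le> s p" using D sB(1) by (auto simp: r_def)
  have B': "B p \<le> B'" if "p \<in> D" for p using D that by (auto simp: B'_def)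
  show thesis
  proof (rule that[of r B'])
    fix p assume osc: "osculating p"
    obtain l where l: "l \<in> \<Lambda>" "- l \<in> \<Lambda>" "p - l \<in> K" using K(2) by blast
    have osc': "osculating (p - l)" using osculating_translate[of "- l" p] l osc by simp
    have "p - l \<in> X" using osculating_in[OF osc'] .
    then obtain q where q: "q \<in> D" "p - l \<in> ball q (s q)" using D(3) l(3) by blast
    have "vchart X (B q) (p - l) (s q)" using sB(2)[OF _ q(2) osc'] q(1) D(1) by blast
    then have "vchart X B' (p - l) r" using r(2)[OF q(1)] B'[OF q(1)] by (rule vchart_mono)
    from vchart_translate[OF lamination_translate[OF lam l(1,2)] this] show "vchart X B' p r" by simp
  qed (rule r)
qed

text \<open>Analytic continuation with a uniform step would produce an entire function with bounded
  derivative, hence a line in \<open>X\<close>.\<close>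

lemma not_osculating: "\<not> osculating p"
proof
  assume osc: "osculating p"
  obtain r B where r: "0 < r" and ch: "\<And>p. osculating p \<Longrightarrow> vchart X B p r" by (rule osculating_uniform_chart) blast
  define s where "s = r/2"
  have s: "0 < s" using r by (simp add: s_def)
  define P where "P = (\<lambda>p F. vgraph X F (fst p) r \<and> F (fst p) = snd p \<and> (\<forall>x\<in>ball (fst p) r. cmod (F x - snd p) \<le> B) \<and>
      (\<forall>x\<in>ball (fst p) s. osculating (x, F x)))"
  define E where "E = (\<lambda>p. SOME F. P p F)"
  have "P p (E p)" if "osculating p" for p
  proof -
    have "\<exists>F. P p F" unfolding P_def by (rule osculating_extend[OF that ch[OF that] r]) (auto simp: s_def)
    then show ?thesis unfolding E_def by (rule someI_ex)
  qed
  then have E: "\<And>p. osculating p \<Longrightarrow> vgraph X (E p) (fst p) r" "\<And>p. osculating p \<Longrightarrow> E p (fst p) = snd p"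
    "\<And>p x. osculating p \<Longrightarrow> x \<in> ball (fst p) r \<Longrightarrow> cmod (E p x - snd p) \<le> B"
    "\<And>p x. osculating p \<Longrightarrow> x \<in> ball (fst p) s \<Longrightarrow> osculating (x, E p x)"
    unfolding P_def by blast+
  have Ehol: "E p holomorphic_on ball (fst p) s" if "osculating p" for p
    using E(1)[OF that] r by (auto simp: vgraph_def s_def intro: holomorphic_on_subset)
  have EX: "(x, E p x) \<in> X" if "osculating p" "x \<in> ball (fst p) s" for p x
    using E(4)[OF that] osculating_in by blast
  define a b where "a = fst p" and "b = snd p"
  \<comment> \<open>The invariant of the continuation: all points of the extended graph are
    osculating, so that each of them carries a chart for the next step.\<close>
  define ext where "ext = (\<lambda>R F. F holomorphic_on ball a R \<and> F a = b \<and> (\<forall>x\<in>ball a R. osculating (x, F x)))"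
  have near: "\<forall>\<^sub>F y in nhds c. F y = E (c, F c) y" if F: "ext R F" and c: "c \<in> ball a R" for R F c
  proof -
    have osc: "osculating (c, F c)" using F c by (simp add: ext_def)
    define t where "t = min s (R - dist a c)"
    have t: "0 < t" "t \<le> s" "ball c t \<subseteq> ball a R" using s c by (auto simp: t_def intro!: ball_subset_ballI)
    have "vgraph X F c t" unfolding vgraph_def
    proof
      show "F holomorphic_on ball c t" using F t(3) by (auto simp: ext_def intro: holomorphic_on_subset)
      show "\<forall>x\<in>ball c t. (x, F x) \<in> X" using F t(3) osculating_in unfolding ext_def by blast
    qed
    moreover have "vgraph X (E (c, F c)) c t"
      by (rule vgraph_subset[OF E(1)[OF osc]]) (use t r in \<open>auto simp: s_def\<close>)
    ultimately have eq: "F y = E (c, F c) y" if "y \<in> ball c t" for y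
      using uniq[of F c t "E (c, F c)" c y] E(2)[OF osc] t(1) that by simp
    have "\<forall>\<^sub>F y in nhds c. y \<in> ball c t" by (rule eventually_nhds_in_open) (use t(1) in auto)
    then show ?thesis by (rule eventually_mono) (rule eq)
  qed
  \<comment> \<open>A new point of the larger disc is within \<open>3*s/4\<close> of a centre at
    distance \<open>R - s/4\<close> from \<open>a\<close>, hence in a disc of radius
    \<open>s\<close> around a point where \<open>F\<close> is defined. The gain \<open>s/2\<close>
    does not depend on \<open>R\<close>.\<close>
  have step: "\<exists>F'. ext (R + s/2) F'" if F: "ext R F" and R: "s \<le> R" for R F
  proof -
    define C where "C = (\<lambda>x. SOME c. c \<in> ball a R \<and> x \<in> ball c s)"
    define F' where "F' = (\<lambda>x. if x \<in> ball a R then F x else E (C x, F (C x)) x)"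
    have C: "C x \<in> ball a R \<and> x \<in> ball (C x) s" if x: "x \<in> ball a (R + s/2)" for x
    proof -
      have "\<exists>c. c \<in> ball a R \<and> x \<in> ball c s"
      proof (cases "x \<in> ball a R")
        case True
        then show ?thesis using s by (intro exI[of _ x]) auto
      next
        case False
        define d where "d = dist a x"
        have d: "R \<le> d" "d < R + s/2" "0 < d" using False x s R by (auto simp: d_def)
        define c where "c = a + of_real ((R - s/4) / d) * (x - a)"
        have xa: "cmod (x - a) = d" by (simp add: d_def dist_norm norm_minus_commute)
        have "dist a c = cmod (of_real ((R - s/4) / d) * (x - a))" by (simp add: c_def dist_norm)
        also have "\<dots> = R - s/4" using xa d R s by (simp add: norm_mult del: of_real_divide of_real_diff)
        finally have cR: "c \<in> ball a R" using s by simp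
        have "x - c = of_real (1 - (R - s/4) / d) * (x - a)" by (simp add: c_def algebra_simps)
        then have "dist c x = \<bar>1 - (R - s/4) / d\<bar> * d"
          using xa by (simp add: dist_norm norm_minus_commute[of c] norm_mult del: of_real_divide of_real_diff)
        also have "\<dots> = \<bar>(1 - (R - s/4) / d) * d\<bar>" using d by (simp add: abs_mult)
        also have "(1 - (R - s/4) / d) * d = d - (R - s/4)"
        proof -
          have "(1 - u / d) * d = d - u" for u using d(3) by (simp add: left_diff_distrib)
          then show ?thesis .
        qed
        finally have "dist c x = d - (R - s/4)" using d s by simp
        then have "x \<in> ball c s" using d s by simp
        with cR show ?thesis by blast
      qed
      then show ?thesis unfolding C_def by (rule someI_ex)
    qed
    \<comment> \<open>Independence of the centre chosen. Two discs of radius \<open>s\<close> with a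
      common point have centres less than \<open>2*s\<close> apart, so the midpoint lies in both
      discs and, by convexity, in \<open>ball a R\<close>, where the two local graphs agree with
      \<open>F\<close>.\<close>
    have key: "F' x = E (c, F c) x" if c: "c \<in> ball a R" and x: "x \<in> ball c s" "x \<in> ball a (R + s/2)" for c x
    proof (cases "x \<in> ball a R")
      case True
      have osc: "osculating (c, F c)" using F c by (simp add: ext_def)
      have "F x = E (c, F c) x"
      proof (rule holomorphic_eqI[of F "ball a R \<inter> ball c s" "E (c, F c)" c x, OF _ _ _ _ _ near[OF F c]])
        show "F holomorphic_on ball a R \<inter> ball c s" using F by (auto simp: ext_def intro: holomorphic_on_subset)
        show "E (c, F c) holomorphic_on ball a R \<inter> ball c s"
          using Ehol[OF osc] by (auto intro: holomorphic_on_subset)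
        show "connected (ball a R \<inter> ball c s)" by (intro convex_connected convex_Int) auto
      qed (use c x True s in auto)
      then show ?thesis using True by (simp add: F'_def)
    next
      case False
      define c' where "c' = C x"
      have c': "c' \<in> ball a R" "x \<in> ball c' s" using C[OF x(2)] by (auto simp: c'_def)
      have osc: "osculating (c, F c)" "osculating (c', F c')" using F c c' by (auto simp: ext_def)
      define m where "m = midpoint c c'"
      have "m \<in> ball a R" unfolding m_def using c c'(1)
        by (meson convex_ball convex_contains_segment midpoint_in_closed_segment subsetD)
      have dcc: "dist c c' < 2 * s" using x(1) c'(2) dist_triangle[of c c' x] by (simp add: dist_commute)
      have ms: "m \<in> ball c s" "m \<in> ball c' s" unfolding m_def using dcc by (auto simp: dist_midpoint)
      have Fm: "\<forall>\<^sub>F y in nhds m. F y = E (d, F d) y" if d: "d \<in> ball a R" "m \<in> ball d s" for d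
      proof -
        have "osculating (d, F d)" using F d by (simp add: ext_def)
        have "F y = E (d, F d) y" if "y \<in> ball a R \<inter> ball d s" for y
        proof (rule holomorphic_eqI[of F "ball a R \<inter> ball d s" "E (d, F d)" d y, OF _ _ _ _ _ near[OF F d(1)]])
          show "F holomorphic_on ball a R \<inter> ball d s" using F by (auto simp: ext_def intro: holomorphic_on_subset)
          show "E (d, F d) holomorphic_on ball a R \<inter> ball d s"
            using Ehol[OF \<open>osculating (d, F d)\<close>] by (auto intro: holomorphic_on_subset)
          show "connected (ball a R \<inter> ball d s)" by (intro convex_connected convex_Int) auto
        qed (use d that s in auto)
        then show ?thesis unfolding eventually_nhds
          using \<open>m \<in> ball a R\<close> d(2) by (intro exI[of _ "ball a R \<inter> ball d s"]) (auto intro: open_Int)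
      qed
      have "E (c', F c') x = E (c, F c) x"
      proof (rule holomorphic_eqI[of "E (c', F c')" "ball c s \<inter> ball c' s" "E (c, F c)" m x])
        show "E (c', F c') holomorphic_on ball c s \<inter> ball c' s" "E (c, F c) holomorphic_on ball c s \<inter> ball c' s"
          using Ehol[OF osc(1)] Ehol[OF osc(2)] by (auto intro: holomorphic_on_subset)
        show "connected (ball c s \<inter> ball c' s)" by (intro convex_connected convex_Int) auto
        show "m \<in> ball c s \<inter> ball c' s" using ms by blast
        show "\<forall>\<^sub>F y in nhds m. E (c', F c') y = E (c, F c) y"
          using Fm[OF c ms(1)] Fm[OF c'(1) ms(2)] by eventually_elim simp
      qed (use x c' in \<open>auto intro: open_Int\<close>)
      then show ?thesis using False by (simp add: F'_def c'_def)
    qed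
    have "ext (R + s/2) F'" unfolding ext_def
    proof (intro conjI ballI)
      show "F' holomorphic_on ball a (R + s/2)" unfolding holomorphic_on_def
      proof
        fix x assume x: "x \<in> ball a (R + s/2)"
        define c where "c = C x"
        have c: "c \<in> ball a R" "x \<in> ball c s" using C[OF x] by (auto simp: c_def)
        have "osculating (c, F c)" using F c by (simp add: ext_def)
        then have "E (c, F c) field_differentiable at x"
          using Ehol c(2) by (metis fst_conv holomorphic_on_imp_differentiable_at open_ball)
        moreover have "\<forall>\<^sub>F y in nhds x. E (c, F c) y = F' y"
          unfolding eventually_nhds using x c key
          by (intro exI[of _ "ball c s \<inter> ball a (R + s/2)"]) (auto intro: open_Int)
        ultimately have "F' field_differentiable at x"
          unfolding field_differentiable_def using DERIV_cong_ev[OF refl, of "E (c, F c)" F' x] by blast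
        then show "F' field_differentiable at x within ball a (R + s/2)"
          by (rule field_differentiable_at_within)
      qed
      show "F' a = b" using F R s by (simp add: F'_def ext_def)
      show "osculating (x, F' x)" if x: "x \<in> ball a (R + s/2)" for x
      proof -
        have c: "C x \<in> ball a R" "x \<in> ball (C x) s" using C[OF x] by auto
        have "osculating (C x, F (C x))" using F c by (simp add: ext_def)
        from E(4)[OF this, of x] show ?thesis using key[OF c x] c by simp
      qed
    qed
    then show ?thesis by blast
  qed
  have "\<exists>F. ext (s + real k * (s/2)) F" for k
  proof (induction k)
    case 0
    have "ext s (E p)" unfolding ext_def using Ehol[OF osc] E(2,4)[OF osc] by (simp add: a_def b_def)
    then show ?case by auto
  next
    case (Suc k)
    then obtain F where "ext (s + real k * (s/2)) F" by blast
    then have "\<exists>F'. ext (s + real k * (s/2) + s/2) F'" using s by (intro step) auto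
    moreover have "s + real k * (s/2) + s/2 = s + real (Suc k) * (s/2)" by (simp add: field_simps)
    ultimately show ?case by metis
  qed
  then have "\<forall>k. \<exists>F. ext (s + real k * (s/2)) F" by blast
  from choice[OF this] obtain F where F: "\<And>k. ext (s + real k * (s/2)) (F k)" by blast
  \<comment> \<open>Each point of the continued leaf has its own graph of radius \<open>r\<close>
    and height at most \<open>B\<close>, so Cauchy's inequality bounds the slope by one constant
    everywhere.\<close>
  define M where "M = 2 * \<bar>B\<bar> / r"
  have dF: "cmod (deriv (F k) x) \<le> M" if x: "x \<in> ball a (s + real k * (s/2))" for k x
  proof -
    have osc: "osculating (x, F k x)" using F x by (simp add: ext_def)
    have holE: "E (x, F k x) holomorphic_on ball x r" using E(1)[OF osc] by (simp add: vgraph_def)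
    have "cmod (deriv (\<lambda>y. E (x, F k x) y - F k x) x) \<le> 2 * \<bar>B\<bar> / r"
    proof (rule norm_deriv_le_ball)
      show "cmod (E (x, F k x) w - F k x) \<le> \<bar>B\<bar>" if "w \<in> ball x r" for w
        using E(3)[OF osc, of w] that by simp
    qed (use holE r in \<open>auto intro!: holomorphic_intros\<close>)
    moreover have "deriv (\<lambda>y. E (x, F k x) y - F k x) x = deriv (E (x, F k x)) x - deriv (\<lambda>y. F k x) x"
      using holE r by (intro deriv_diff) (auto intro: holomorphic_on_imp_differentiable_at)
    moreover have "deriv (F k) x = deriv (E (x, F k x)) x"
      by (rule deriv_cong_ev[OF near[OF F x] refl])
    ultimately show ?thesis by (simp add: M_def)
  qed
  have Fk0: "F k x = F 0 x" if x: "x \<in> ball a s" for k x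
  proof (rule uniq[of "F k" a s "F 0" a x])
    have sub: "ball a s \<subseteq> ball a (s + real k * (s/2))" for k using s by (intro subset_ball) simp
    show "vgraph X (F k) a s" "vgraph X (F 0) a s"
      using F sub osculating_in unfolding vgraph_def ext_def by (meson holomorphic_on_subset subsetD)+
    show "F k a = F 0 a" using F by (simp add: ext_def)
  qed (use s x in auto)
  have holF: "F k holomorphic_on ball a (s + real k * (s/2))" for k using F by (simp add: ext_def)
  \<comment> \<open>Liouville's argument without gluing the \<open>F k\<close>: they all agree on
    the disc of radius \<open>s\<close>, and Cauchy's inequality for \<open>deriv (F k)\<close>
    bounds the second derivative by a multiple of 1/k.\<close>
  have dd: "deriv (deriv (F 0)) x = 0" if x: "x \<in> ball a s" for x
  proof (rule ccontr)
    assume nz: "deriv (deriv (F 0)) x \<noteq> 0"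
    have bound: "cmod (deriv (deriv (F 0)) x) \<le> 2 * M / (real k * (s/2))" if "k > 0" for k
    proof -
      have ev: "\<forall>\<^sub>F y in nhds x. y \<in> ball a s" using x by (intro eventually_nhds_in_open) auto
      have "\<forall>\<^sub>F y in nhds x. deriv (F 0) y = deriv (F k) y"
        using ev
      proof eventually_elim
        case (elim y)
        have "\<forall>\<^sub>F z in nhds y. z \<in> ball a s" using elim by (intro eventually_nhds_in_open) auto
        then have "\<forall>\<^sub>F z in nhds y. F 0 z = F k z" by eventually_elim (simp add: Fk0[where k = k])
        then show ?case by (rule deriv_cong_ev) simp
      qed
      then have "deriv (deriv (F 0)) x = deriv (deriv (F k)) x" by (rule deriv_cong_ev) simp
      moreover have "cmod (deriv (deriv (F k)) x) \<le> 2 * M / ((s + real k * (s/2)) - s)"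
        by (rule norm_deriv_le_ball'[OF _ dF x]) (use holF s that in \<open>auto intro: holomorphic_deriv\<close>)
      ultimately show ?thesis by simp
    qed
    define D where "D = cmod (deriv (deriv (F 0)) x)"
    have D: "D > 0" using nz by (simp add: D_def)
    obtain k :: nat where k: "4 * M / (s * D) < real k" using reals_Archimedean2 by blast
    have M0: "M \<ge> 0" using r by (simp add: M_def)
    then have "0 \<le> 4 * M / (s * D)" using s D by simp
    then have kp: "k > 0" using k by (cases k) auto
    have "D \<le> 2 * M / (real k * (s/2))" using bound[OF kp] by (simp add: D_def)
    then have "D * (real k * (s/2)) \<le> 2 * M" using kp s by (simp add: pos_le_divide_eq)
    moreover have "4 * M < real k * (s * D)" using k s D by (simp add: pos_divide_less_eq)
    ultimately show False by (simp add: algebra_simps)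
  qed
  have hol0: "F 0 holomorphic_on ball a s" using holF[of 0] by simp
  have "deriv (F 0) constant_on ball a s"
  proof (rule has_field_derivative_0_imp_constant_on)
    show "(deriv (F 0) has_field_derivative 0) (at z)" if "z \<in> ball a s" for z
      using holomorphic_derivI[OF holomorphic_deriv[OF hol0 open_ball] open_ball that] dd[OF that] by simp
  qed auto
  moreover have "vgraph X (F 0) a s" using F[of 0] osculating_in by (auto simp: vgraph_def ext_def)
  ultimately show False using affine_vgraph_imp_line s nl by blast
qed

end

section \<open>Counting intersections\<close>

text \<open>A common Lipschitz bound replaces the moving base point by the centre, where the
  convergence lemmas for leaves ask for a limit.\<close>

lemma center_limit:
  fixes f :: "nat \<Rightarrow> complex \<Rightarrow> complex"
  assumes ev: "\<forall>\<^sub>F n in sequentially. f n holomorphic_on ball c r \<and> (\<forall>w\<in>ball c r. cmod (f n w) \<le> B)"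
    and r: "0 < r" and x: "x \<longlonglongrightarrow> c" and lim: "(\<lambda>n. f n (x n)) \<longlonglongrightarrow> y"
  shows "(\<lambda>n. f n c) \<longlonglongrightarrow> y"
proof -
  have r2: "0 < r/2" using r by simp
  have "\<forall>\<^sub>F n in sequentially. norm (f n c - f n (x n)) \<le> 2 * B / (r - r/2) * norm (c - x n)"
    using ev tendstoD[OF x r2]
  proof eventually_elim
    case (elim n)
    show ?case by (rule bounded_holomorphic_Lipschitz[of _ c]) (use elim r in \<open>auto simp: dist_commute\<close>)
  qed
  moreover have "(\<lambda>n. 2 * B / (r - r/2) * norm (c - x n)) \<longlonglongrightarrow> 2 * B / (r - r/2) * norm (c - c)"
    by (intro tendsto_intros x)
  then have "(\<lambda>n. 2 * B / (r - r/2) * norm (c - x n)) \<longlonglongrightarrow> 0" by simp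
  ultimately have "(\<lambda>n. f n c - f n (x n)) \<longlonglongrightarrow> 0" by (rule Lim_null_comparison)
  from tendsto_add[OF this lim] show ?thesis by simp
qed

text \<open>The intersection is taken in C^2, before projection to the torus. The disc
  \<open>D\<close> is a parameter so that plaques can be shrunk around a given point.\<close>

definition meets :: "(complex \<times> c2 \<Rightarrow> c2) \<Rightarrow> complex set \<Rightarrow> c2 \<Rightarrow> c2 \<Rightarrow> c2 \<Rightarrow> c2 set" where
  "meets \<phi> D e t1 t2 = (\<lambda>z. \<phi> (z, t1)) ` D \<inter> (\<lambda>x. x + e) ` (\<lambda>z. \<phi> (z, t2)) ` D"

lemma meets_mono: "D \<subseteq> D' \<Longrightarrow> meets \<phi> D e t1 t2 \<subseteq> meets \<phi> D' e t1 t2"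
  unfolding meets_def by blast

lemma large_finite_subset:
  assumes "\<not> (finite S \<and> real (card S) \<le> a)"
  shows "\<exists>Z. finite Z \<and> Z \<subseteq> S \<and> a \<le> real (card Z)"
proof (cases "finite S")
  case True
  then show ?thesis using assms by (intro exI[of _ S]) auto
next
  case False
  obtain Z where "finite Z" "card Z = nat \<lceil>a\<rceil>" "Z \<subseteq> S"
    using infinite_arbitrarily_large[OF False] by blast
  moreover have "a \<le> real (nat \<lceil>a\<rceil>)" by (rule real_nat_ceiling_ge)
  ultimately show ?thesis by (intro exI[of _ Z]) auto
qed

text \<open>Otherwise plaques tending to that of \<open>t0\<close> have too many intersections near
  \<open>p\<close> after small shifts. If the plaque is not vertical at \<open>p\<close>, this makes
  \<open>p\<close> osculating. If it is vertical there, nearby plaques are handled over the second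
  coordinate, and the critical point of \<open>h\<close> contradicts
  \<open>shifted_graphs_deriv_nonzero\<close> directly.\<close>

lemma vertical_shift_count:
  assumes lat: "lattice \<Lambda>" and lam: "lamination \<Lambda> X" and nl: "\<not> has_invariant_line_segment X"
    and fb: "flow_box \<Lambda> X U T \<phi>" and z0: "z0 \<in> ball 0 1" and t0: "t0 \<in> T"
  shows "\<exists>s>0. \<exists>A>0. \<exists>\<epsilon>0>0. \<forall>\<epsilon>. 0 < cmod \<epsilon> \<longrightarrow> cmod \<epsilon> < \<epsilon>0 \<longrightarrow>
    (\<forall>t1\<in>T \<inter> ball t0 s. \<forall>t2\<in>T \<inter> ball t0 s.
      finite (meets \<phi> (ball z0 s) (0, \<epsilon>) t1 t2) \<and>
      real (card (meets \<phi> (ball z0 s) (0, \<epsilon>) t1 t2)) \<le> A * ln (1 / cmod \<epsilon>))"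
proof (rule ccontr)
  assume "\<not> ?thesis"
  define Q where "Q = (\<lambda>s A \<epsilon>0. \<forall>\<epsilon>. 0 < cmod \<epsilon> \<longrightarrow> cmod \<epsilon> < \<epsilon>0 \<longrightarrow>
    (\<forall>t1\<in>T \<inter> ball t0 s. \<forall>t2\<in>T \<inter> ball t0 s.
      finite (meets \<phi> (ball z0 s) (0, \<epsilon>) t1 t2) \<and>
      real (card (meets \<phi> (ball z0 s) (0, \<epsilon>) t1 t2)) \<le> A * ln (1 / cmod \<epsilon>)))"
  with \<open>\<not> ?thesis\<close> have neg: "\<And>s A \<epsilon>0. 0 < s \<Longrightarrow> 0 < A \<Longrightarrow> 0 < \<epsilon>0 \<Longrightarrow> \<not> Q s A \<epsilon>0" by blast
  obtain d0 where d0: "0 < d0" "ball z0 d0 \<subseteq> ball 0 1" using z0 by (meson open_ball openE)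
  \<comment> \<open>Size, constant and shift bound are tied to one index, so that the negated claim
    yields a single sequence: the parameters tend to \<open>t0\<close> and \<open>e n\<close> to 0,
    while the constant \<open>Suc n\<close> grows.\<close>
  define s where "s = (\<lambda>n. d0 / real (Suc n))"
  have s: "0 < s n" for n using d0 by (simp add: s_def)
  have "\<exists>\<epsilon> t1 t2 Z. 0 < cmod \<epsilon> \<and> cmod \<epsilon> < 1 / real (Suc n) \<and> t1 \<in> T \<inter> ball t0 (s n) \<and> t2 \<in> T \<inter> ball t0 (s n) \<and>
     finite Z \<and> Z \<subseteq> meets \<phi> (ball z0 (s n)) (0, \<epsilon>) t1 t2 \<and> real (Suc n) * ln (1 / cmod \<epsilon>) \<le> real (card Z)" for n
  proof -
    have "\<not> Q (s n) (real (Suc n)) (1 / real (Suc n))" by (rule neg[OF s]) auto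
    then have "\<exists>\<epsilon>. 0 < cmod \<epsilon> \<and> cmod \<epsilon> < 1 / real (Suc n) \<and> (\<exists>t1\<in>T \<inter> ball t0 (s n). \<exists>t2\<in>T \<inter> ball t0 (s n).
        \<not> (finite (meets \<phi> (ball z0 (s n)) (0, \<epsilon>) t1 t2) \<and> real (card (meets \<phi> (ball z0 (s n)) (0, \<epsilon>) t1 t2)) \<le> real (Suc n) * ln (1 / cmod \<epsilon>)))"
      unfolding Q_def by (simp only: not_all not_imp ball_simps)
    then obtain \<epsilon> t1 t2 where 1: "0 < cmod \<epsilon>" "cmod \<epsilon> < 1 / real (Suc n)" "t1 \<in> T \<inter> ball t0 (s n)" "t2 \<in> T \<inter> ball t0 (s n)"
      and 2: "\<not> (finite (meets \<phi> (ball z0 (s n)) (0, \<epsilon>) t1 t2) \<and> real (card (meets \<phi> (ball z0 (s n)) (0, \<epsilon>) t1 t2)) \<le> real (Suc n) * ln (1 / cmod \<epsilon>))"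
      by (elim exE conjE bexE) (rule that)
    show ?thesis using 1 large_finite_subset[OF 2] by (elim exE) (intro exI conjI; assumption | blast)
  qed
  then obtain e t1 t2 Z where es: "\<And>n. 0 < cmod (e n)" "\<And>n. cmod (e n) < 1 / real (Suc n)"
    and t: "\<And>n. t1 n \<in> T \<inter> ball t0 (s n)" "\<And>n. t2 n \<in> T \<inter> ball t0 (s n)"
    and Z: "\<And>n. finite (Z n)" "\<And>n. Z n \<subseteq> meets \<phi> (ball z0 (s n)) (0, e n) (t1 n) (t2 n)"
      "\<And>n. real (Suc n) * ln (1 / cmod (e n)) \<le> real (card (Z n))"
    by metis
  have lim_inv: "(\<lambda>n. c / real (Suc n)) \<longlonglongrightarrow> 0" for c :: real by (rule LIMSEQ_Suc[OF lim_const_over_n])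
  have e0: "e \<longlonglongrightarrow> 0"
    by (rule Lim_null_comparison[OF always_eventually lim_inv[of 1]]) (use es(2) in \<open>auto intro: less_imp_le\<close>)
  have en: "e n \<noteq> 0" for n using es(1)[of n] by auto
  have slim: "s \<longlonglongrightarrow> 0" unfolding s_def by (rule lim_inv)
  have "(\<lambda>n. t2 n - t0) \<longlonglongrightarrow> 0"
    by (rule Lim_null_comparison[OF always_eventually slim])
      (use t(2) in \<open>auto simp: dist_norm norm_minus_commute intro: less_imp_le\<close>)
  then have t2lim: "t2 \<longlonglongrightarrow> t0" by (simp add: LIM_zero_iff)
  interpret shifted_lamination \<Lambda> X e
    by unfold_locales (use lat lam nl e0 en in auto)
  have Zcard: "real n * ln (1 / cmod (e n)) \<le> real (card (Z n))" for n
  proof -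
    have "cmod (e n) < 1" using es(2)[of n] by (rule less_le_trans) simp
    then have "0 \<le> ln (1 / cmod (e n))" using es(1)[of n] by simp
    then have "real n * ln (1 / cmod (e n)) \<le> real (Suc n) * ln (1 / cmod (e n))" by (intro mult_right_mono) auto
    then show ?thesis using Z(3)[of n] by linarith
  qed
  have Zmem: "\<exists>z w. z \<in> ball z0 (s n) \<and> w \<in> ball z0 (s n) \<and> q = \<phi> (z, t1 n) \<and> q = \<phi> (w, t2 n) + (0, e n)" if "q \<in> Z n" for q n
    using Z(2)[of n] that unfolding meets_def by blast
  have cont: "continuous_on (ball 0 1 \<times> T) \<phi>"
    using fb unfolding flow_box_def homeomorphism_def by blast
  define p where "p = \<phi> (z0, t0)"
  have "continuous_on T (\<lambda>t. \<phi> (z0, t))"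
    by (rule continuous_on_compose2[OF cont]) (use z0 in \<open>auto intro!: continuous_intros\<close>)
  then have \<phi>lim: "(\<lambda>n. \<phi> (z0, t2 n)) \<longlonglongrightarrow> p"
    unfolding p_def by (rule continuous_on_tendsto_compose[OF _ t2lim t0]) (use t(2) in auto)
  show False
  proof (cases "deriv (\<lambda>w. fst (\<phi> (w, t0))) z0 = 0")
    case False
    obtain r d where rd: "0 < r" "0 < d" "ball z0 d \<subseteq> ball 0 1"
      and ch: "\<And>t. t \<in> T \<inter> ball t0 d \<Longrightarrow> \<exists>f. vgraph X f (fst p) r \<and>
        (\<forall>x\<in>ball (fst p) r. cmod (f x - snd p) \<le> 1) \<and>
        (\<forall>z\<in>ball z0 d. fst (\<phi> (z, t)) \<in> ball (fst p) (r/16) \<and> f (fst (\<phi> (z, t))) = snd (\<phi> (z, t)))"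
      by (rule flow_box_chart[OF fb z0 t0 False, folded p_def]) (rule that, assumption+)
    define B where "B = cmod (snd p) + 1"
    define good where "good = (\<lambda>t f. vgraph X f (fst p) r \<and> (\<forall>x\<in>ball (fst p) r. cmod (f x) \<le> B) \<and>
        (\<forall>z\<in>ball z0 d. fst (\<phi> (z, t)) \<in> ball (fst p) (r/16) \<and> f (fst (\<phi> (z, t))) = snd (\<phi> (z, t))))"
    have ex: "\<exists>f. good t f" if tT: "t \<in> T \<inter> ball t0 d" for t
    proof -
      obtain f where f: "vgraph X f (fst p) r" "\<forall>x\<in>ball (fst p) r. cmod (f x - snd p) \<le> 1"
        "\<forall>z\<in>ball z0 d. fst (\<phi> (z, t)) \<in> ball (fst p) (r/16) \<and> f (fst (\<phi> (z, t))) = snd (\<phi> (z, t))"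
        using ch[OF tT] by blast
      have "cmod (f x) \<le> B" if "x \<in> ball (fst p) r" for x
        using bounded_of_vchart[of f x "snd p" 1] f(2) that unfolding B_def by blast
      then show ?thesis using f unfolding good_def by blast
    qed
    define F where "F = (\<lambda>t. SOME f. good t f)"
    have F: "good t (F t)" if "t \<in> T \<inter> ball t0 d" for t
      unfolding F_def by (rule someI_ex[OF ex[OF that]])
    have evs: "\<forall>\<^sub>F n in sequentially. s n < d" using order_tendstoD(2)[OF slim rd(2)] .
    have ev: "\<forall>\<^sub>F n in sequentially. good (t1 n) (F (t1 n)) \<and> good (t2 n) (F (t2 n)) \<and> s n < d"
      using evs
    proof eventually_elim
      case (elim n)
      then have "t1 n \<in> T \<inter> ball t0 d" "t2 n \<in> T \<inter> ball t0 d" using t[of n] by auto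
      then show ?case using F elim by blast
    qed
    \<comment> \<open>An intersection point lies over a zero of
      \<open>F (t1 n) x - F (t2 n) x - e n\<close>, and \<open>fst\<close> is injective on
      \<open>Z n\<close> because its points lie on one graph; so no intersection is lost in counting
      zeros.\<close>
    have rap: "rapid e (ball (fst p) (r/2)) (\<lambda>n x. F (t1 n) x - F (t2 n) x - e n)"
    proof (rule rapid_of_many_zeros[OF e0 en rd(1), where B = "2 * B + 1" and Z = "\<lambda>n. fst ` Z n"])
      show "\<forall>\<^sub>F n in sequentially. (\<lambda>x. F (t1 n) x - F (t2 n) x - e n) holomorphic_on ball (fst p) r \<and>
        (\<forall>w\<in>ball (fst p) r. cmod (F (t1 n) w - F (t2 n) w - e n) \<le> 2 * B + 1) \<and>
        finite (fst ` Z n) \<and> fst ` Z n \<subseteq> ball (fst p) (r/8) \<and> (\<forall>w\<in>fst ` Z n. F (t1 n) w - F (t2 n) w - e n = 0) \<and>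
        real n * ln (1 / cmod (e n)) \<le> real (card (fst ` Z n))"
        using ev
      proof eventually_elim
        case (elim n)
        then have g: "good (t1 n) (F (t1 n))" "good (t2 n) (F (t2 n))" and sd: "s n < d" by auto
        have q: "fst q \<in> ball (fst p) (r/16) \<and> F (t1 n) (fst q) = snd q \<and> F (t2 n) (fst q) = snd q - e n" if qZ: "q \<in> Z n" for q
        proof -
          obtain z w where zw: "z \<in> ball z0 (s n)" "w \<in> ball z0 (s n)" "q = \<phi> (z, t1 n)" "q = \<phi> (w, t2 n) + (0, e n)"
            using Zmem[OF qZ] by blast
          have zd: "z \<in> ball z0 d" "w \<in> ball z0 d" using zw sd by auto
          have "fst q \<in> ball (fst p) (r/16) \<and> F (t1 n) (fst q) = snd q"
            using g(1) zd(1) unfolding good_def zw(3) by blast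
          moreover have "F (t2 n) (fst (\<phi> (w, t2 n))) = snd (\<phi> (w, t2 n))"
            using g(2) zd(2) unfolding good_def by blast
          then have "F (t2 n) (fst q) = snd q - e n" by (simp add: zw(4))
          ultimately show ?thesis by blast
        qed
        have "cmod (F (t1 n) x - F (t2 n) x - e n) \<le> 2 * B + 1" if "x \<in> ball (fst p) r" for x
        proof -
          have "cmod (F (t1 n) x) \<le> B" "cmod (F (t2 n) x) \<le> B" using g that by (auto simp: good_def)
          moreover have "cmod (e n) \<le> 1" using es(2)[of n] by (rule order_trans[OF less_imp_le]) simp
          ultimately show ?thesis
            using norm_triangle_ineq4[of "F (t1 n) x - F (t2 n) x" "e n"] norm_triangle_ineq4[of "F (t1 n) x" "F (t2 n) x"] by linarith
        qed
        moreover have "inj_on fst (Z n)"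
        proof (rule inj_onI)
          fix q q' assume "q \<in> Z n" "q' \<in> Z n" and eq: "fst q = fst q'"
          then have "F (t1 n) (fst q) = snd q" "F (t1 n) (fst q') = snd q'" using q by blast+
          with eq show "q = q'" by (simp add: prod_eq_iff)
        qed
        then have "card (fst ` Z n) = card (Z n)" by (rule card_image)
        moreover have "fst ` Z n \<subseteq> ball (fst p) (r/8)" using q rd(1) by fastforce
        ultimately show ?case using g q Z(1)[of n] Zcard[of n]
          by (auto simp: good_def vgraph_def intro!: holomorphic_intros)
      qed
    qed
    have lim: "(\<lambda>n. F (t2 n) (fst p)) \<longlonglongrightarrow> snd p"
    proof (rule center_limit[OF _ rd(1), where B = B and x = "\<lambda>n. fst (\<phi> (z0, t2 n))"])
      show "\<forall>\<^sub>F n in sequentially. F (t2 n) holomorphic_on ball (fst p) r \<and> (\<forall>w\<in>ball (fst p) r. cmod (F (t2 n) w) \<le> B)"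
        using ev by eventually_elim (auto simp: good_def vgraph_def)
      show "(\<lambda>n. fst (\<phi> (z0, t2 n))) \<longlonglongrightarrow> fst p" by (rule tendsto_fst[OF \<phi>lim])
      have "\<forall>\<^sub>F n in sequentially. snd (\<phi> (z0, t2 n)) = F (t2 n) (fst (\<phi> (z0, t2 n)))"
        using ev by eventually_elim (use rd(2) in \<open>auto simp: good_def\<close>)
      then show "(\<lambda>n. F (t2 n) (fst (\<phi> (z0, t2 n)))) \<longlonglongrightarrow> snd p"
        by (rule Lim_transform_eventually[OF tendsto_snd[OF \<phi>lim]])
    qed
    have "osculating p" unfolding osculating_def
    proof (intro exI conjI)
      show "0 < r/2" using rd by simp
      have sub: "ball (fst p) (r/2) \<subseteq> ball (fst p) r" using rd(1) by auto
      show "\<forall>\<^sub>F n in sequentially. vgraph X (F (t1 n)) (fst p) (r/2) \<and> vgraph X (F (t2 n)) (fst p) (r/2) \<and>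
        (\<forall>x\<in>ball (fst p) (r/2). cmod (F (t1 n) x) \<le> B \<and> cmod (F (t2 n) x) \<le> B)"
        using ev
      proof eventually_elim
        case (elim n)
        then show ?case using sub unfolding good_def by (blast intro: vgraph_subset)
      qed
    qed (rule lim, rule rap)
    then show False using not_osculating by blast
  next
    case True
    define \<phi>' where "\<phi>' = prod.swap \<circ> \<phi>"
    have fb': "flow_box (prod.swap ` \<Lambda>) (prod.swap ` X) (prod.swap ` U) T \<phi>'"
      unfolding \<phi>'_def by (rule flow_box_swap[OF fb])
    define p' where "p' = prod.swap p"
    have p': "\<phi>' (z0, t0) = p'" "fst p' = snd p" "snd p' = fst p" by (auto simp: \<phi>'_def p_def p'_def)
    have nz: "deriv (\<lambda>w. fst (\<phi>' (w, t0))) z0 \<noteq> 0" using flow_box_immersion[OF fb z0 t0] True by (simp add: \<phi>'_def)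
    have z: "deriv (\<lambda>w. snd (\<phi>' (w, t0))) z0 = 0" using True by (simp add: \<phi>'_def)
    obtain r d where rd: "0 < r" "0 < d" "ball z0 d \<subseteq> ball 0 1"
      and ch: "\<And>t. t \<in> T \<inter> ball t0 d \<Longrightarrow> \<exists>f. vgraph (prod.swap ` X) f (fst p') r \<and>
        (\<forall>x\<in>ball (fst p') r. cmod (f x - snd p') \<le> 1) \<and>
        (\<forall>z\<in>ball z0 d. fst (\<phi>' (z, t)) \<in> ball (fst p') (r/16) \<and> f (fst (\<phi>' (z, t))) = snd (\<phi>' (z, t)))"
      by (rule flow_box_chart[OF fb' z0 t0 nz, unfolded p'(1)]) (rule that, assumption+)
    define b where "b = snd p"
    define B where "B = cmod (fst p) + 1"
    define good where "good = (\<lambda>t f. vgraph (prod.swap ` X) f b r \<and> (\<forall>x\<in>ball b r. cmod (f x) \<le> B) \<and>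
        (\<forall>z\<in>ball z0 d. snd (\<phi> (z, t)) \<in> ball b (r/16) \<and> f (snd (\<phi> (z, t))) = fst (\<phi> (z, t))))"
    have ex: "\<exists>f. good t f" if tT: "t \<in> T \<inter> ball t0 d" for t
    proof -
      obtain f where f: "vgraph (prod.swap ` X) f b r" "\<forall>x\<in>ball b r. cmod (f x - fst p) \<le> 1"
        "\<forall>z\<in>ball z0 d. snd (\<phi> (z, t)) \<in> ball b (r/16) \<and> f (snd (\<phi> (z, t))) = fst (\<phi> (z, t))"
        using ch[OF tT] unfolding p'(2,3) b_def[symmetric] \<phi>'_def by auto
      have "cmod (f x) \<le> B" if "x \<in> ball b r" for x
        using bounded_of_vchart[of f x "fst p" 1] f(2) that unfolding B_def by blast
      then show ?thesis using f unfolding good_def by blast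
    qed
    define F where "F = (\<lambda>t. SOME f. good t f)"
    have F: "good t (F t)" if "t \<in> T \<inter> ball t0 d" for t
      unfolding F_def by (rule someI_ex[OF ex[OF that]])
    have evs: "\<forall>\<^sub>F n in sequentially. s n < d" using order_tendstoD(2)[OF slim rd(2)] .
    have ev: "\<forall>\<^sub>F n in sequentially. good (t1 n) (F (t1 n)) \<and> good (t2 n) (F (t2 n)) \<and> s n < d"
      using evs
    proof eventually_elim
      case (elim n)
      then have "t1 n \<in> T \<inter> ball t0 d" "t2 n \<in> T \<inter> ball t0 d" using t[of n] by auto
      then show ?case using F elim by blast
    qed
    define h where "h = F t0"
    have h: "good t0 h" unfolding h_def by (rule F) (use t0 rd in auto)
    have hb: "h b = fst p" using h rd(2) unfolding good_def b_def p_def by simp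
    have holh: "h holomorphic_on ball b r" using h by (simp add: good_def vgraph_def)
    \<comment> \<open>Over the second coordinate intersections are zeros of
      \<open>F (t1 n) y - F (t2 n) (y - e n)\<close>. The smaller radius leaves room for the shifted
      argument and still satisfies \<open>r/16 \<le> R/8\<close>.\<close>
    define R where "R = 3 * r / 4"
    have R: "0 < R" "R \<le> r" "r/16 \<le> R/8" using rd(1) by (auto simp: R_def)
    have rap: "rapid e (ball b (R/2)) (\<lambda>n y. F (t1 n) y - F (t2 n) (y - e n))"
    proof (rule rapid_of_many_zeros[OF e0 en R(1), where B = "2 * B" and Z = "\<lambda>n. snd ` Z n"])
      have r5: "0 < r/5" using rd(1) by simp
      show "\<forall>\<^sub>F n in sequentially. (\<lambda>y. F (t1 n) y - F (t2 n) (y - e n)) holomorphic_on ball b R \<and>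
        (\<forall>w\<in>ball b R. cmod (F (t1 n) w - F (t2 n) (w - e n)) \<le> 2 * B) \<and>
        finite (snd ` Z n) \<and> snd ` Z n \<subseteq> ball b (R/8) \<and> (\<forall>w\<in>snd ` Z n. F (t1 n) w - F (t2 n) (w - e n) = 0) \<and>
        real n * ln (1 / cmod (e n)) \<le> real (card (snd ` Z n))"
        using ev eventually_mult_norm_le[OF e0 r5, of 1]
      proof eventually_elim
        case (elim n)
        then have g: "good (t1 n) (F (t1 n))" "good (t2 n) (F (t2 n))" and sd: "s n < d" and er: "cmod (e n) \<le> r/5" by auto
        have q: "snd q \<in> ball b (r/16) \<and> F (t1 n) (snd q) = fst q \<and> F (t2 n) (snd q - e n) = fst q" if qZ: "q \<in> Z n" for q
        proof -
          obtain z w where zw: "z \<in> ball z0 (s n)" "w \<in> ball z0 (s n)" "q = \<phi> (z, t1 n)" "q = \<phi> (w, t2 n) + (0, e n)"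
            using Zmem[OF qZ] by blast
          have zd: "z \<in> ball z0 d" "w \<in> ball z0 d" using zw sd by auto
          have "snd q \<in> ball b (r/16) \<and> F (t1 n) (snd q) = fst q"
            using g(1) zd(1) unfolding good_def zw(3) by blast
          moreover have "F (t2 n) (snd (\<phi> (w, t2 n))) = fst (\<phi> (w, t2 n))"
            using g(2) zd(2) unfolding good_def by blast
          then have "F (t2 n) (snd q - e n) = fst q" by (simp add: zw(4))
          ultimately show ?thesis by blast
        qed
        have sub: "w - e n \<in> ball b r" if "w \<in> ball b R" for w
        proof -
          have "dist b (w - e n) \<le> dist b w + cmod (e n)" using norm_triangle_ineq[of "b - w" "e n"] by (simp add: dist_norm algebra_simps)
          then show ?thesis using that er rd(1) by (simp add: R_def)
        qed
        have sub1: "w \<in> ball b r" if "w \<in> ball b R" for w using that R(2) by auto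
        have hol: "F (t1 n) holomorphic_on ball b r" "F (t2 n) holomorphic_on ball b r" using g by (auto simp: good_def vgraph_def)
        have "(F (t2 n) \<circ> (\<lambda>y. y - e n)) holomorphic_on ball b R"
          by (rule holomorphic_on_compose_gen[OF _ hol(2)]) (use sub in \<open>auto intro!: holomorphic_intros\<close>)
        moreover have "F (t1 n) holomorphic_on ball b R" using hol(1) sub1 by (auto intro: holomorphic_on_subset)
        ultimately have "(\<lambda>y. F (t1 n) y - F (t2 n) (y - e n)) holomorphic_on ball b R"
          by (auto simp: o_def intro!: holomorphic_intros)
        moreover have "cmod (F (t1 n) w - F (t2 n) (w - e n)) \<le> 2 * B" if "w \<in> ball b R" for w
        proof -
          have "cmod (F (t1 n) w) \<le> B" "cmod (F (t2 n) (w - e n)) \<le> B" using g sub[OF that] sub1[OF that] unfolding good_def by blast+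
          then show ?thesis using norm_triangle_ineq4[of "F (t1 n) w" "F (t2 n) (w - e n)"] by linarith
        qed
        moreover have "inj_on snd (Z n)"
        proof (rule inj_onI)
          fix q q' assume "q \<in> Z n" "q' \<in> Z n" and eq: "snd q = snd q'"
          then have "F (t1 n) (snd q) = fst q" "F (t1 n) (snd q') = fst q'" using q by blast+
          with eq show "q = q'" by (simp add: prod_eq_iff)
        qed
        then have "card (snd ` Z n) = card (Z n)" by (rule card_image)
        moreover have "snd ` Z n \<subseteq> ball b (R/8)" using q R(3) by fastforce
        moreover have "\<forall>w\<in>snd ` Z n. F (t1 n) w - F (t2 n) (w - e n) = 0" using q by auto
        ultimately show ?case using Z(1)[of n] Zcard[of n] by simp
      qed
    qed
    have "deriv h b \<noteq> 0"
    proof (rule shifted_graphs_deriv_nonzero[OF e0 en rd(1), of "R/2"])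
      show "\<not> deriv h constant_on ball b r"
        using affine_vgraph_imp_line[of _ h b r] h rd(1) no_line_swap[OF nl] by (auto simp: good_def)
      show "\<forall>\<^sub>F n in sequentially. F (t1 n) holomorphic_on ball b r \<and> F (t2 n) holomorphic_on ball b r \<and>
        (\<forall>w\<in>ball b r. cmod (F (t1 n) w) \<le> B \<and> cmod (F (t2 n) w) \<le> B) \<and>
        ((\<forall>w\<in>ball b r. F (t1 n) w \<noteq> F (t2 n) w) \<or> (\<forall>w\<in>ball b r. F (t1 n) w = F (t2 n) w)) \<and>
        ((\<forall>w\<in>ball b r. F (t2 n) w \<noteq> h w) \<or> (\<forall>w\<in>ball b r. F (t2 n) w = h w))"
        using ev
      proof eventually_elim
        case (elim n)
        have v: "vgraph (prod.swap ` X) (F (t1 n)) b r" "vgraph (prod.swap ` X) (F (t2 n)) b r" "vgraph (prod.swap ` X) h b r"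
          using elim h by (auto simp: good_def)
        show ?case using elim dichH[OF v(1,2)] dichH[OF v(2,3)] v by (simp add: good_def vgraph_def)
      qed
      show "(\<lambda>n. F (t2 n) b) \<longlonglongrightarrow> h b"
      proof (rule center_limit[OF _ rd(1), where B = B and x = "\<lambda>n. snd (\<phi> (z0, t2 n))"])
        show "\<forall>\<^sub>F n in sequentially. F (t2 n) holomorphic_on ball b r \<and> (\<forall>w\<in>ball b r. cmod (F (t2 n) w) \<le> B)"
          using ev by eventually_elim (auto simp: good_def vgraph_def)
        show "(\<lambda>n. snd (\<phi> (z0, t2 n))) \<longlonglongrightarrow> b" unfolding b_def by (rule tendsto_snd[OF \<phi>lim])
        have "\<forall>\<^sub>F n in sequentially. fst (\<phi> (z0, t2 n)) = F (t2 n) (snd (\<phi> (z0, t2 n)))"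
          using ev by eventually_elim (use rd(2) in \<open>auto simp: good_def\<close>)
        then show "(\<lambda>n. F (t2 n) (snd (\<phi> (z0, t2 n)))) \<longlonglongrightarrow> h b"
          unfolding hb by (rule Lim_transform_eventually[OF tendsto_fst[OF \<phi>lim]])
      qed
      show "cmod (h w) \<le> B" if "w \<in> ball b r" for w using h that by (auto simp: good_def)
    qed (use holh rap rd(1) R(1) in auto)
    moreover have "deriv h (fst (\<phi>' (z0, t0))) = 0"
      by (rule flow_box_tangent[OF fb' z0 t0 nz z rd(2,3) _ rd(1)])
        (use holh h in \<open>auto simp: good_def \<phi>'_def b_def p_def\<close>)
    ultimately show False by (simp add: p' b_def)
  qed
qed

section \<open>Shrinking flow boxes\<close>

text \<open>\<open>flow_box\<close> prescribes the unit disc, so the smaller disc is rescaled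
  affinely. As \<open>\<phi>\<close> is a homeomorphism, the image of the smaller parameter set is
  relatively open in \<open>X \<inter> U\<close>, which supplies \<open>W\<close>.\<close>

lemma flow_box_restrict:
  assumes fb: "flow_box \<Lambda> X U T \<phi>" and s: "0 < s" "ball z0 s \<subseteq> ball 0 1" and t0: "t0 \<in> T"
  obtains W where "flow_box \<Lambda> X W (T \<inter> ball t0 s) (\<lambda>q. \<phi> (z0 + of_real s * fst q, snd q))" "\<phi> (z0, t0) \<in> W"
proof -
  define T' where "T' = T \<inter> ball t0 s"
  define \<sigma> where "\<sigma> = (\<lambda>q :: complex \<times> c2. (z0 + of_real s * fst q, snd q))"
  obtain \<psi> where \<psi>: "homeomorphism (ball 0 1 \<times> T) (X \<inter> U) \<phi> \<psi>" using fb by (auto simp: flow_box_def)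
  define V where "V = ball z0 s \<times> T'"
  have sc: "z0 + of_real s * w \<in> ball z0 s \<longleftrightarrow> w \<in> ball 0 1" for w
    using s(1) by (simp add: dist_norm norm_mult)
  have \<sigma>: "homeomorphism (ball 0 1 \<times> T') V \<sigma> (\<lambda>q. ((fst q - z0) / of_real s, snd q))"
    unfolding V_def \<sigma>_def
  proof (rule homeomorphismI)
    show "(\<lambda>q. (z0 + of_real s * fst q, snd q)) ` (ball 0 1 \<times> T') \<subseteq> ball z0 s \<times> T'" using sc by auto
    have "(y - z0) / of_real s \<in> ball 0 1" if "y \<in> ball z0 s" for y
      using that s(1) by (simp add: dist_norm norm_divide norm_minus_commute)
    then show "(\<lambda>q. ((fst q - z0) / of_real s, snd q)) ` (ball z0 s \<times> T') \<subseteq> ball 0 1 \<times> T'" by auto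
  qed (use s in \<open>auto intro!: continuous_intros\<close>)
  have VT: "V \<subseteq> ball 0 1 \<times> T" using s(2) by (auto simp: V_def T'_def)
  have "openin (top_of_set (ball 0 1 \<times> T)) V"
  proof -
    have "V = (ball 0 1 \<times> T) \<inter> (ball z0 s \<times> ball t0 s)" using s(2) by (auto simp: V_def T'_def)
    moreover have "open (ball z0 s \<times> ball t0 s)" by (intro open_Times) auto
    ultimately show ?thesis by (simp add: openin_open_Int)
  qed
  then have "openin (top_of_set (X \<inter> U)) (\<phi> ` V)" using homeomorphism_imp_open_map[OF \<psi>] by simp
  then obtain W0 where W0: "open W0" "\<phi> ` V = (X \<inter> U) \<inter> W0" by (auto simp: openin_open)
  define W where "W = U \<inter> W0"
  have XW: "X \<inter> W = \<phi> ` V" using W0 by (auto simp: W_def)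
  have "homeomorphism V (\<phi> ` V) \<phi> \<psi>"
    by (rule homeomorphism_of_subsets[OF \<psi> VT subset_refl refl])
  from homeomorphism_compose[OF \<sigma> this]
  have hom: "\<exists>\<psi>'. homeomorphism (ball 0 1 \<times> T') (X \<inter> W) (\<phi> \<circ> \<sigma>) \<psi>'" unfolding XW by blast
  have "flow_box \<Lambda> X W T' (\<phi> \<circ> \<sigma>)"
    unfolding flow_box_def
  proof (intro conjI ballI hom)
    show "open W" using fb W0 by (auto simp: W_def flow_box_def)
    show "x - y \<in> \<Lambda> \<longrightarrow> x = y" if "x \<in> W" "y \<in> W" for x y
      using fb that by (auto simp: W_def flow_box_def)
    fix t assume "t \<in> T'"
    then have t: "t \<in> T" by (simp add: T'_def)
    define u v where "u = (\<lambda>z. fst (\<phi> (z, t)))" and "v = (\<lambda>z. snd (\<phi> (z, t)))"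
    have hol: "u holomorphic_on ball 0 1" "v holomorphic_on ball 0 1" using fb t by (auto simp: u_def v_def flow_box_def)
    have in1: "z0 + of_real s * w \<in> ball 0 1" if "w \<in> ball 0 1" for w using sc that s(2) by blast
    have comp: "(\<lambda>w. g (z0 + of_real s * w)) holomorphic_on ball 0 1" if "g holomorphic_on ball 0 1" for g
    proof -
      have "(g \<circ> (\<lambda>w. z0 + of_real s * w)) holomorphic_on ball 0 1"
        by (rule holomorphic_on_compose_gen[OF _ that]) (use in1 in \<open>auto intro!: holomorphic_intros\<close>)
      then show ?thesis by (simp add: o_def)
    qed
    have der: "deriv (\<lambda>w. g (z0 + of_real s * w)) z = deriv g (z0 + of_real s * z) * of_real s"
      if "g holomorphic_on ball 0 1" "z \<in> ball 0 1" for g z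
    proof (rule DERIV_imp_deriv)
      have "(g has_field_derivative deriv g (z0 + of_real s * z)) (at (z0 + of_real s * z))"
        using that in1 by (intro holomorphic_derivI[of _ "ball 0 1"]) auto
      then show "((\<lambda>w. g (z0 + of_real s * w)) has_field_derivative deriv g (z0 + of_real s * z) * of_real s) (at z)"
        by (rule DERIV_chain2[where g = "\<lambda>w. z0 + of_real s * w"]) (auto intro!: derivative_eq_intros)
    qed
    show "(\<lambda>z. fst ((\<phi> \<circ> \<sigma>) (z, t))) holomorphic_on ball 0 1" "(\<lambda>z. snd ((\<phi> \<circ> \<sigma>) (z, t))) holomorphic_on ball 0 1"
      using comp[OF hol(1)] comp[OF hol(2)] by (simp_all add: \<sigma>_def u_def v_def)
    fix z :: complex assume z: "z \<in> ball 0 1"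
    have "deriv u (z0 + of_real s * z) \<noteq> 0 \<or> deriv v (z0 + of_real s * z) \<noteq> 0"
      unfolding u_def v_def by (rule flow_box_immersion[OF fb in1[OF z] t])
    then show "deriv (\<lambda>w. fst ((\<phi> \<circ> \<sigma>) (w, t))) z \<noteq> 0 \<or> deriv (\<lambda>w. snd ((\<phi> \<circ> \<sigma>) (w, t))) z \<noteq> 0"
      using der[OF hol(1) z] der[OF hol(2) z] s(1) by (simp add: \<sigma>_def u_def v_def)
  qed
  moreover have "(z0, t0) \<in> V" using s(1) t0 by (simp add: V_def T'_def)
  then have "\<phi> (z0, t0) \<in> W" using XW by blast
  ultimately show thesis using that[of W] by (simp add: T'_def \<sigma>_def o_def)
qed

lemma plaque_restrict:
  assumes "0 < s"
  shows "plaque (\<lambda>q. \<phi> (z0 + of_real s * fst q, snd q)) t = (\<lambda>z. \<phi> (z, t)) ` ball z0 s"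
proof -
  have "(\<lambda>w. z0 + of_real s * w) ` ball 0 1 = ball z0 s"
  proof (intro set_eqI iffI)
    fix x assume "x \<in> (\<lambda>w. z0 + of_real s * w) ` ball 0 1"
    then show "x \<in> ball z0 s" using assms by (auto simp: dist_norm norm_mult)
  next
    fix x assume x: "x \<in> ball z0 s"
    have "x = z0 + of_real s * ((x - z0) / of_real s)" using assms by simp
    moreover have "(x - z0) / of_real s \<in> ball 0 1"
      using x assms by (simp add: dist_norm norm_divide norm_minus_commute)
    ultimately show "x \<in> (\<lambda>w. z0 + of_real s * w) ` ball 0 1" by blast
  qed
  moreover have "plaque (\<lambda>q. \<phi> (z0 + of_real s * fst q, snd q)) t = (\<lambda>z. \<phi> (z, t)) ` (\<lambda>w. z0 + of_real s * w) ` ball 0 1"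
    unfolding plaque_def image_image by simp
  ultimately show ?thesis by simp
qed

section \<open>Descent to the torus and reduction of the horizontal shift\<close>

lemma zero_in_lattice:
  assumes "lattice \<Lambda>" shows "0 \<in> \<Lambda>"
proof -
  obtain v1 v2 v3 v4 :: c2 where
    \<Lambda>: "\<Lambda> = {real_of_int a *\<^sub>R v1 + real_of_int b *\<^sub>R v2 + real_of_int c *\<^sub>R v3 + real_of_int d *\<^sub>R v4 | a b c d. True}"
    using assms unfolding lattice_def by blast
  have "0 = real_of_int 0 *\<^sub>R v1 + real_of_int 0 *\<^sub>R v2 + real_of_int 0 *\<^sub>R v3 + real_of_int 0 *\<^sub>R v4" by simp
  then show ?thesis unfolding \<Lambda> by blast
qed

lemma lattice_swap:
  assumes "lattice \<Lambda>" shows "lattice (prod.swap ` \<Lambda>)"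
proof -
  obtain v1 v2 v3 v4 :: c2 where v: "independent {v1, v2, v3, v4}" "card {v1, v2, v3, v4} = 4"
    and \<Lambda>: "\<Lambda> = {real_of_int a *\<^sub>R v1 + real_of_int b *\<^sub>R v2 + real_of_int c *\<^sub>R v3 + real_of_int d *\<^sub>R v4 | a b c d. True}"
    using assms unfolding lattice_def by blast
  have lin: "linear (prod.swap :: c2 \<Rightarrow> c2)" by (rule linearI) (auto simp: prod.swap_def)
  have inj: "inj (prod.swap :: c2 \<Rightarrow> c2)" by (simp add: inj_swap)
  have "independent (prod.swap ` {v1, v2, v3, v4})"
    using linear_independent_injective_image[OF lin v(1)] inj by (meson inj_on_subset subset_UNIV)
  moreover have "card (prod.swap ` {v1, v2, v3, v4}) = 4"
    using card_image[OF inj_on_subset[OF inj subset_UNIV]] v(2) by metis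
  moreover have "prod.swap ` \<Lambda> = {real_of_int a *\<^sub>R prod.swap v1 + real_of_int b *\<^sub>R prod.swap v2 +
      real_of_int c *\<^sub>R prod.swap v3 + real_of_int d *\<^sub>R prod.swap v4 | a b c d. True}"
    unfolding \<Lambda> image_Collect
  proof (intro Collect_cong iffI; elim exE conjE)
    fix y x a b c d assume "y = prod.swap x" "x = real_of_int a *\<^sub>R v1 + real_of_int b *\<^sub>R v2 + real_of_int c *\<^sub>R v3 + real_of_int d *\<^sub>R v4"
    then have "y = real_of_int a *\<^sub>R prod.swap v1 + real_of_int b *\<^sub>R prod.swap v2 +
      real_of_int c *\<^sub>R prod.swap v3 + real_of_int d *\<^sub>R prod.swap v4" by (simp add: prod.swap_def)
    then show "\<exists>a b c d. y = real_of_int a *\<^sub>R prod.swap v1 + real_of_int b *\<^sub>R prod.swap v2 +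
      real_of_int c *\<^sub>R prod.swap v3 + real_of_int d *\<^sub>R prod.swap v4 \<and> True" by blast
  next
    fix y a b c d assume "y = real_of_int a *\<^sub>R prod.swap v1 + real_of_int b *\<^sub>R prod.swap v2 +
      real_of_int c *\<^sub>R prod.swap v3 + real_of_int d *\<^sub>R prod.swap v4"
    then have "y = prod.swap (real_of_int a *\<^sub>R v1 + real_of_int b *\<^sub>R v2 + real_of_int c *\<^sub>R v3 + real_of_int d *\<^sub>R v4)"
      by (simp add: prod.swap_def)
    then show "\<exists>x. y = prod.swap x \<and> (\<exists>a b c d. x = real_of_int a *\<^sub>R v1 + real_of_int b *\<^sub>R v2 + real_of_int c *\<^sub>R v3 + real_of_int d *\<^sub>R v4 \<and> True)"
      by blast
  qed
  ultimately show ?thesis unfolding lattice_def by (intro exI[of _ "prod.swap v1"] exI[of _ "prod.swap v2"] exI[of _ "prod.swap v3"] exI[of _ "prod.swap v4"]) simp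
qed

lemma meets_swap: "meets (prod.swap \<circ> \<phi>) D (prod.swap e) t1 t2 = prod.swap ` meets \<phi> D e t1 t2"
proof -
  have 1: "(\<lambda>z. (prod.swap \<circ> \<phi>) (z, t)) ` D = prod.swap ` (\<lambda>z. \<phi> (z, t)) ` D" for t by (simp add: image_image)
  have 2: "(\<lambda>x. x + prod.swap e) ` prod.swap ` S = prod.swap ` (\<lambda>x. x + e) ` S" for S
    by (simp add: image_image prod.swap_def)
  show ?thesis unfolding meets_def 1 2 by (simp add: image_Int)
qed

text \<open>Points of the two pieces differ by less than \<open>\<eta>/2\<close> and the shift is
  below \<open>\<eta>/2\<close>, so they can only be identified by a lattice vector shorter than
  \<open>\<eta>\<close>, which is 0. Projection therefore creates no new intersections.\<close>

lemma tproj_meets: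
  assumes lat: "lattice \<Lambda>" and small: "\<And>l. l \<in> \<Lambda> \<Longrightarrow> norm l < \<eta> \<Longrightarrow> l = 0"
    and L: "L \<subseteq> ball p (\<eta>/4)" "L' \<subseteq> ball p (\<eta>/4)" and e: "norm e < \<eta>/2"
  shows "tproj \<Lambda> ` L \<inter> tproj \<Lambda> ` (\<lambda>x. x + e) ` L' = tproj \<Lambda> ` (L \<inter> (\<lambda>x. x + e) ` L')"
proof
  show "tproj \<Lambda> ` L \<inter> tproj \<Lambda> ` (\<lambda>x. x + e) ` L' \<subseteq> tproj \<Lambda> ` (L \<inter> (\<lambda>x. x + e) ` L')"
  proof
    fix c assume "c \<in> tproj \<Lambda> ` L \<inter> tproj \<Lambda> ` (\<lambda>x. x + e) ` L'"
    then obtain x y where xy: "x \<in> L" "y \<in> L'" "c = tproj \<Lambda> x" "tproj \<Lambda> x = tproj \<Lambda> (y + e)" by auto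
    have "x + 0 \<in> tproj \<Lambda> x" unfolding tproj_def using zero_in_lattice[OF lat] by (rule imageI)
    then obtain l where l: "l \<in> \<Lambda>" "x = y + e + l" using xy(4) by (auto simp: tproj_def)
    have "dist x y \<le> dist x p + dist p y" by (rule dist_triangle)
    then have "dist x y < \<eta>/2" using L xy(1,2) by (force simp: dist_commute)
    moreover have "norm l \<le> dist x y + norm e"
      using norm_triangle_ineq4[of "x - y" e] l(2) by (simp add: dist_norm algebra_simps)
    ultimately have "norm l < \<eta>" using e by simp
    then have "x = y + e" using small[OF l(1)] l(2) by simp
    then show "c \<in> tproj \<Lambda> ` (L \<inter> (\<lambda>x. x + e) ` L')" using xy by blast
  qed
qed blast

text \<open>The box is shrunk until both directions of translation are under control, the horizontal
  one as a vertical shift of the swapped box, and until \<open>tproj_meets\<close> applies. The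
  intersection in the torus is an image of the one in C^2, so its cardinality is no larger.\<close>

lemma good_flow_box:
  assumes lat: "lattice \<Lambda>" and lam: "lamination \<Lambda> X" and nl: "\<not> has_invariant_line_segment X" and pX: "p \<in> X"
  shows "\<exists>U T \<phi> A \<epsilon>0. flow_box \<Lambda> X U T \<phi> \<and> p \<in> U \<and> 0 < A \<and> 0 < \<epsilon>0 \<and>
    (\<forall>\<epsilon>. 0 < cmod \<epsilon> \<and> cmod \<epsilon> < \<epsilon>0 \<longrightarrow> (\<forall>e \<in> {(\<epsilon>, 0), (0, \<epsilon>)}. \<forall>t1\<in>T. \<forall>t2\<in>T.
       finite (tproj \<Lambda> ` plaque \<phi> t1 \<inter> tproj \<Lambda> ` ((\<lambda>x. x + e) ` plaque \<phi> t2)) \<and>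
       real (card (tproj \<Lambda> ` plaque \<phi> t1 \<inter> tproj \<Lambda> ` ((\<lambda>x. x + e) ` plaque \<phi> t2))) \<le> A * ln (1 / cmod \<epsilon>)))"
proof -
  obtain U T \<phi> z0 t0 where fb: "flow_box \<Lambda> X U T \<phi>" "z0 \<in> ball 0 1" "t0 \<in> T" "\<phi> (z0, t0) = p"
    using lamination_flow_box[OF lam pX] .
  obtain \<eta> where \<eta>: "0 < \<eta>" "\<And>l. l \<in> \<Lambda> \<Longrightarrow> norm l < \<eta> \<Longrightarrow> l = 0" using lattice_cocompact(2)[OF lat] by blast
  obtain s1 A1 \<epsilon>1 where 1: "0 < s1" "0 < A1" "0 < \<epsilon>1"
    and c1: "\<forall>\<epsilon>. 0 < cmod \<epsilon> \<longrightarrow> cmod \<epsilon> < \<epsilon>1 \<longrightarrow> (\<forall>t1\<in>T \<inter> ball t0 s1. \<forall>t2\<in>T \<inter> ball t0 s1.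
      finite (meets \<phi> (ball z0 s1) (0, \<epsilon>) t1 t2) \<and> real (card (meets \<phi> (ball z0 s1) (0, \<epsilon>) t1 t2)) \<le> A1 * ln (1 / cmod \<epsilon>))"
    using vertical_shift_count[OF lat lam nl fb(1-3)] by (elim exE conjE) (rule that)
  obtain s2 A2 \<epsilon>2 where 2: "0 < s2" "0 < A2" "0 < \<epsilon>2"
    and c2: "\<forall>\<epsilon>. 0 < cmod \<epsilon> \<longrightarrow> cmod \<epsilon> < \<epsilon>2 \<longrightarrow> (\<forall>t1\<in>T \<inter> ball t0 s2. \<forall>t2\<in>T \<inter> ball t0 s2.
      finite (meets (prod.swap \<circ> \<phi>) (ball z0 s2) (0, \<epsilon>) t1 t2) \<and>
      real (card (meets (prod.swap \<circ> \<phi>) (ball z0 s2) (0, \<epsilon>) t1 t2)) \<le> A2 * ln (1 / cmod \<epsilon>))"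
    using vertical_shift_count[OF lattice_swap[OF lat] lamination_swap[OF lam] no_line_swap[OF nl] flow_box_swap[OF fb(1)] fb(2,3)]
    by (elim exE conjE) (rule that)
  obtain d0 where d0: "0 < d0" "ball z0 d0 \<subseteq> ball 0 1" using fb(2) by (meson open_ball openE)
  have cont: "continuous_on (ball 0 1 \<times> T) \<phi>"
    using fb(1) unfolding flow_box_def homeomorphism_def by blast
  have "(z0, t0) \<in> ball 0 1 \<times> T" using fb(2,3) by auto
  moreover have "0 < \<eta>/4" using \<eta>(1) by simp
  ultimately obtain e3 where e3: "e3 > 0" "\<And>q. q \<in> ball 0 1 \<times> T \<Longrightarrow> dist q (z0, t0) < e3 \<Longrightarrow> dist (\<phi> q) p < \<eta>/4"
    using cont unfolding continuous_on_iff fb(4)[symmetric] by blast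
  define s where "s = min (min s1 s2) (min d0 (e3/2))"
  have s: "0 < s" "s \<le> s1" "s \<le> s2" "s \<le> d0" "s \<le> e3/2" using 1 2 d0 e3 by (auto simp: s_def)
  have sub: "ball z0 s \<subseteq> ball 0 1" using d0(2) s(4) by (auto simp: subset_iff)
  define \<phi>' where "\<phi>' = (\<lambda>q. \<phi> (z0 + of_real s * fst q, snd q))"
  obtain W where W: "flow_box \<Lambda> X W (T \<inter> ball t0 s) \<phi>'" "p \<in> W"
    using flow_box_restrict[OF fb(1) s(1) sub fb(3)] unfolding fb(4) \<phi>'_def by blast
  \<comment> \<open>The bound 1 keeps ln (1 / |\<epsilon>|) nonnegative, so that \<open>A1\<close>
    and \<open>A2\<close> may be replaced by the larger \<open>A\<close>; \<open>\<eta>/2\<close> is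
    the bound on the shift in \<open>tproj_meets\<close>.\<close>
  define \<epsilon>0 where "\<epsilon>0 = min (min \<epsilon>1 \<epsilon>2) (min 1 (\<eta>/2))"
  have \<epsilon>0: "0 < \<epsilon>0" "\<epsilon>0 \<le> \<epsilon>1" "\<epsilon>0 \<le> \<epsilon>2" "\<epsilon>0 \<le> 1" "\<epsilon>0 \<le> \<eta>/2" using 1 2 \<eta> by (auto simp: \<epsilon>0_def)
  define A where "A = max A1 A2"
  have A: "0 < A" "A1 \<le> A" "A2 \<le> A" using 1 by (auto simp: A_def)
  have pl: "plaque \<phi>' t = (\<lambda>z. \<phi> (z, t)) ` ball z0 s" for t unfolding \<phi>'_def by (rule plaque_restrict[OF s(1)])
  have plp: "plaque \<phi>' t \<subseteq> ball p (\<eta>/4)" if t: "t \<in> T \<inter> ball t0 s" for t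
  proof
    fix x assume "x \<in> plaque \<phi>' t"
    then obtain z where z: "z \<in> ball z0 s" "x = \<phi> (z, t)" unfolding pl by blast
    have "dist (z, t) (z0, t0) \<le> dist z z0 + dist t t0"
      unfolding dist_Pair_Pair by (rule sqrt_sum_squares_le_sum) auto
    then have "dist (z, t) (z0, t0) < e3" using z(1) t s(5) by (simp add: dist_commute)
    then have "dist (\<phi> (z, t)) p < \<eta>/4" using e3(2)[of "(z, t)"] z(1) sub t by auto
    then show "x \<in> ball p (\<eta>/4)" using z(2) by (simp add: dist_commute)
  qed
  have cnt: "finite (tproj \<Lambda> ` plaque \<phi>' t1 \<inter> tproj \<Lambda> ` ((\<lambda>x. x + e) ` plaque \<phi>' t2)) \<and>
       real (card (tproj \<Lambda> ` plaque \<phi>' t1 \<inter> tproj \<Lambda> ` ((\<lambda>x. x + e) ` plaque \<phi>' t2))) \<le> A * ln (1 / cmod \<epsilon>)"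
    if \<epsilon>: "0 < cmod \<epsilon>" "cmod \<epsilon> < \<epsilon>0" and e: "e \<in> {(\<epsilon>, 0), (0, \<epsilon>)}" and t: "t1 \<in> T \<inter> ball t0 s" "t2 \<in> T \<inter> ball t0 s" for \<epsilon> e t1 t2
  proof -
    have ln0: "0 \<le> ln (1 / cmod \<epsilon>)" using \<epsilon> \<epsilon>0(4) by simp
    have "norm e < \<eta>/2" using e \<epsilon>(2) \<epsilon>0(5) by (auto simp: norm_Pair)
    then have eq: "tproj \<Lambda> ` plaque \<phi>' t1 \<inter> tproj \<Lambda> ` ((\<lambda>x. x + e) ` plaque \<phi>' t2) = tproj \<Lambda> ` meets \<phi> (ball z0 s) e t1 t2"
      using tproj_meets[OF lat \<eta>(2) plp[OF t(1)] plp[OF t(2)]] unfolding meets_def pl by blast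
    have "finite (meets \<phi> (ball z0 s) e t1 t2) \<and> real (card (meets \<phi> (ball z0 s) e t1 t2)) \<le> A * ln (1 / cmod \<epsilon>)"
    proof (cases "e = (0, \<epsilon>)")
      case True
      have sub: "meets \<phi> (ball z0 s) e t1 t2 \<subseteq> meets \<phi> (ball z0 s1) (0, \<epsilon>) t1 t2"
        unfolding True by (rule meets_mono) (use s(2) in auto)
      have c: "finite (meets \<phi> (ball z0 s1) (0, \<epsilon>) t1 t2)" "real (card (meets \<phi> (ball z0 s1) (0, \<epsilon>) t1 t2)) \<le> A1 * ln (1 / cmod \<epsilon>)"
        using c1[rule_format, of \<epsilon> t1 t2] \<epsilon> \<epsilon>0(2) t s(2) by auto
      have "A1 * ln (1 / cmod \<epsilon>) \<le> A * ln (1 / cmod \<epsilon>)" using A(2) ln0 by (rule mult_right_mono)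
      then show ?thesis using c card_mono[OF c(1) sub] finite_subset[OF sub c(1)] by linarith
    next
      case False
      then have e': "prod.swap e = (0, \<epsilon>)" using e by auto
      have sub: "meets (prod.swap \<circ> \<phi>) (ball z0 s) (0, \<epsilon>) t1 t2 \<subseteq> meets (prod.swap \<circ> \<phi>) (ball z0 s2) (0, \<epsilon>) t1 t2"
        by (rule meets_mono) (use s(3) in auto)
      have c: "finite (meets (prod.swap \<circ> \<phi>) (ball z0 s2) (0, \<epsilon>) t1 t2)"
        "real (card (meets (prod.swap \<circ> \<phi>) (ball z0 s2) (0, \<epsilon>) t1 t2)) \<le> A2 * ln (1 / cmod \<epsilon>)"
        using c2[rule_format, of \<epsilon> t1 t2] \<epsilon> \<epsilon>0(3) t s(3) by auto
      have m: "meets (prod.swap \<circ> \<phi>) (ball z0 s) (0, \<epsilon>) t1 t2 = prod.swap ` meets \<phi> (ball z0 s) e t1 t2"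
        using meets_swap[of \<phi> "ball z0 s" e t1 t2] e' by simp
      have inj: "inj_on prod.swap (meets \<phi> (ball z0 s) e t1 t2)" by (rule inj_on_subset[OF inj_swap]) auto
      have "finite (meets \<phi> (ball z0 s) e t1 t2)"
        using finite_subset[OF sub c(1)] finite_imageD[OF _ inj] unfolding m by blast
      moreover have "card (meets \<phi> (ball z0 s) e t1 t2) \<le> card (meets (prod.swap \<circ> \<phi>) (ball z0 s2) (0, \<epsilon>) t1 t2)"
        using card_mono[OF c(1) sub] unfolding m card_image[OF inj] .
      moreover have "A2 * ln (1 / cmod \<epsilon>) \<le> A * ln (1 / cmod \<epsilon>)" using A(3) ln0 by (rule mult_right_mono)
      ultimately show ?thesis using c(2) by linarith
    qed
    then show ?thesis unfolding eq using card_image_le[of "meets \<phi> (ball z0 s) e t1 t2" "tproj \<Lambda>"]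
      by (meson finite_imageI of_nat_le_iff order_trans)
  qed
  show ?thesis
  proof (rule exI[of _ W], rule exI[of _ "T \<inter> ball t0 s"], rule exI[of _ \<phi>'], rule exI[of _ A], rule exI[of _ \<epsilon>0],
      intro conjI W A(1) \<epsilon>0(1) allI impI ballI)
    fix \<epsilon> e t1 t2
    assume "0 < cmod \<epsilon> \<and> cmod \<epsilon> < \<epsilon>0" "e \<in> {(\<epsilon>, 0), (0, \<epsilon>)}" "t1 \<in> T \<inter> ball t0 s" "t2 \<in> T \<inter> ball t0 s"
    then show "finite (tproj \<Lambda> ` plaque \<phi>' t1 \<inter> tproj \<Lambda> ` ((\<lambda>x. x + e) ` plaque \<phi>' t2))"
       "real (card (tproj \<Lambda> ` plaque \<phi>' t1 \<inter> tproj \<Lambda> ` ((\<lambda>x. x + e) ` plaque \<phi>' t2))) \<le> A * ln (1 / cmod \<epsilon>)"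
      using cnt[of \<epsilon> e t1 t2] by simp_all
  qed
qed

theorem theorem3p2:
  fixes \<Lambda> Xt :: "c2 set"
  assumes "lattice \<Lambda>"
    and "lamination \<Lambda> Xt"
    and "\<not> has_invariant_line_segment Xt"
  shows "\<exists>\<epsilon>0 > 0. \<exists>A > 0. \<exists>(I :: nat set) U T \<phi>.
           (\<forall>i\<in>I. flow_box \<Lambda> Xt (U i) (T i) (\<phi> i)) \<and>
           Xt \<subseteq> (\<Union>i\<in>I. \<Union>l\<in>\<Lambda>. (\<lambda>x. x + l) ` U i) \<and>
           (\<forall>\<epsilon>::complex. 0 < cmod \<epsilon> \<and> cmod \<epsilon> < \<epsilon>0 \<longrightarrow>
              (\<forall>e \<in> {(\<epsilon>, 0), (0, \<epsilon>)}. \<forall>i\<in>I. \<forall>t1\<in>T i. \<forall>t2\<in>T i.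
                 finite (tproj \<Lambda> ` plaque (\<phi> i) t1 \<inter> tproj \<Lambda> ` ((\<lambda>x. x + e) ` plaque (\<phi> i) t2)) \<and>
                 real (card (tproj \<Lambda> ` plaque (\<phi> i) t1 \<inter> tproj \<Lambda> ` ((\<lambda>x. x + e) ` plaque (\<phi> i) t2)))
                   \<le> A * ln (1 / cmod \<epsilon>)))"
proof -
  define good where "good = (\<lambda>p (U, T, \<phi>, A, \<epsilon>0). flow_box \<Lambda> Xt U T \<phi> \<and> p \<in> U \<and> 0 < A \<and> 0 < \<epsilon>0 \<and>
    (\<forall>\<epsilon>. 0 < cmod \<epsilon> \<and> cmod \<epsilon> < \<epsilon>0 \<longrightarrow> (\<forall>e \<in> {(\<epsilon>, 0), (0, \<epsilon>)}. \<forall>t1\<in>T. \<forall>t2\<in>T.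
       finite (tproj \<Lambda> ` plaque \<phi> t1 \<inter> tproj \<Lambda> ` ((\<lambda>x. x + e) ` plaque \<phi> t2)) \<and>
       real (card (tproj \<Lambda> ` plaque \<phi> t1 \<inter> tproj \<Lambda> ` ((\<lambda>x. x + e) ` plaque \<phi> t2))) \<le> A * ln (1 / cmod \<epsilon>))))"
  define b where "b = (\<lambda>p. SOME x. good p x)"
  have good: "good p (b p)" if "p \<in> Xt" for p
  proof -
    have "\<exists>x. good p x" using good_flow_box[OF assms that] unfolding good_def by auto
    then show ?thesis unfolding b_def by (rule someI_ex)
  qed
  define U where "U = (\<lambda>p. fst (b p))"
  define T where "T = (\<lambda>p. fst (snd (b p)))"
  define \<phi> where "\<phi> = (\<lambda>p. fst (snd (snd (b p))))"
  define A where "A = (\<lambda>p. fst (snd (snd (snd (b p)))))"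
  define \<epsilon>0 where "\<epsilon>0 = (\<lambda>p. snd (snd (snd (snd (b p)))))"
  have b: "b p = (U p, T p, \<phi> p, A p, \<epsilon>0 p)" for p by (simp add: U_def T_def \<phi>_def A_def \<epsilon>0_def)
  have g: "flow_box \<Lambda> Xt (U p) (T p) (\<phi> p)" "p \<in> U p" "0 < A p" "0 < \<epsilon>0 p"
    "\<And>\<epsilon> e t1 t2. 0 < cmod \<epsilon> \<Longrightarrow> cmod \<epsilon> < \<epsilon>0 p \<Longrightarrow> e \<in> {(\<epsilon>, 0), (0, \<epsilon>)} \<Longrightarrow> t1 \<in> T p \<Longrightarrow> t2 \<in> T p \<Longrightarrow>
       finite (tproj \<Lambda> ` plaque (\<phi> p) t1 \<inter> tproj \<Lambda> ` ((\<lambda>x. x + e) ` plaque (\<phi> p) t2)) \<and>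
       real (card (tproj \<Lambda> ` plaque (\<phi> p) t1 \<inter> tproj \<Lambda> ` ((\<lambda>x. x + e) ` plaque (\<phi> p) t2))) \<le> A p * ln (1 / cmod \<epsilon>)"
    if "p \<in> Xt" for p
    using good[OF that] unfolding b good_def prod.case by blast+
  obtain K where K: "compact K" "\<And>x. \<exists>l\<in>\<Lambda>. - l \<in> \<Lambda> \<and> x - l \<in> K" using lattice_cocompact(1)[OF assms(1)] by blast
  have "compact (Xt \<inter> K)" using assms(2) K(1) by (auto simp: lamination_def intro: closed_Int_compact)
  then obtain D where D: "D \<subseteq> Xt \<inter> K" "finite D" "Xt \<inter> K \<subseteq> (\<Union>p\<in>D. U p)"
  proof (rule compactE_image)
    show "open (U p)" if "p \<in> Xt \<inter> K" for p using g(1)[of p] that by (auto simp: flow_box_def)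
    show "Xt \<inter> K \<subseteq> (\<Union>p\<in>Xt \<inter> K. U p)" using g(2) by blast
  qed
  obtain f where f: "bij_betw f {0..<card D} D" using ex_bij_betw_nat_finite[OF D(2)] by blast
  define I where "I = {0..<card D}"
  have fD: "f i \<in> D" if "i \<in> I" for i using f that bij_betwE by (fastforce simp: I_def)
  have fX: "f i \<in> Xt" if "i \<in> I" for i using fD[OF that] D(1) by blast
  \<comment> \<open>Finiteness of the subcover makes a common constant and a common positive shift
    bound possible. The inserted 1 covers an empty \<open>D\<close> and, in
    \<open>\<epsilon>'\<close>, keeps the logarithm nonnegative.\<close>
  define A' where "A' = Max (insert 1 (A ` D))"
  define \<epsilon>' where "\<epsilon>' = Min (insert 1 (\<epsilon>0 ` D))"
  have A': "0 < A'" "\<And>p. p \<in> D \<Longrightarrow> A p \<le> A'" using D(2) by (auto simp: A'_def Max_gr_iff)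
  have \<epsilon>': "0 < \<epsilon>'" "\<epsilon>' \<le> 1" "\<And>p. p \<in> D \<Longrightarrow> \<epsilon>' \<le> \<epsilon>0 p" using D g(4) by (auto simp: \<epsilon>'_def)
  show ?thesis
  proof (rule exI[of _ \<epsilon>'], rule conjI[OF \<epsilon>'(1)], rule exI[of _ A'], rule conjI[OF A'(1)], rule exI[of _ I],
      rule exI[of _ "\<lambda>i. U (f i)"], rule exI[of _ "\<lambda>i. T (f i)"], rule exI[of _ "\<lambda>i. \<phi> (f i)"],
      intro conjI ballI allI impI)
    show "flow_box \<Lambda> Xt (U (f i)) (T (f i)) (\<phi> (f i))" if "i \<in> I" for i by (rule g(1)[OF fX[OF that]])
    show "Xt \<subseteq> (\<Union>i\<in>I. \<Union>l\<in>\<Lambda>. (\<lambda>x. x + l) ` U (f i))"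
    proof
      fix x assume x: "x \<in> Xt"
      obtain l where l: "l \<in> \<Lambda>" "- l \<in> \<Lambda>" "x - l \<in> K" using K(2) by blast
      have "x - l \<in> Xt" using lamination_translate(2)[OF assms(2) l(1,2) x] .
      then obtain p where p: "p \<in> D" "x - l \<in> U p" using D(3) l(3) by blast
      have "p \<in> f ` I" using f p(1) by (simp add: bij_betw_def I_def)
      then obtain i where i: "i \<in> I" "f i = p" by blast
      have "x = (x - l) + l" by simp
      then show "x \<in> (\<Union>i\<in>I. \<Union>l\<in>\<Lambda>. (\<lambda>x. x + l) ` U (f i))" using i p(2) l(1) by blast
    qed
  next
    fix \<epsilon> :: complex and e i t1 t2
    assume \<epsilon>: "0 < cmod \<epsilon> \<and> cmod \<epsilon> < \<epsilon>'" and e: "e \<in> {(\<epsilon>, 0), (0, \<epsilon>)}" and i: "i \<in> I"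
      and t: "t1 \<in> T (f i)" "t2 \<in> T (f i)"
    have "0 < cmod \<epsilon>" "cmod \<epsilon> < \<epsilon>0 (f i)" using \<epsilon> \<epsilon>'(3)[OF fD[OF i]] by auto
    note c = g(5)[OF fX[OF i] this e t]
    show "finite (tproj \<Lambda> ` plaque (\<phi> (f i)) t1 \<inter> tproj \<Lambda> ` ((\<lambda>x. x + e) ` plaque (\<phi> (f i)) t2))" using c by blast
    have "0 \<le> ln (1 / cmod \<epsilon>)" using \<epsilon> \<epsilon>'(2) by simp
    then have "A (f i) * ln (1 / cmod \<epsilon>) \<le> A' * ln (1 / cmod \<epsilon>)" using A'(2)[OF fD[OF i]] by (intro mult_right_mono)
    then show "real (card (tproj \<Lambda> ` plaque (\<phi> (f i)) t1 \<inter> tproj \<Lambda> ` ((\<lambda>x. x + e) ` plaque (\<phi> (f i)) t2))) \<le> A' * ln (1 / cmod \<epsilon>)"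
      using c by linarith
  qed
qed

end
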